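(* Let $u^{\varepsilon}$ be the exact solution of the regularized logarithmic Klein-Gordon equation and suppose it satisfies the regularity assumption (A) given in the context. Let $u^{\varepsilon,n}\in X_N$ be the solution of the CNFD scheme $$\delta_{t}^{2}u^{\varepsilon,n}_{j}-\frac{1}{2}\delta_{x}^{2}(u^{\varepsilon,n+1}_{j}+u^{\varepsilon,n-1}_{j})+\frac{1}{2}(u^{\varepsilon,n+1}_{j}+u^{\varepsilon,n-1}_{j})+G_{\varepsilon}(u^{\varepsilon,n+1}_{j},u^{\varepsilon,n-1}_{j})=0,\quad n\geq1,$$ with initial values, for $0\le j\le N$, $u^{\varepsilon,0}_j=\phi(x_j)$ and $$u_{j}^{\varepsilon,1}=\phi(x_{j})+\tau\gamma(x_{j})+\frac{\tau^{2}}{2}\left[\delta^{2}_{x}\phi(x_{j})-\phi(x_{j})-\phi(x_{j})\ln(\varepsilon^{2}+(\phi(x_{j}))^{2})\right].$$ Let $e^{\varepsilon,n}_j=u^{\varepsilon}(x_j,t_n)-u^{\varepsilon,n}_j$ and $\Lambda=\|u^{\varepsilon}\|_{L^\infty(\Omega_T)}$. Then there exist $h_{0}>0$, $\tau_{0}>0$ sufficiently small and independent of $\varepsilon$ such that, for any $0<\varepsilon\ll1$, when $0<h\leq h_{0}$ and $0<\tau\leq\tau_{0}$, for $0\le n\le \frac{T}{\tau}-1$, $$\|\delta_{x}^{+}e^{\varepsilon,n}\|_{l^{2}}+\|e^{\varepsilon,n}\|_{l^{2}}\lesssim e^{\frac{T}{2\varepsilon}}\left(h^{2}+\frac{\tau^{2}}{\varepsilon^{2}}\right),\qquad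 \|u^{\varepsilon,n}\|_{l^{\infty}}\leq\Lambda+1.$$
   Context: Equation: for $0<\varepsilon\ll1$ and $\Omega=(a,b)$ with periodic boundary conditions, $u^\varepsilon$ is the real-valued solution of $u^{\varepsilon}_{tt}-u^{\varepsilon}_{xx}+u^{\varepsilon}+u^{\varepsilon}\ln(\varepsilon^{2}+(u^{\varepsilon})^{2})=0$, $u^\varepsilon(x,0)=\phi(x)$, $\partial_tu^\varepsilon(x,0)=\gamma(x)$. Assumption (A): with $\Omega_T=\Omega\times[0,T]$, $0<T<T^*$, $T^*$ the maximal existence time of the solution, $$u^{\varepsilon}\in C([0,T];W^{5,\infty}_{p})\cap C^{2}([0,T];W^{3,\infty}_{p})\cap C^{4}([0,T];W^{1,\infty}_{p}),\qquad \left\|\frac{\partial^{r+s}}{\partial t^{r}\partial x^{s}}u^{\varepsilon}\right\|_{L^{\infty}(\Omega_{T})}\lesssim1\ \text{ for } 0\leq r\leq4,\ 0\leq r+s\leq5,$$ where $W_{p}^{m,\infty}=\{u\in W^{m,\infty}(\Omega): \frac{\partial^{l}}{\partial x^{l}}u(a)=\frac{\partial^{l}}{\partial x^{l}}u(b),\ 0\leq l\leq m-1\}$ for $m\ge1$. $p\lesssim q$ means $|p|\le Cq$ with a generic constant $C$ independent of $\tau,h,\varepsilon$. Grid: $\tau>0$ is the time step, $h=\frac{b-a}{N}$ with $N$ a positive integer, $t_n=n\tau$, $x_j=a+jh$. $X_N=\{u\in\mathbb{R}^{N+1}:u_0=u_N\}$ with periodic conventions $u_{-1}=u_{N-1}$,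 $u_{N+1}=u_1$. $\delta_t^2u_j^n=\frac{u_j^{n+1}-2u_j^n+u_j^{n-1}}{\tau^2}$, $\delta_x^{+}u_j=\frac{u_{j+1}-u_j}{h}$, $\delta_x^2u_j=\frac{u_{j+1}-2u_j+u_{j-1}}{h^2}$. $\|u\|_{l^2}^2=h\sum_{j=0}^{N-1}|u_j|^2$ (likewise for $\delta_x^+u$), $\|u\|_{l^\infty}=\sup_{0\le j\le N-1}|u_j|$. Nonlinearity: $f_\varepsilon(\rho)=\ln(\varepsilon^2+\rho)$ and $G_\varepsilon(z_1,z_2)=\int_0^1 f_\varepsilon(\theta z_1^2+(1-\theta)z_2^2)\,\mathrm{d}\theta\cdot\frac{z_1+z_2}{2}$ for $z_1,z_2\in\mathbb{R}$. *)

theory Defs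
  imports "HOL-Analysis.Analysis" "HOL-Probability.Essential_Supremum"
begin

section \<open>Lebesgue and Sobolev spaces\<close>

text \<open>
  The set \<open>S\<close> is an interval \<open>(a,b)\<close> or a space-time cylinder. The norm is extended real,
  and infinite for functions that are not essentially bounded.
\<close>

definition Linf_norm :: "'a::euclidean_space set \<Rightarrow> ('a \<Rightarrow> real) \<Rightarrow> ereal"
  where "Linf_norm S f = esssup (lebesgue_on S) (\<lambda>x. ereal \<bar>f x\<bar>)"

definition Linf :: "'a::euclidean_space set \<Rightarrow> ('a \<Rightarrow> real) set"
  where "Linf S = {f \<in> borel_measurable (lebesgue_on S). Linf_norm S f < \<infinity>}"

definition test_function :: "real \<Rightarrow> real \<Rightarrow> (real \<Rightarrow> real) \<Rightarrow> bool"
  where "test_function a b \<psi> \<longleftrightarrow>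
    (\<forall>x. \<psi> differentiable at x) \<and> continuous_on UNIV (deriv \<psi>) \<and>
    closure {x. \<psi> x \<noteq> 0} \<subseteq> {a<..<b}"

text \<open>
  As usual in one dimension, weak derivatives are tested against compactly supported \<open>C\<^sup>1\<close>
  functions; by density this is the same as testing against smooth ones.
\<close>

definition weak_deriv :: "real \<Rightarrow> real \<Rightarrow> (real \<Rightarrow> real) \<Rightarrow> (real \<Rightarrow> real) \<Rightarrow> bool"
  where "weak_deriv a b f g \<longleftrightarrow>
    (\<forall>\<psi>. test_function a b \<psi> \<longrightarrow>
      (LINT x|lebesgue_on {a<..<b}. f x * deriv \<psi> x) =
      - (LINT x|lebesgue_on {a<..<b}. g x * \<psi> x))"

text \<open>
  \<open>d l\<close> is the \<open>l\<close>-th weak derivative of \<open>f\<close>, for all \<open>l \<le> m\<close>. Thus \<open>f\<close> belongs to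
  \<open>W\<^sup>m\<^sup>,\<^sup>\<infinity>(a,b)\<close> iff such a \<open>d\<close> exists.
\<close>

definition weak_derivs ::
    "real \<Rightarrow> real \<Rightarrow> nat \<Rightarrow> (real \<Rightarrow> real) \<Rightarrow> (nat \<Rightarrow> real \<Rightarrow> real) \<Rightarrow> bool"
  where "weak_derivs a b m f d \<longleftrightarrow>
    d 0 = f \<and> (\<forall>l\<le>m. d l \<in> Linf {a<..<b}) \<and> (\<forall>l<m. weak_deriv a b (d l) (d (Suc l)))"

text \<open>
  Weak derivatives are unique up to null sets, so all members of the set below have the same
  value; the infimum only serves to make the norm infinite outside \<open>W\<^sup>m\<^sup>,\<^sup>\<infinity>(a,b)\<close>.
\<close>

definition W_norm :: "real \<Rightarrow> real \<Rightarrow> nat \<Rightarrow> (real \<Rightarrow> real) \<Rightarrow> ereal"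
  where "W_norm a b m f =
    (INF d\<in>{d. weak_derivs a b m f d}. \<Sum>l\<le>m. Linf_norm {a<..<b} (d l))"

text \<open>
  The space \<open>W\<^sub>p\<^sup>m\<^sup>,\<^sup>\<infinity>\<close>, for \<open>m \<ge> 1\<close>. The derivatives of order below \<open>m\<close> are represented by
  their continuous versions on \<open>[a,b]\<close>, which gives a meaning to the boundary values; in
  particular \<open>f = d 0\<close> itself is continuous on \<open>[a,b]\<close>.
\<close>

definition W_per :: "real \<Rightarrow> real \<Rightarrow> nat \<Rightarrow> (real \<Rightarrow> real) set"
  where "W_per a b m =
    {f. \<exists>d. weak_derivs a b m f d \<and> (\<forall>l<m. continuous_on {a..b} (d l) \<and> d l a = d l b)}"

text \<open>
  \<open>v 0 \<in> C\<^sup>k([0,T]; W\<^sub>p\<^sup>m\<^sup>,\<^sup>\<infinity>)\<close> with time derivatives \<open>v 1, \<dots>, v k\<close>: here \<open>v r t\<close> is a function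
  of \<open>x\<close>, and continuity and differentiability in time refer to the norm of \<open>W\<^sup>m\<^sup>,\<^sup>\<infinity>(a,b)\<close>.
\<close>

definition Ck_W_per ::
    "real \<Rightarrow> real \<Rightarrow> real \<Rightarrow> nat \<Rightarrow> nat \<Rightarrow> (nat \<Rightarrow> real \<Rightarrow> real \<Rightarrow> real) \<Rightarrow> bool"
  where "Ck_W_per a b T k m v \<longleftrightarrow>
    (\<forall>r\<le>k. \<forall>t\<in>{0..T}.
      v r t \<in> W_per a b m \<and>
      ((\<lambda>s. W_norm a b m (\<lambda>x. v r s x - v r t x)) \<longlongrightarrow> 0) (at t within {0..T})) \<and>
    (\<forall>r<k. \<forall>t\<in>{0..T}.
      ((\<lambda>s. W_norm a b m (\<lambda>x. (v r s x - v r t x) / (s - t) - v (Suc r) t x)) \<longlongrightarrow> 0)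
        (at t within {0..T}))"

text \<open>
  The regularity assumption, with \<open>M\<close> as the bound on the derivatives. The arguments of \<open>u\<close> are
  time and space, in this order. The function \<open>g\<close> is \<open>\<partial>\<^sub>x\<^sup>s \<partial>\<^sub>t\<^sup>r u\<close>, where \<open>\<partial>\<^sub>t\<^sup>r u = v r\<close> is the time
  derivative from the first part of the assumption and \<open>\<partial>\<^sub>x\<^sup>s\<close> is a weak derivative.
\<close>

definition regular_solution ::
    "real \<Rightarrow> real \<Rightarrow> real \<Rightarrow> real \<Rightarrow> (real \<Rightarrow> real \<Rightarrow> real) \<Rightarrow> bool"
  where "regular_solution a b T M u \<longleftrightarrow>
    (\<exists>v. v 0 = u \<and> Ck_W_per a b T 0 5 v \<and> Ck_W_per a b T 2 3 v \<and> Ck_W_per a b T 4 1 v \<and>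
      (\<forall>r s. r \<le> 4 \<longrightarrow> r + s \<le> 5 \<longrightarrow>
        (\<exists>g. (AE t in lebesgue_on {0..T}. \<exists>d. weak_derivs a b s (v r t) d \<and> g t = d s) \<and>
             (\<lambda>(t, x). g t x) \<in> Linf ({0..T} \<times> {a<..<b}) \<and>
             Linf_norm ({0..T} \<times> {a<..<b}) (\<lambda>(t, x). g t x) \<le> ereal M)))"


section \<open>The regularized logarithmic Klein-Gordon equation\<close>

definition f_reg :: "real \<Rightarrow> real \<Rightarrow> real"
  where "f_reg \<epsilon> \<rho> = ln (\<epsilon>\<^sup>2 + \<rho>)"

text \<open>Classical solutions on \<open>[0,S] \<times> [a,b]\<close>, with one-sided derivatives at the boundary.\<close>

definition is_solution ::
    "real \<Rightarrow> real \<Rightarrow> real \<Rightarrow> (real \<Rightarrow> real) \<Rightarrow> (real \<Rightarrow> real) \<Rightarrow> real \<Rightarrow>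
     (real \<Rightarrow> real \<Rightarrow> real) \<Rightarrow> bool"
  where "is_solution a b \<epsilon> \<phi> \<gamma> S u \<longleftrightarrow>
    (\<exists>ut utt ux uxx.
      (\<forall>w\<in>{u, ut, utt, ux, uxx}. continuous_on ({0..S} \<times> {a..b}) (\<lambda>(t, x). w t x)) \<and>
      (\<forall>t\<in>{0..S}. \<forall>x\<in>{a..b}.
        ((\<lambda>t. u t x) has_real_derivative ut t x) (at t within {0..S}) \<and>
        ((\<lambda>t. ut t x) has_real_derivative utt t x) (at t within {0..S}) \<and>
        ((\<lambda>x. u t x) has_real_derivative ux t x) (at x within {a..b}) \<and>
        ((\<lambda>x. ux t x) has_real_derivative uxx t x) (at x within {a..b}) \<and>
        utt t x - uxx t x + u t x + u t x * f_reg \<epsilon> ((u t x)\<^sup>2) = 0) \<and>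
      (\<forall>t\<in>{0..S}. u t a = u t b \<and> ux t a = ux t b) \<and>
      (\<forall>x\<in>{a..b}. u 0 x = \<phi> x \<and> ut 0 x = \<gamma> x))"

definition max_existence_time ::
    "real \<Rightarrow> real \<Rightarrow> real \<Rightarrow> (real \<Rightarrow> real) \<Rightarrow> (real \<Rightarrow> real) \<Rightarrow> ereal"
  where "max_existence_time a b \<epsilon> \<phi> \<gamma> =
    (SUP S\<in>{S. 0 < S \<and> (\<exists>u. is_solution a b \<epsilon> \<phi> \<gamma> S u)}. ereal S)"


section \<open>Grid functions and the CNFD scheme\<close>

text \<open>Grid functions are used at the indices \<open>0, \<dots>, N\<close> only.\<close>

definition X_grid :: "nat \<Rightarrow> (nat \<Rightarrow> real) set"
  where "X_grid N = {w. w 0 = w N}"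

text \<open>The neighbours \<open>w\<^sub>j\<^sub>+\<^sub>1\<close> and \<open>w\<^sub>j\<^sub>-\<^sub>1\<close>, with \<open>w\<^sub>N\<^sub>+\<^sub>1 = w\<^sub>1\<close> and \<open>w\<^sub>-\<^sub>1 = w\<^sub>N\<^sub>-\<^sub>1\<close>.\<close>

definition right_nb :: "nat \<Rightarrow> (nat \<Rightarrow> real) \<Rightarrow> nat \<Rightarrow> real"
  where "right_nb N w j = (if j = N then w 1 else w (j + 1))"

definition left_nb :: "nat \<Rightarrow> (nat \<Rightarrow> real) \<Rightarrow> nat \<Rightarrow> real"
  where "left_nb N w j = (if j = 0 then w (N - 1) else w (j - 1))"

definition dx_plus :: "nat \<Rightarrow> real \<Rightarrow> (nat \<Rightarrow> real) \<Rightarrow> nat \<Rightarrow> real"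
  where "dx_plus N h w j = (right_nb N w j - w j) / h"

definition dx2 :: "nat \<Rightarrow> real \<Rightarrow> (nat \<Rightarrow> real) \<Rightarrow> nat \<Rightarrow> real"
  where "dx2 N h w j = (right_nb N w j - 2 * w j + left_nb N w j) / h\<^sup>2"

definition l2_norm :: "nat \<Rightarrow> real \<Rightarrow> (nat \<Rightarrow> real) \<Rightarrow> real"
  where "l2_norm N h w = sqrt (h * (\<Sum>j<N. \<bar>w j\<bar>\<^sup>2))"

definition linf_norm :: "nat \<Rightarrow> (nat \<Rightarrow> real) \<Rightarrow> real"
  where "linf_norm N w = (SUP j\<in>{..<N}. \<bar>w j\<bar>)"

definition G_reg :: "real \<Rightarrow> real \<Rightarrow> real \<Rightarrow> real"
  where "G_reg \<epsilon> z1 z2 =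
    integral {0..1} (\<lambda>\<theta>. f_reg \<epsilon> (\<theta> * z1\<^sup>2 + (1 - \<theta>) * z2\<^sup>2)) * ((z1 + z2) / 2)"

text \<open>\<open>U n j\<close> is the numerical solution at time level \<open>n\<close> and grid point \<open>x\<^sub>j = a + j h\<close>.\<close>

definition cnfd_solution ::
    "real \<Rightarrow> real \<Rightarrow> (real \<Rightarrow> real) \<Rightarrow> (real \<Rightarrow> real) \<Rightarrow> nat \<Rightarrow> real \<Rightarrow> real \<Rightarrow>
     (nat \<Rightarrow> nat \<Rightarrow> real) \<Rightarrow> bool"
  where "cnfd_solution a \<epsilon> \<phi> \<gamma> N h \<tau> U \<longleftrightarrow>
    (let x = (\<lambda>j. a + real j * h) in
      (\<forall>n. U n \<in> X_grid N) \<and>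
      (\<forall>j\<le>N. U 0 j = \<phi> (x j)) \<and>
      (\<forall>j\<le>N. U 1 j = \<phi> (x j) + \<tau> * \<gamma> (x j) +
         \<tau>\<^sup>2 / 2 * (dx2 N h (\<lambda>i. \<phi> (x i)) j - \<phi> (x j) - \<phi> (x j) * ln (\<epsilon>\<^sup>2 + (\<phi> (x j))\<^sup>2))) \<and>
      (\<forall>n\<ge>1. \<forall>j\<le>N.
         (U (n + 1) j - 2 * U n j + U (n - 1) j) / \<tau>\<^sup>2
         - 1 / 2 * dx2 N h (\<lambda>i. U (n + 1) i + U (n - 1) i) j
         + 1 / 2 * (U (n + 1) j + U (n - 1) j)
         + G_reg \<epsilon> (U (n + 1) j) (U (n - 1) j) = 0))"

end

theory Submission
  imports Defs
begin

text \<open>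
  The nonlinearity \<open>g(z) = z ln (\<epsilon>\<^sup>2 + z\<^sup>2)\<close> has a Lipschitz constant of order \<open>ln (1 / \<epsilon>)\<close> only, and the discrete
  nonlinearity \<open>G_reg\<close> is its average along the segment between the two arguments
  (\<open>G_reg_eq_average\<close>). The linear part of the scheme has an exact energy identity
  (\<open>energy_identity\<close>): testing with the difference of the outer time levels gives, for the root \<open>s n\<close> of
  the energy of the error, a linear recursion with the residual and the nonlinear difference as source
  terms (\<open>energy_step\<close>, \<open>error_step\<close>).

  The difficulty is that the thresholds for \<open>h\<close> and \<open>\<tau>\<close> must not depend on \<open>\<epsilon>\<close>, although the rate
  \<open>\<tau>\<^sup>2 / \<epsilon>\<^sup>2\<close> is useless when \<open>\<epsilon>\<close> is much smaller than \<open>\<tau>\<close>. The proof therefore has two stages.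

  In the first stage no rate is claimed. Uniformly in \<open>\<epsilon>\<close>, the function \<open>g\<close> has the modulus of continuity
  \<open>r \<mapsto> C r (1 + ln (1 / r))\<close> near 0, in the linearized form \<open>g_reg_log_lipschitz\<close>. This modulus satisfies
  the Osgood condition, so an error that is small enough at the beginning stays small up to time \<open>T\<close>:
  it is dominated by an explicit discrete solution of the Osgood equation (\<open>uniform_bound\<close>). Residual and
  initial error become small with \<open>h\<close> and \<open>\<tau>\<close>, uniformly in \<open>\<epsilon>\<close>, and the discrete Sobolev inequality turns
  smallness of the energy into the bound \<open>\<bar>e\<bar> \<le> 1\<close>, which is the second claim. Large solutions of the
  implicit equation are excluded without any a priori estimate, since \<open>g\<close> is increasing away from the
  origin (\<open>G_reg_stability\<close>).

  In the second stage the error is known to be at most 1, so that \<open>g\<close> is Lipschitz with constant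
  \<open>L = 2 ln (1 / \<epsilon>) + O(1)\<close> on the relevant range. Gronwall with the second order residual gives the rate with
  the factor \<open>exp (8 L T)\<close>, a power of \<open>1 / \<epsilon>\<close>, which is below a multiple of \<open>exp (T / (2 \<epsilon>))\<close>. Gronwall for the
  implicit recursion needs \<open>\<tau> L\<close> small; if it is not, then \<open>\<tau> / \<epsilon>\<close> is bounded below and the bound is trivial
  (\<open>convergence_rate\<close>).

  The regularity assumption is formulated with Sobolev norms and weak derivatives. It is translated
  into classical derivatives and bounds on difference quotients at all times in
  \<open>regular_solution_smooth\<close>; the tools are the lemma of du Bois-Reymond, smooth bumps and Fubini.
\<close>

section \<open>The nonlinearity\<close>

definition g_reg :: "real \<Rightarrow> real \<Rightarrow> real"
  where "g_reg \<epsilon> z = z * ln (\<epsilon>\<^sup>2 + z\<^sup>2)"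

text \<open>
  A Lipschitz constant of \<open>g_reg \<delta>\<close> on \<open>{-B..B}\<close>. Since it grows only like \<open>2 ln (1 / \<delta>)\<close>, the
  Gronwall factor in the error bound is a power of \<open>1 / \<epsilon>\<close>.
\<close>

definition lip_const :: "real \<Rightarrow> real \<Rightarrow> real"
  where "lip_const B \<delta> = 2 * ln (1 / \<delta>) + ln (1 + B\<^sup>2) + 2"

text \<open>
  The discrete nonlinearity is a difference quotient of a primitive of \<open>z ln (\<epsilon>\<^sup>2 + z\<^sup>2)\<close>. Written as
  the average of that function along the segment between its arguments, it inherits every estimate
  for \<open>g_reg\<close> pointwise in \<open>\<theta>\<close>.
\<close>

lemma G_reg_eq_average:
  assumes "\<epsilon> \<noteq> 0"
  shows "((\<lambda>\<theta>. g_reg \<epsilon> (\<theta> * z1 + (1 - \<theta>) * z2)) has_integral G_reg \<epsilon> z1 z2) {0..1}"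
proof -
  have pos: "0 < \<epsilon>\<^sup>2 + x" if "0 \<le> x" for x
    using assms that by (simp add: add_pos_nonneg)
  define \<Phi> where "\<Phi> \<rho> = (\<epsilon>\<^sup>2 + \<rho>) * ln (\<epsilon>\<^sup>2 + \<rho>) - \<rho>" for \<rho>
  have \<Phi>: "(\<Phi> has_real_derivative ln (\<epsilon>\<^sup>2 + \<rho>)) (at \<rho>)" if "0 \<le> \<rho>" for \<rho>
  proof -
    have "(\<Phi> has_real_derivative
        1 * ln (\<epsilon>\<^sup>2 + \<rho>) + 1 / (\<epsilon>\<^sup>2 + \<rho>) * (\<epsilon>\<^sup>2 + \<rho>) - 1) (at \<rho>)"
      unfolding \<Phi>_def using pos[OF that] by (auto intro!: derivative_eq_intros)
    thus ?thesis using pos[OF that] by simp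
  qed
  define H where "H z = \<Phi> (z\<^sup>2) / 2" for z
  have H: "(H has_real_derivative g_reg \<epsilon> z) (at z)" for z
    unfolding H_def[abs_def]
    by (rule has_field_derivative_at_within, rule DERIV_cong, rule DERIV_cdivide,
        rule DERIV_chain2[OF \<Phi>])
       (auto intro!: derivative_eq_intros simp: g_reg_def)
  show ?thesis
  proof (cases "z1 = z2")
    case True
    have "((\<lambda>\<theta>. g_reg \<epsilon> z2) has_integral g_reg \<epsilon> z2) {0..1::real}"
      using has_integral_const_real[of "g_reg \<epsilon> z2" 0 1] by simp
    moreover have "G_reg \<epsilon> z1 z2 = g_reg \<epsilon> z2"
      using True by (simp add: G_reg_def g_reg_def f_reg_def flip: distrib_right)
    ultimately show ?thesis using True by (simp flip: distrib_right)
  next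
    case False
    have "((\<lambda>\<theta>. g_reg \<epsilon> (\<theta> * z1 + (1 - \<theta>) * z2)) has_integral
            H (1 * z1 + (1 - 1) * z2) / (z1 - z2) - H (0 * z1 + (1 - 0) * z2) / (z1 - z2)) {0..1}"
      by (rule fundamental_theorem_of_calculus)
         (use False in \<open>auto intro!: derivative_eq_intros DERIV_chain2[OF H]
           simp flip: has_real_derivative_iff_has_vector_derivative\<close>)
    hence int: "((\<lambda>\<theta>. g_reg \<epsilon> (\<theta> * z1 + (1 - \<theta>) * z2)) has_integral
            (\<Phi> (z1\<^sup>2) - \<Phi> (z2\<^sup>2)) / (2 * (z1 - z2))) {0..1}"
      by (simp add: H_def diff_divide_distrib)
    have "(\<Phi> (z1\<^sup>2) - \<Phi> (z2\<^sup>2)) / (2 * (z1 - z2)) = G_reg \<epsilon> z1 z2"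
    proof (cases "z1\<^sup>2 = z2\<^sup>2")
      case True
      hence "z1 + z2 = 0" using False by (auto simp: power2_eq_iff)
      thus ?thesis using True by (simp add: G_reg_def)
    next
      case sq: False
      have "((\<lambda>\<theta>. f_reg \<epsilon> (\<theta> * z1\<^sup>2 + (1 - \<theta>) * z2\<^sup>2)) has_integral
              \<Phi> (1 * z1\<^sup>2 + (1 - 1) * z2\<^sup>2) / (z1\<^sup>2 - z2\<^sup>2)
              - \<Phi> (0 * z1\<^sup>2 + (1 - 0) * z2\<^sup>2) / (z1\<^sup>2 - z2\<^sup>2)) {0..1}"
        by (rule fundamental_theorem_of_calculus)
           (use sq in \<open>auto intro!: derivative_eq_intros DERIV_chain2[OF \<Phi>] simp: f_reg_def
             simp flip: has_real_derivative_iff_has_vector_derivative\<close>)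
      hence "integral {0..1} (\<lambda>\<theta>. f_reg \<epsilon> (\<theta> * z1\<^sup>2 + (1 - \<theta>) * z2\<^sup>2))
              = (\<Phi> (z1\<^sup>2) - \<Phi> (z2\<^sup>2)) / (z1\<^sup>2 - z2\<^sup>2)"
        by (simp add: integral_unique diff_divide_distrib)
      moreover have "z1\<^sup>2 - z2\<^sup>2 = (z1 - z2) * (z1 + z2)"
        by (simp add: algebra_simps power2_eq_square)
      moreover have "z1 + z2 \<noteq> 0"
        using sq by (auto simp: power2_eq_iff add_eq_0_iff)
      ultimately show ?thesis
        using False by (simp add: G_reg_def)
    qed
    thus ?thesis using int by simp
  qed
qed

definition g_reg' :: "real \<Rightarrow> real \<Rightarrow> real"
  where "g_reg' \<epsilon> z = ln (\<epsilon>\<^sup>2 + z\<^sup>2) + 2 * z\<^sup>2 / (\<epsilon>\<^sup>2 + z\<^sup>2)"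

lemma eps_sq_pos: "0 < \<epsilon> \<Longrightarrow> 0 < \<epsilon>\<^sup>2 + (z::real)\<^sup>2"
  by (simp add: add_pos_nonneg)

lemma DERIV_g_reg: "0 < \<epsilon> \<Longrightarrow> (g_reg \<epsilon> has_real_derivative g_reg' \<epsilon> z) (at z)"
  unfolding g_reg_def[abs_def] g_reg'_def using eps_sq_pos[of \<epsilon> z]
  by (auto intro!: derivative_eq_intros simp: power2_eq_square)

lemma lip_const_ge_2: "0 < \<delta> \<Longrightarrow> \<delta> < 1 \<Longrightarrow> 2 \<le> lip_const B \<delta>"
proof -
  assume "0 < \<delta>" "\<delta> < 1"
  hence "0 \<le> ln (1 / \<delta>)" by simp
  moreover have "0 \<le> ln (1 + B\<^sup>2)" by simp
  ultimately show ?thesis unfolding lip_const_def by linarith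
qed

lemma g_reg'_bound:
  assumes "0 < \<epsilon>" "\<epsilon> < 1" "\<bar>z\<bar> \<le> B"
  shows "\<bar>g_reg' \<epsilon> z\<bar> \<le> lip_const B \<epsilon>"
proof -
  have p: "0 < \<epsilon>\<^sup>2 + z\<^sup>2" using eps_sq_pos assms by blast
  have "z\<^sup>2 \<le> B\<^sup>2" using assms(3) by (simp add: abs_le_square_iff[symmetric])
  moreover have "\<epsilon>\<^sup>2 \<le> 1" using assms by (simp add: power_le_one)
  ultimately have "ln (\<epsilon>\<^sup>2 + z\<^sup>2) \<le> ln (1 + B\<^sup>2)" using p by simp
  moreover have "ln (\<epsilon>\<^sup>2) \<le> ln (\<epsilon>\<^sup>2 + z\<^sup>2)" using assms p by simp
  moreover have "ln (\<epsilon>\<^sup>2) = - 2 * ln (1 / \<epsilon>)" using assms by (simp add: ln_div ln_realpow)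
  moreover have "0 \<le> ln (1 / \<epsilon>)" using assms by simp
  moreover have "0 \<le> ln (1 + B\<^sup>2)" by simp
  moreover have "0 \<le> 2 * z\<^sup>2 / (\<epsilon>\<^sup>2 + z\<^sup>2)" "2 * z\<^sup>2 / (\<epsilon>\<^sup>2 + z\<^sup>2) \<le> 2"
    using p by (auto simp: field_simps)
  ultimately show ?thesis
    unfolding g_reg'_def lip_const_def by linarith
qed

lemma g_reg_lipschitz:
  assumes "0 < \<epsilon>" "\<epsilon> < 1" "\<bar>z\<bar> \<le> B" "\<bar>w\<bar> \<le> B"
  shows "\<bar>g_reg \<epsilon> z - g_reg \<epsilon> w\<bar> \<le> lip_const B \<epsilon> * \<bar>z - w\<bar>"
proof -
  have "norm (g_reg \<epsilon> z - g_reg \<epsilon> w) \<le> lip_const B \<epsilon> * norm (z - w)"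
    by (rule field_differentiable_bound[of "{-B..B}" "g_reg \<epsilon>" "g_reg' \<epsilon>"])
       (use assms g_reg'_bound[OF assms(1,2)] in
         \<open>auto intro: has_field_derivative_at_within DERIV_g_reg\<close>)
  thus ?thesis by simp
qed

text \<open>
  Everything uniform in \<open>\<epsilon>\<close> comes from here: raising the regularization from \<open>\<epsilon>\<close> to \<open>\<delta>\<close> costs
  only \<open>O(\<delta>)\<close>. By \<open>\<delta>\<^sup>2 + z\<^sup>2 \<le> (\<delta> + \<bar>z\<bar>)\<^sup>2\<close> the two logarithms differ by at most
  \<open>2 ln (1 + \<delta> / \<bar>z\<bar>) \<le> 2 \<delta> / \<bar>z\<bar>\<close>, and the factor \<open>z\<close> cancels the singularity.
\<close>

lemma g_reg_change_eps:
  assumes "0 < \<epsilon>" "\<epsilon> \<le> \<delta>"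
  shows "\<bar>g_reg \<epsilon> z - g_reg \<delta> z\<bar> \<le> 2 * \<delta>"
proof (cases "z = 0")
  case True thus ?thesis using assms by (simp add: g_reg_def)
next
  case False
  have p: "0 < \<epsilon>\<^sup>2 + z\<^sup>2" "0 < \<delta>\<^sup>2 + z\<^sup>2" using eps_sq_pos assms by auto
  have le: "\<epsilon>\<^sup>2 \<le> \<delta>\<^sup>2" using assms by (simp add: power_mono)
  have "ln (\<delta>\<^sup>2 + z\<^sup>2) \<le> ln ((\<delta> + \<bar>z\<bar>)\<^sup>2)"
    using assms p by (intro ln_mono) (auto simp: power2_sum)
  also have "\<dots> = 2 * ln (\<bar>z\<bar> * (1 + \<delta> / \<bar>z\<bar>))"
    using assms False by (subst ln_realpow) (auto simp: distrib_left add.commute)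
  also have "\<dots> = 2 * ln \<bar>z\<bar> + 2 * ln (1 + \<delta> / \<bar>z\<bar>)"
    using assms False by (subst ln_mult_pos) (auto simp: add_pos_nonneg)
  also have "2 * ln \<bar>z\<bar> = ln (z\<^sup>2)" using ln_realpow[of "\<bar>z\<bar>" 2] False by simp
  also have "\<dots> \<le> ln (\<epsilon>\<^sup>2 + z\<^sup>2)" using p False by simp
  also have "ln (1 + \<delta> / \<bar>z\<bar>) \<le> \<delta> / \<bar>z\<bar>"
    using assms by (intro ln_add_one_self_le_self) auto
  finally have "ln (\<delta>\<^sup>2 + z\<^sup>2) - ln (\<epsilon>\<^sup>2 + z\<^sup>2) \<le> 2 * \<delta> / \<bar>z\<bar>" by simp
  moreover have "ln (\<epsilon>\<^sup>2 + z\<^sup>2) \<le> ln (\<delta>\<^sup>2 + z\<^sup>2)" using le p by simp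
  ultimately have "\<bar>ln (\<epsilon>\<^sup>2 + z\<^sup>2) - ln (\<delta>\<^sup>2 + z\<^sup>2)\<bar> \<le> 2 * \<delta> / \<bar>z\<bar>" by simp
  hence "\<bar>z\<bar> * \<bar>ln (\<epsilon>\<^sup>2 + z\<^sup>2) - ln (\<delta>\<^sup>2 + z\<^sup>2)\<bar> \<le> \<bar>z\<bar> * (2 * \<delta> / \<bar>z\<bar>)"
    by (rule mult_left_mono) simp
  thus ?thesis using False by (simp add: g_reg_def abs_mult flip: right_diff_distrib)
qed

text \<open>
  The modulus of continuity \<open>r \<mapsto> r ln (1 / r)\<close>, linearized with a free parameter \<open>\<delta>\<close>: for
  \<open>\<epsilon> \<le> \<delta>\<close> pass to \<open>g_reg \<delta>\<close>, for \<open>\<delta> < \<epsilon>\<close> the Lipschitz constant of \<open>g_reg \<epsilon>\<close> is already small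
  enough. No constant depends on \<open>\<epsilon>\<close>.
\<close>

lemma g_reg_log_lipschitz:
  assumes "0 < \<epsilon>" "\<epsilon> < 1" "0 < \<delta>" "\<delta> < 1" "\<bar>z\<bar> \<le> B" "\<bar>w\<bar> \<le> B"
  shows "\<bar>g_reg \<epsilon> z - g_reg \<epsilon> w\<bar> \<le> lip_const B \<delta> * \<bar>z - w\<bar> + 4 * \<delta>"
proof (cases "\<epsilon> \<le> \<delta>")
  case True
  show ?thesis
    using g_reg_change_eps[OF assms(1) True, of z] g_reg_change_eps[OF assms(1) True, of w]
      g_reg_lipschitz[OF assms(3-6)] by linarith
next
  case False
  have "ln (1 / \<epsilon>) \<le> ln (1 / \<delta>)" using False assms by (simp add: frac_le)
  hence "lip_const B \<epsilon> * \<bar>z - w\<bar> \<le> lip_const B \<delta> * \<bar>z - w\<bar>"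
    by (intro mult_right_mono) (auto simp: lip_const_def)
  thus ?thesis using g_reg_lipschitz[OF assms(1,2,5,6)] assms by linarith
qed

lemma g_reg_minus: "g_reg \<epsilon> (- z) = - g_reg \<epsilon> z"
  by (simp add: g_reg_def)

lemma g_reg_mono_beyond_1:
  assumes "0 < \<epsilon>" "1 \<le> x" "x \<le> y"
  shows "g_reg \<epsilon> x \<le> g_reg \<epsilon> y"
proof -
  have "1 \<le> x\<^sup>2" using assms by simp
  moreover have "x\<^sup>2 \<le> y\<^sup>2" using assms by simp
  moreover have "0 < \<epsilon>\<^sup>2" using assms by simp
  ultimately have "0 \<le> ln (\<epsilon>\<^sup>2 + x\<^sup>2)" "ln (\<epsilon>\<^sup>2 + x\<^sup>2) \<le> ln (\<epsilon>\<^sup>2 + y\<^sup>2)"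
    by (intro ln_ge_zero ln_mono; linarith)+
  thus ?thesis unfolding g_reg_def using assms by (intro mult_mono) auto
qed

text \<open>
  The new time level solves an implicit equation, and nothing is known beforehand about the size of
  its error. A lower bound for \<open>g_reg \<epsilon> (w + e) - g_reg \<epsilon> w\<close> nevertheless holds for arbitrarily large
  \<open>e > 0\<close>, because \<open>g_reg\<close> is increasing beyond 1.
\<close>

lemma g_reg_one_sided:
  assumes "0 < \<epsilon>" "0 \<le> L" "0 \<le> M" "\<bar>w\<bar> \<le> M" "-1 \<le> e"
    and lip: "\<And>z w. \<bar>z\<bar> \<le> M + 1 \<Longrightarrow> \<bar>w\<bar> \<le> M + 1 \<Longrightarrow>
      \<bar>g_reg \<epsilon> z - g_reg \<epsilon> w\<bar> \<le> L * \<bar>z - w\<bar> + \<kappa>"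
  shows "- (L * \<bar>e\<bar> + \<kappa>) \<le> g_reg \<epsilon> (w + e) - g_reg \<epsilon> w"
proof (cases "w + e \<le> M + 1")
  case True
  have "\<bar>g_reg \<epsilon> (w + e) - g_reg \<epsilon> w\<bar> \<le> L * \<bar>w + e - w\<bar> + \<kappa>"
    using True assms by (intro lip) auto
  thus ?thesis by (simp add: abs_le_iff)
next
  case False
  have "g_reg \<epsilon> (M + 1) \<le> g_reg \<epsilon> (w + e)"
    using False assms by (intro g_reg_mono_beyond_1) auto
  moreover have "\<bar>g_reg \<epsilon> (M + 1) - g_reg \<epsilon> w\<bar> \<le> L * \<bar>M + 1 - w\<bar> + \<kappa>"
    using assms by (intro lip) auto
  moreover have "L * \<bar>M + 1 - w\<bar> \<le> L * \<bar>e\<bar>"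
    using False assms by (intro mult_left_mono) auto
  ultimately show ?thesis by linarith
qed

lemma integral_segment: "((\<lambda>\<theta>. \<theta> * x + (1 - \<theta>) * y) has_integral (x + y) / 2) {0..1::real}"
  for x y :: real
proof -
  have "((\<lambda>\<theta>. \<theta> * x + (1 - \<theta>) * y) has_integral
      (1\<^sup>2 / 2 * x + (1 - 1\<^sup>2 / 2) * y) - (0\<^sup>2 / 2 * x + (0 - 0\<^sup>2 / 2) * y)) {0..1::real}"
    by (rule fundamental_theorem_of_calculus)
       (auto intro!: derivative_eq_intros
         simp flip: has_real_derivative_iff_has_vector_derivative)
  thus ?thesis by (simp add: field_simps)
qed

lemma abs_segment_le:
  fixes x y \<theta> :: real
  assumes "0 \<le> \<theta>" "\<theta> \<le> 1"
  shows "\<bar>\<theta> * x + (1 - \<theta>) * y\<bar> \<le> \<bar>x\<bar> + \<bar>y\<bar>"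
proof -
  have "\<bar>\<theta> * x + (1 - \<theta>) * y\<bar> \<le> \<theta> * \<bar>x\<bar> + (1 - \<theta>) * \<bar>y\<bar>"
    using assms abs_triangle_ineq[of "\<theta> * x" "(1 - \<theta>) * y"] by (simp add: abs_mult)
  also have "\<dots> \<le> 1 * \<bar>x\<bar> + 1 * \<bar>y\<bar>"
    using assms by (intro add_mono mult_right_mono) auto
  finally show ?thesis by simp
qed

lemma abs_segment_le_bound:
  fixes x y \<theta> B :: real
  assumes "0 \<le> \<theta>" "\<theta> \<le> 1" "\<bar>x\<bar> \<le> B" "\<bar>y\<bar> \<le> B"
  shows "\<bar>\<theta> * x + (1 - \<theta>) * y\<bar> \<le> B"
proof -
  have "\<bar>\<theta> * x + (1 - \<theta>) * y\<bar> \<le> \<theta> * \<bar>x\<bar> + (1 - \<theta>) * \<bar>y\<bar>"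
    using assms abs_triangle_ineq[of "\<theta> * x" "(1 - \<theta>) * y"] by (simp add: abs_mult)
  also have "\<dots> \<le> \<theta> * B + (1 - \<theta>) * B"
    using assms by (intro add_mono mult_left_mono) auto
  finally show ?thesis by (simp add: algebra_simps)
qed

text \<open>
  The form in which stability enters the energy estimate. A large \<open>e1\<close> does no harm: it makes
  \<open>e1 - e2\<close> and the nonlinear difference have the same sign up to the stated error, so that the
  dangerous part of their product is nonnegative. Only the known older level \<open>e2\<close> has to be small.
\<close>

lemma G_reg_stability:
  assumes "0 < \<epsilon>" "0 \<le> L" "0 \<le> M" "\<bar>w1\<bar> \<le> M" "\<bar>w2\<bar> \<le> M" "\<bar>e2\<bar> \<le> 1"
    and lip: "\<And>z w. \<bar>z\<bar> \<le> M + 1 \<Longrightarrow> \<bar>w\<bar> \<le> M + 1 \<Longrightarrow>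
      \<bar>g_reg \<epsilon> z - g_reg \<epsilon> w\<bar> \<le> L * \<bar>z - w\<bar> + \<kappa>"
  shows "- ((G_reg \<epsilon> (w1 + e1) (w2 + e2) - G_reg \<epsilon> w1 w2) * (e1 - e2))
         \<le> (L * (\<bar>e1\<bar> + \<bar>e2\<bar>) + \<kappa>) * \<bar>e1 - e2\<bar>"
proof -
  define w where "w \<theta> = \<theta> * w1 + (1 - \<theta>) * w2" for \<theta>
  define e where "e \<theta> = \<theta> * e1 + (1 - \<theta>) * e2" for \<theta>
  define D where "D = G_reg \<epsilon> (w1 + e1) (w2 + e2) - G_reg \<epsilon> w1 w2"
  define K where "K = L * (\<bar>e1\<bar> + \<bar>e2\<bar>) + \<kappa>"
  have "\<epsilon> \<noteq> 0" using assms by simp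
  have D: "((\<lambda>\<theta>. g_reg \<epsilon> (w \<theta> + e \<theta>) - g_reg \<epsilon> (w \<theta>)) has_integral D) {0..1}"
    unfolding D_def
    using has_integral_diff[OF G_reg_eq_average[OF \<open>\<epsilon> \<noteq> 0\<close>, of "w1 + e1" "w2 + e2"]
      G_reg_eq_average[OF \<open>\<epsilon> \<noteq> 0\<close>, of w1 w2]]
    by (simp add: w_def e_def algebra_simps)
  have w: "\<bar>w \<theta>\<bar> \<le> M" if "\<theta> \<in> {0..1}" for \<theta>
    unfolding w_def using that assms by (intro abs_segment_le_bound) auto
  have eK: "L * \<bar>e \<theta>\<bar> + \<kappa> \<le> K" if "\<theta> \<in> {0..1}" for \<theta>
    unfolding K_def e_def using that assms by (intro add_right_mono mult_left_mono abs_segment_le) auto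
  have const: "((\<lambda>\<theta>. c) has_integral c) {0..1::real}" for c :: real
    using has_integral_const_real[of c 0 1] by simp
  have lower: "- K \<le> D" if e1: "-1 \<le> e1"
  proof (rule has_integral_le[OF const D])
    fix \<theta> :: real assume \<theta>: "\<theta> \<in> {0..1}"
    have "\<theta> * (-1) + (1 - \<theta>) * (-1) \<le> e \<theta>"
      unfolding e_def using \<theta> e1 assms by (intro add_mono mult_left_mono) auto
    hence "-1 \<le> e \<theta>" by simp
    hence "- (L * \<bar>e \<theta>\<bar> + \<kappa>) \<le> g_reg \<epsilon> (w \<theta> + e \<theta>) - g_reg \<epsilon> (w \<theta>)"
      by (intro g_reg_one_sided[where M = M] lip assms w \<theta>)
    thus "- K \<le> g_reg \<epsilon> (w \<theta> + e \<theta>) - g_reg \<epsilon> (w \<theta>)" using eK[OF \<theta>] by linarith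
  qed
  have upper: "D \<le> K" if e1: "e1 \<le> 1"
  proof (rule has_integral_le[OF D const])
    fix \<theta> :: real assume \<theta>: "\<theta> \<in> {0..1}"
    have "e \<theta> \<le> \<theta> * 1 + (1 - \<theta>) * 1"
      unfolding e_def using \<theta> e1 assms by (intro add_mono mult_left_mono) auto
    hence "-1 \<le> - e \<theta>" by simp
    moreover have "\<bar>- w \<theta>\<bar> \<le> M" using w[OF \<theta>] by simp
    ultimately have "- (L * \<bar>- e \<theta>\<bar> + \<kappa>) \<le> g_reg \<epsilon> (- w \<theta> + - e \<theta>) - g_reg \<epsilon> (- w \<theta>)"
      by (intro g_reg_one_sided[where M = M] lip assms)
    moreover have "g_reg \<epsilon> (- w \<theta> + - e \<theta>) = - g_reg \<epsilon> (w \<theta> + e \<theta>)"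
      using g_reg_minus[of \<epsilon> "w \<theta> + e \<theta>"] by simp
    ultimately show "g_reg \<epsilon> (w \<theta> + e \<theta>) - g_reg \<epsilon> (w \<theta>) \<le> K"
      using eK[OF \<theta>] by (simp add: g_reg_minus)
  qed
  have "- (D * (e1 - e2)) \<le> K * \<bar>e1 - e2\<bar>"
  proof (cases "e2 \<le> e1")
    case True
    hence "- K * (e1 - e2) \<le> D * (e1 - e2)"
      using assms by (intro mult_right_mono lower) auto
    thus ?thesis using True by simp
  next
    case False
    hence "D * (e2 - e1) \<le> K * (e2 - e1)"
      using assms by (intro mult_right_mono upper) auto
    thus ?thesis using False by (simp add: algebra_simps)
  qed
  thus ?thesis by (simp add: D_def K_def)
qed

lemma DERIV_g_reg':
  assumes "0 < \<epsilon>"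
  shows "(g_reg' \<epsilon> has_real_derivative
    2 * z / (\<epsilon>\<^sup>2 + z\<^sup>2) + 4 * z * \<epsilon>\<^sup>2 / (\<epsilon>\<^sup>2 + z\<^sup>2)\<^sup>2) (at z)"
  unfolding g_reg'_def[abs_def] using eps_sq_pos[OF assms, of z]
  by (auto intro!: derivative_eq_intros simp: power2_eq_square algebra_simps)

lemma g_reg''_bound:
  fixes \<epsilon> z :: real
  assumes "0 < \<epsilon>"
  shows "\<bar>2 * z / (\<epsilon>\<^sup>2 + z\<^sup>2) + 4 * z * \<epsilon>\<^sup>2 / (\<epsilon>\<^sup>2 + z\<^sup>2)\<^sup>2\<bar> \<le> 3 / \<epsilon>"
proof -
  define q where "q = \<epsilon>\<^sup>2 + z\<^sup>2"
  have q: "0 < q" "\<epsilon>\<^sup>2 \<le> q" using eps_sq_pos[OF assms, of z] by (auto simp: q_def)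
  have "2 * \<bar>z\<bar> * \<epsilon> \<le> q"
    using zero_le_power2[of "\<bar>z\<bar> - \<epsilon>"] by (simp add: q_def power2_diff algebra_simps)
  hence 1: "2 * \<bar>z\<bar> / q \<le> 1 / \<epsilon>" using q assms by (simp add: field_simps)
  have "4 * \<bar>z\<bar> * \<epsilon>\<^sup>2 / q\<^sup>2 = 2 * (2 * \<bar>z\<bar> / q) * (\<epsilon>\<^sup>2 / q)" by (simp add: power2_eq_square)
  also have "\<dots> \<le> 2 * (1 / \<epsilon>) * 1"
    using 1 q assms by (intro mult_mono) auto
  finally have 2: "4 * \<bar>z\<bar> * \<epsilon>\<^sup>2 / q\<^sup>2 \<le> 2 / \<epsilon>" by simp
  have "\<bar>2 * z / q + 4 * z * \<epsilon>\<^sup>2 / q\<^sup>2\<bar> \<le> 2 * \<bar>z\<bar> / q + 4 * \<bar>z\<bar> * \<epsilon>\<^sup>2 / q\<^sup>2"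
    using q abs_triangle_ineq[of "2 * z / q" "4 * z * \<epsilon>\<^sup>2 / q\<^sup>2"] by (simp add: abs_mult)
  also have "\<dots> \<le> 3 / \<epsilon>" using 1 2 by (simp add: add_divide_distrib[symmetric] field_simps)
  finally show ?thesis by (simp add: q_def)
qed

text \<open>
  The second derivative of \<open>g_reg\<close> is of size \<open>1 / \<epsilon>\<close>.
\<close>

lemma g_reg_taylor:
  assumes "0 < \<epsilon>"
  shows "\<bar>g_reg \<epsilon> (z + y) - g_reg \<epsilon> z - g_reg' \<epsilon> z * y\<bar> \<le> 3 / \<epsilon> * y\<^sup>2"
proof -
  define f where "f = (\<lambda>i::nat. if i = 0 then g_reg \<epsilon> else if i = 1 then g_reg' \<epsilon> else
    (\<lambda>z. 2 * z / (\<epsilon>\<^sup>2 + z\<^sup>2) + 4 * z * \<epsilon>\<^sup>2 / (\<epsilon>\<^sup>2 + z\<^sup>2)\<^sup>2))"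
  have "norm (f 0 (z + y) - (\<Sum>i\<le>1. f i z * (z + y - z) ^ i / fact i))
     \<le> 3 / \<epsilon> * norm (z + y - z) ^ Suc 1 / fact 1"
  proof (rule field_Taylor[of UNIV])
    fix i :: nat and x :: real assume "i \<le> 1"
    thus "(f i has_field_derivative f (Suc i) x) (at x within UNIV)"
      using DERIV_g_reg[OF assms] DERIV_g_reg'[OF assms] by (auto simp: f_def le_Suc_eq)
  qed (use g_reg''_bound[OF assms] in \<open>auto simp: f_def\<close>)
  thus ?thesis by (simp add: f_def algebra_simps power2_eq_square)
qed

text \<open>
  In the application \<open>y1\<close> and \<open>y2\<close> are the forward and backward time increments, of first order in
  the time step, while \<open>y1 + y2\<close> is a second difference and therefore of second order.
\<close>

lemma G_reg_consistency:
  assumes "0 < \<epsilon>" "\<epsilon> < 1" "\<bar>z\<bar> \<le> B" "\<bar>y1\<bar> \<le> m" "\<bar>y2\<bar> \<le> m"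
  shows "\<bar>G_reg \<epsilon> (z + y1) (z + y2) - g_reg \<epsilon> z\<bar>
         \<le> lip_const B \<epsilon> * \<bar>y1 + y2\<bar> + 3 / \<epsilon> * m\<^sup>2"
proof -
  define y where "y \<theta> = \<theta> * y1 + (1 - \<theta>) * y2" for \<theta>
  define D where "D = G_reg \<epsilon> (z + y1) (z + y2) - g_reg \<epsilon> z - g_reg' \<epsilon> z * ((y1 + y2) / 2)"
  have "\<epsilon> \<noteq> 0" using assms by simp
  have const: "((\<lambda>\<theta>. c) has_integral c) {0..1::real}" for c :: real
    using has_integral_const_real[of c 0 1] by simp
  have "((\<lambda>\<theta>. g_reg \<epsilon> (z + y \<theta>) - g_reg \<epsilon> z - g_reg' \<epsilon> z * y \<theta>) has_integral D) {0..1}"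
  proof -
    have eq: "\<theta> * (z + y1) + (1 - \<theta>) * (z + y2) = z + y \<theta>" for \<theta>
      by (simp add: y_def algebra_simps)
    show ?thesis
      unfolding D_def
      using has_integral_diff[OF has_integral_diff[OF
          G_reg_eq_average[OF \<open>\<epsilon> \<noteq> 0\<close>, of "z + y1" "z + y2"] const]
          has_integral_mult_right[OF integral_segment[of y1 y2]]]
      unfolding eq y_def[symmetric] .
  qed
  hence "norm D \<le> 3 / \<epsilon> * m\<^sup>2 * measure lborel {0..1::real}"
  proof (rule has_integral_bound_real[where S = "{}", rotated 2])
    fix \<theta> :: real assume 3: "\<theta> \<in> {0..1} - {}"
    have "\<bar>y \<theta>\<bar> \<le> m" unfolding y_def using 3 assms by (intro abs_segment_le_bound) auto
    hence "(y \<theta>)\<^sup>2 \<le> m\<^sup>2" by (simp add: abs_le_square_iff[symmetric])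
    hence "3 / \<epsilon> * (y \<theta>)\<^sup>2 \<le> 3 / \<epsilon> * m\<^sup>2" using assms by (intro mult_left_mono) auto
    thus "norm (g_reg \<epsilon> (z + y \<theta>) - g_reg \<epsilon> z - g_reg' \<epsilon> z * y \<theta>) \<le> 3 / \<epsilon> * m\<^sup>2"
      using g_reg_taylor[OF assms(1), of z "y \<theta>"] by simp
  qed (use assms in auto)
  hence "\<bar>D\<bar> \<le> 3 / \<epsilon> * m\<^sup>2" by simp
  moreover have "\<bar>g_reg' \<epsilon> z * ((y1 + y2) / 2)\<bar> \<le> lip_const B \<epsilon> * \<bar>y1 + y2\<bar>"
  proof -
    have "\<bar>g_reg' \<epsilon> z * ((y1 + y2) / 2)\<bar> = \<bar>g_reg' \<epsilon> z\<bar> * (\<bar>y1 + y2\<bar> / 2)"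
      by (simp add: abs_mult)
    also have "\<dots> \<le> lip_const B \<epsilon> * \<bar>y1 + y2\<bar>"
      using g_reg'_bound[OF assms(1-3)] by (intro mult_mono) auto
    finally show ?thesis .
  qed
  ultimately show ?thesis unfolding D_def by linarith
qed

text \<open>
  The counterpart of the previous estimate that does not degenerate as \<open>\<epsilon>\<close> tends to 0. It has no
  rate, but can be made small by choosing first \<open>\<delta>\<close> and then \<open>m\<close>.
\<close>

lemma G_reg_consistency_uniform:
  assumes "0 < \<epsilon>" "\<epsilon> < 1" "0 < \<delta>" "\<delta> < 1" "\<bar>z\<bar> \<le> B" "\<bar>z + y1\<bar> \<le> B" "\<bar>z + y2\<bar> \<le> B"
    "\<bar>y1\<bar> \<le> m" "\<bar>y2\<bar> \<le> m"
  shows "\<bar>G_reg \<epsilon> (z + y1) (z + y2) - g_reg \<epsilon> z\<bar> \<le> lip_const B \<delta> * m + 4 * \<delta>"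
proof -
  define y where "y \<theta> = \<theta> * y1 + (1 - \<theta>) * y2" for \<theta>
  have "\<epsilon> \<noteq> 0" using assms by simp
  have const: "((\<lambda>\<theta>. c) has_integral c) {0..1::real}" for c :: real
    using has_integral_const_real[of c 0 1] by simp
  have L: "0 \<le> lip_const B \<delta>" using lip_const_ge_2[of \<delta> B] assms by linarith
  have m: "0 \<le> m" using assms by linarith
  have "((\<lambda>\<theta>. g_reg \<epsilon> (z + y \<theta>) - g_reg \<epsilon> z) has_integral
      (G_reg \<epsilon> (z + y1) (z + y2) - g_reg \<epsilon> z)) {0..1}"
    using has_integral_diff[OF G_reg_eq_average[OF \<open>\<epsilon> \<noteq> 0\<close>, of "z + y1" "z + y2"] const]
    by (simp add: y_def algebra_simps)
  hence "norm (G_reg \<epsilon> (z + y1) (z + y2) - g_reg \<epsilon> z)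
      \<le> (lip_const B \<delta> * m + 4 * \<delta>) * measure lborel {0..1::real}"
  proof (rule has_integral_bound_real[where S = "{}", rotated 2])
    fix \<theta> :: real assume 3: "\<theta> \<in> {0..1} - {}"
    have "\<bar>y \<theta>\<bar> \<le> m" unfolding y_def using 3 assms by (intro abs_segment_le_bound) auto
    moreover have "\<bar>\<theta> * (z + y1) + (1 - \<theta>) * (z + y2)\<bar> \<le> B"
      using 3 assms by (intro abs_segment_le_bound) auto
    hence "\<bar>z + y \<theta>\<bar> \<le> B" by (simp add: y_def algebra_simps)
    ultimately have "\<bar>g_reg \<epsilon> (z + y \<theta>) - g_reg \<epsilon> z\<bar> \<le> lip_const B \<delta> * \<bar>y \<theta>\<bar> + 4 * \<delta>"
      "lip_const B \<delta> * \<bar>y \<theta>\<bar> \<le> lip_const B \<delta> * m"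
      using g_reg_log_lipschitz[of \<epsilon> \<delta> "z + y \<theta>" B z] assms L by (auto intro: mult_left_mono)
    thus "norm (g_reg \<epsilon> (z + y \<theta>) - g_reg \<epsilon> z) \<le> lip_const B \<delta> * m + 4 * \<delta>" by simp
  qed (use assms L m in auto)
  thus ?thesis by simp
qed

section \<open>The discrete energy method\<close>

lemma l2_norm_L2_set: "0 \<le> h \<Longrightarrow> l2_norm N h w = sqrt h * L2_set w {..<N}"
  by (simp add: l2_norm_def L2_set_def real_sqrt_mult)

lemma l2_norm_nonneg: "0 \<le> h \<Longrightarrow> 0 \<le> l2_norm N h w"
  by (simp add: l2_norm_L2_set)

lemma l2_norm_sq: "0 \<le> h \<Longrightarrow> (l2_norm N h w)\<^sup>2 = h * (\<Sum>j<N. (w j)\<^sup>2)"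
  by (simp add: l2_norm_def sum_nonneg)

lemma l2_norm_cong: "(\<And>j. j < N \<Longrightarrow> v j = w j) \<Longrightarrow> l2_norm N h v = l2_norm N h w"
  by (simp add: l2_norm_def)

lemma l2_norm_triangle:
  "0 \<le> h \<Longrightarrow> l2_norm N h (\<lambda>j. v j + w j) \<le> l2_norm N h v + l2_norm N h w"
  using L2_set_triangle_ineq[of v w "{..<N}"]
  by (simp add: l2_norm_L2_set mult_left_mono flip: distrib_left)

lemma l2_norm_scale: "0 \<le> h \<Longrightarrow> l2_norm N h (\<lambda>j. c * w j) = \<bar>c\<bar> * l2_norm N h w"
  by (simp add: l2_norm_def power_mult_distrib flip: sum_distrib_left)
     (simp add: mult.left_commute[of h] real_sqrt_mult)

lemma l2_norm_le_sup:
  assumes "0 \<le> h" "0 \<le> B" "\<And>j. j < N \<Longrightarrow> \<bar>w j\<bar> \<le> B"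
  shows "l2_norm N h w \<le> sqrt (h * real N) * B"
proof -
  have "(\<Sum>j<N. \<bar>w j\<bar>\<^sup>2) \<le> (\<Sum>j<N. B\<^sup>2)"
    using assms by (intro sum_mono power_mono) auto
  hence "l2_norm N h w \<le> sqrt (h * (real N * B\<^sup>2))"
    unfolding l2_norm_def using assms by (intro real_sqrt_le_mono mult_left_mono) auto
  thus ?thesis using assms by (simp add: real_sqrt_mult)
qed

lemma l2_norm_abs: "l2_norm N h (\<lambda>j. \<bar>w j\<bar>) = l2_norm N h w"
  by (simp add: l2_norm_def)

lemma cauchy_schwarz_grid:
  "0 \<le> h \<Longrightarrow> h * (\<Sum>j<N. \<bar>v j\<bar> * \<bar>w j\<bar>) \<le> l2_norm N h v * l2_norm N h w"
  using mult_left_mono[OF L2_set_mult_ineq[of v w "{..<N}"], of h]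
  by (simp add: l2_norm_L2_set mult.assoc mult.left_commute flip: real_sqrt_mult)
     (simp add: mult.assoc[symmetric])

text \<open>
  Periodicity removes the boundary terms: shifting the index by one permutes the backward
  differences cyclically.
\<close>

lemma summation_by_parts:
  assumes "0 < N" "0 < h" "w \<in> X_grid N" "z \<in> X_grid N"
  shows "(\<Sum>j<N. dx2 N h w j * z j) = - (\<Sum>j<N. dx_plus N h w j * dx_plus N h z j)"
proof -
  obtain m where N: "N = Suc m" using assms(1) by (cases N) auto
  have w: "w (Suc m) = w 0" and z: "z (Suc m) = z 0"
    using assms(3,4) by (auto simp: X_grid_def N)
  define d where "d j = w (Suc j) - w j" for j
  define l where "l j = w j - left_nb N w j" for j
  have l0: "l 0 = d m" and lS: "l (Suc j) = d j" for j
    by (auto simp: l_def left_nb_def d_def N w)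
  have "(\<Sum>j<N. l j * z j) = d m * z (Suc m) + (\<Sum>j<m. d j * z (Suc j))"
    unfolding N sum.lessThan_Suc_shift by (simp add: l0 lS z)
  also have "\<dots> = (\<Sum>j<N. d j * z (Suc j))" by (simp add: N)
  finally have shift: "(\<Sum>j<N. l j * z j) = (\<Sum>j<N. d j * z (Suc j))" .
  have "(\<Sum>j<N. dx2 N h w j * z j) = (\<Sum>j<N. (d j * z j - l j * z j) / h\<^sup>2)"
    by (intro sum.cong) (auto simp: dx2_def right_nb_def d_def l_def field_simps)
  also have "\<dots> = ((\<Sum>j<N. d j * z j) - (\<Sum>j<N. d j * z (Suc j))) / h\<^sup>2"
    by (simp add: sum_divide_distrib[symmetric] sum_subtractf shift)
  also have "\<dots> = - (\<Sum>j<N. d j * (z (Suc j) - z j)) / h\<^sup>2"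
    by (simp add: sum_subtractf right_diff_distrib)
  also have "\<dots> = - (\<Sum>j<N. dx_plus N h w j * dx_plus N h z j)"
    unfolding minus_divide_left[symmetric] sum_divide_distrib
    by (simp add: dx_plus_def right_nb_def d_def power2_eq_square)
  finally show ?thesis .
qed

lemma grid_diff_le:
  fixes w :: "nat \<Rightarrow> real"
  assumes "i \<le> N" "j \<le> N"
  shows "\<bar>w i - w j\<bar> \<le> (\<Sum>k<N. \<bar>w (Suc k) - w k\<bar>)"
proof -
  have "\<bar>w q - w p\<bar> \<le> (\<Sum>k<N. \<bar>w (Suc k) - w k\<bar>)" if "p \<le> q" "q \<le> N" for p q
  proof -
    have "w q - w p = (\<Sum>k\<in>{p..<q}. w (Suc k) - w k)"
      using sum_Suc_diff'[of p q w] that by simp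
    also have "\<bar>\<dots>\<bar> \<le> (\<Sum>k\<in>{p..<q}. \<bar>w (Suc k) - w k\<bar>)" by (rule sum_abs)
    also have "\<dots> \<le> (\<Sum>k<N. \<bar>w (Suc k) - w k\<bar>)"
      using that by (intro sum_mono2) auto
    finally show ?thesis .
  qed
  from this[of i j] this[of j i] assms show ?thesis
    by (cases "i \<le> j") (auto simp: abs_minus_commute)
qed

text \<open>
  At an index where \<open>\<bar>w\<bar>\<close> is minimal its value is at most the quadratic mean; from there to \<open>j\<close> the
  variation is at most the \<open>l\<^sup>1\<close> norm of the difference quotient.
\<close>

lemma discrete_sobolev:
  assumes "0 < N" "0 < h" "w \<in> X_grid N" "j \<le> N"
  shows "\<bar>w j\<bar> \<le> l2_norm N h w / sqrt (h * real N) + sqrt (h * real N) * l2_norm N h (dx_plus N h w)"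
proof -
  define l where "l = h * real N"
  have l: "0 < l" using assms by (simp add: l_def)
  obtain i where i: "i < N" "\<And>k. k < N \<Longrightarrow> \<bar>w i\<bar> \<le> \<bar>w k\<bar>"
    using ex_min_if_finite[of "(\<lambda>k. \<bar>w k\<bar>) ` {..<N}"] assms(1)
    by (force simp: not_less)
  have "real N * \<bar>w i\<bar>\<^sup>2 \<le> (\<Sum>k<N. \<bar>w k\<bar>\<^sup>2)"
  proof -
    have "(\<Sum>k<N. \<bar>w i\<bar>\<^sup>2) \<le> (\<Sum>k<N. \<bar>w k\<bar>\<^sup>2)"
      using i(2) by (intro sum_mono power_mono) auto
    thus ?thesis by simp
  qed
  hence "sqrt (l * \<bar>w i\<bar>\<^sup>2) \<le> l2_norm N h w"
    unfolding l2_norm_def l_def using assms by (intro real_sqrt_le_mono) (simp add: mult.assoc)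
  hence 1: "\<bar>w i\<bar> \<le> l2_norm N h w / sqrt l"
    using l by (simp add: real_sqrt_mult field_simps)
  have "\<bar>w j - w i\<bar> \<le> (\<Sum>k<N. \<bar>w (Suc k) - w k\<bar>)"
    using assms i by (intro grid_diff_le) auto
  also have "\<dots> = h * (\<Sum>k<N. \<bar>1\<bar> * \<bar>dx_plus N h w k\<bar>)"
    using assms by (simp add: dx_plus_def right_nb_def sum_divide_distrib[symmetric])
  also have "\<dots> \<le> l2_norm N h (\<lambda>_. 1) * l2_norm N h (dx_plus N h w)"
    using assms by (intro cauchy_schwarz_grid) auto
  also have "l2_norm N h (\<lambda>_. 1) = sqrt l" by (simp add: l2_norm_def l_def)
  finally show ?thesis using 1 by (simp add: l_def)
qed

text \<open>
  The discrete energy of the linear Klein-Gordon scheme on two consecutive time levels, the older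
  one first.
\<close>

definition energy :: "nat \<Rightarrow> real \<Rightarrow> real \<Rightarrow> (nat \<Rightarrow> real) \<Rightarrow> (nat \<Rightarrow> real) \<Rightarrow> real"
  where "energy N h \<tau> v w =
    (l2_norm N h (\<lambda>j. (w j - v j) / \<tau>))\<^sup>2
    + ((l2_norm N h (dx_plus N h w))\<^sup>2 + (l2_norm N h (dx_plus N h v))\<^sup>2) / 2
    + ((l2_norm N h w)\<^sup>2 + (l2_norm N h v)\<^sup>2) / 2"

lemma energy_nonneg: "0 \<le> energy N h \<tau> v w"
  by (simp add: energy_def)

text \<open>
  The constant 3/2 is a rational upper bound for the square root of 2.
\<close>

lemma energy_controls:
  assumes "0 \<le> h"
  shows "l2_norm N h w \<le> 3/2 * sqrt (energy N h \<tau> v w)"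
    and "l2_norm N h v \<le> 3/2 * sqrt (energy N h \<tau> v w)"
    and "l2_norm N h (dx_plus N h w) \<le> 3/2 * sqrt (energy N h \<tau> v w)"
    and "l2_norm N h (dx_plus N h v) \<le> 3/2 * sqrt (energy N h \<tau> v w)"
    and "l2_norm N h (\<lambda>j. (w j - v j) / \<tau>) \<le> sqrt (energy N h \<tau> v w)"
proof -
  have *: "x \<le> 3/2 * sqrt S" if "x\<^sup>2 / 2 \<le> S" for x S :: real
  proof -
    have S: "0 \<le> S" using that zero_le_power2[of x] by linarith
    have "x\<^sup>2 \<le> (9/4) * S" using that zero_le_power2[of x] by linarith
    also have "\<dots> = (3/2 * sqrt S)\<^sup>2"
      using S by (simp add: power_mult_distrib power2_eq_square)
    finally show ?thesis
      using S by (intro power2_le_imp_le[of x]) auto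
  qed
  show "l2_norm N h w \<le> 3/2 * sqrt (energy N h \<tau> v w)"
    "l2_norm N h v \<le> 3/2 * sqrt (energy N h \<tau> v w)"
    "l2_norm N h (dx_plus N h w) \<le> 3/2 * sqrt (energy N h \<tau> v w)"
    "l2_norm N h (dx_plus N h v) \<le> 3/2 * sqrt (energy N h \<tau> v w)"
    unfolding energy_def by (rule *; simp add: field_simps)+
  show "l2_norm N h (\<lambda>j. (w j - v j) / \<tau>) \<le> sqrt (energy N h \<tau> v w)"
    unfolding energy_def by (intro real_le_rsqrt) simp
qed

lemma dx_plus_add: "dx_plus N h (\<lambda>i. v i + w i) j = dx_plus N h v j + dx_plus N h w j"
  by (simp add: dx_plus_def right_nb_def add_divide_distrib diff_divide_distrib)

lemma dx_plus_diff: "dx_plus N h (\<lambda>i. v i - w i) j = dx_plus N h v j - dx_plus N h w j"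
  by (simp add: dx_plus_def right_nb_def diff_divide_distrib)

text \<open>
  Testing the linear scheme with \<open>e2 - e0\<close> makes every term a difference of squares.
\<close>

lemma energy_identity:
  assumes "0 < N" "0 < h" "0 < \<tau>" "e0 \<in> X_grid N" "e1 \<in> X_grid N" "e2 \<in> X_grid N"
    and eq: "\<And>j. j < N \<Longrightarrow> (e2 j - 2 * e1 j + e0 j) / \<tau>\<^sup>2
        - 1 / 2 * dx2 N h (\<lambda>i. e2 i + e0 i) j + 1 / 2 * (e2 j + e0 j) = r j"
  shows "energy N h \<tau> e1 e2 - energy N h \<tau> e0 e1 = h * (\<Sum>j<N. r j * (e2 j - e0 j))"
proof -
  have X: "(\<lambda>i. e2 i + e0 i) \<in> X_grid N" "(\<lambda>i. e2 i - e0 i) \<in> X_grid N"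
    using assms by (auto simp: X_grid_def)
  define A where "A = (\<Sum>j<N. ((e2 j - e1 j) / \<tau>)\<^sup>2 - ((e1 j - e0 j) / \<tau>)\<^sup>2)"
  define B where "B = (\<Sum>j<N. (dx_plus N h e2 j)\<^sup>2 - (dx_plus N h e0 j)\<^sup>2)"
  define C where "C = (\<Sum>j<N. (e2 j)\<^sup>2 - (e0 j)\<^sup>2)"
  have "(\<Sum>j<N. dx2 N h (\<lambda>i. e2 i + e0 i) j * (e2 j - e0 j)) = - B"
    unfolding summation_by_parts[OF assms(1,2) X] B_def
    by (simp add: dx_plus_add dx_plus_diff power2_eq_square algebra_simps)
  moreover have "r j * (e2 j - e0 j) = (((e2 j - e1 j) / \<tau>)\<^sup>2 - ((e1 j - e0 j) / \<tau>)\<^sup>2)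
      - 1 / 2 * (dx2 N h (\<lambda>i. e2 i + e0 i) j * (e2 j - e0 j))
      + 1 / 2 * ((e2 j)\<^sup>2 - (e0 j)\<^sup>2)" if "j < N" for j
  proof -
    have "(e2 j - 2 * e1 j + e0 j) * (e2 j - e0 j) = (e2 j - e1 j)\<^sup>2 - (e1 j - e0 j)\<^sup>2"
      by (simp add: power2_eq_square algebra_simps)
    hence "(e2 j - 2 * e1 j + e0 j) / \<tau>\<^sup>2 * (e2 j - e0 j)
        = ((e2 j - e1 j) / \<tau>)\<^sup>2 - ((e1 j - e0 j) / \<tau>)\<^sup>2"
      by (simp only: power_divide diff_divide_distrib[symmetric] times_divide_eq_left)
    moreover have "(e2 j + e0 j) * (e2 j - e0 j) = (e2 j)\<^sup>2 - (e0 j)\<^sup>2"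
      by (simp add: power2_eq_square algebra_simps)
    ultimately show ?thesis
      unfolding eq[OF that, symmetric] by (simp add: distrib_right left_diff_distrib)
  qed
  hence "(\<Sum>j<N. r j * (e2 j - e0 j)) = A
      - 1 / 2 * (\<Sum>j<N. dx2 N h (\<lambda>i. e2 i + e0 i) j * (e2 j - e0 j)) + 1 / 2 * C"
    unfolding A_def C_def
    by (simp add: sum.distrib sum_subtractf sum_divide_distrib[symmetric])
  ultimately have "(\<Sum>j<N. r j * (e2 j - e0 j)) = A + B / 2 + C / 2" by simp
  moreover have "energy N h \<tau> e1 e2 - energy N h \<tau> e0 e1 = h * A + h * B / 2 + h * C / 2"
    using assms unfolding energy_def l2_norm_sq[OF less_imp_le[OF assms(2)]] A_def B_def C_def
    by (simp add: sum_subtractf right_diff_distrib distrib_left add_divide_distrib diff_divide_distrib)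
  ultimately show ?thesis by (simp add: distrib_left)
qed

text \<open>
  The test function is controlled by the root of the energy times the time step, so that one factor
  \<open>sqrt S' + sqrt S\<close> can be cancelled from \<open>S' - S\<close>. This turns the quadratic energy inequality into a linear
  recursion for the root of the energy.
\<close>

lemma energy_step:
  assumes "0 < N" "0 < h" "0 < \<tau>" "e0 \<in> X_grid N" "e1 \<in> X_grid N" "e2 \<in> X_grid N"
    and eq: "\<And>j. j < N \<Longrightarrow> (e2 j - 2 * e1 j + e0 j) / \<tau>\<^sup>2
        - 1 / 2 * dx2 N h (\<lambda>i. e2 i + e0 i) j + 1 / 2 * (e2 j + e0 j) = r j"
    and r: "\<And>j. j < N \<Longrightarrow> r j * (e2 j - e0 j) \<le> p j * \<bar>e2 j - e0 j\<bar>"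
  shows "sqrt (energy N h \<tau> e1 e2) \<le> sqrt (energy N h \<tau> e0 e1) + \<tau> * l2_norm N h p"
proof -
  define s where "s = sqrt (energy N h \<tau> e0 e1)"
  define s' where "s' = sqrt (energy N h \<tau> e1 e2)"
  have h: "0 \<le> h" using assms by simp
  have nn: "0 \<le> s" "0 \<le> s'" "0 \<le> l2_norm N h p"
    using h by (auto simp: s_def s'_def energy_nonneg l2_norm_nonneg)
  have "l2_norm N h (\<lambda>j. e2 j - e0 j)
      = l2_norm N h (\<lambda>j. \<tau> * ((e2 j - e1 j) / \<tau> + (e1 j - e0 j) / \<tau>))"
    using assms by (intro l2_norm_cong) (simp add: field_simps)
  also have "\<dots> \<le> \<tau> * (s' + s)"
    unfolding l2_norm_scale[OF h] using assms
    by (auto intro!: order_trans[OF l2_norm_triangle[OF h]] add_mono energy_controls(5)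
      simp: s_def s'_def)
  finally have d: "l2_norm N h (\<lambda>j. e2 j - e0 j) \<le> \<tau> * (s' + s)" .
  have "s'\<^sup>2 - s\<^sup>2 = h * (\<Sum>j<N. r j * (e2 j - e0 j))"
    using energy_identity[OF assms(1-7)] by (simp add: s_def s'_def energy_nonneg)
  also have "\<dots> \<le> h * (\<Sum>j<N. \<bar>p j\<bar> * \<bar>e2 j - e0 j\<bar>)"
    using h r by (intro mult_left_mono sum_mono)
      (auto intro!: order_trans[OF r] mult_right_mono)
  also have "\<dots> \<le> l2_norm N h p * l2_norm N h (\<lambda>j. e2 j - e0 j)"
    by (rule cauchy_schwarz_grid[OF h])
  also have "\<dots> \<le> l2_norm N h p * (\<tau> * (s' + s))"
    using d nn by (intro mult_left_mono)
  finally have *: "(s' - s) * (s' + s) \<le> (\<tau> * l2_norm N h p) * (s' + s)"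
    by (simp add: power2_eq_square algebra_simps)
  have "s' - s \<le> \<tau> * l2_norm N h p"
  proof (cases "s' + s = 0")
    case True
    hence "s' - s = 0" using nn by linarith
    thus ?thesis using nn assms(3) by simp
  next
    case False thus ?thesis using * nn by (intro mult_right_le_imp_le[OF *]) auto
  qed
  thus ?thesis by (simp add: s_def s'_def)
qed

section \<open>From Sobolev regularity to classical derivatives\<close>

lemma integrable_open_interval:
  fixes F :: "real \<Rightarrow> real"
  assumes "continuous_on {a..b} F"
  shows "integrable (lebesgue_on {a<..<b}) F"
proof -
  have "integrable (lebesgue_on {a..b}) F"
    by (rule continuous_imp_integrable_real[OF assms])
  hence "set_integrable lebesgue {a..b} F"
    by (simp add: integrable_restrict_space set_integrable_def)
  hence "set_integrable lebesgue {a<..<b} F"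
    by (rule set_integrable_subset) auto
  thus ?thesis by (simp add: integrable_restrict_space set_integrable_def)
qed

lemma LINT_open_interval:
  fixes F :: "real \<Rightarrow> real"
  assumes "continuous_on {a..b} F"
  shows "(LINT x|lebesgue_on {a<..<b}. F x) = integral {a..b} F"
  using lebesgue_integral_eq_integral[OF integrable_open_interval[OF assms]]
  by (simp add: integral_open_interval_real)

lemma test_function_zero_outside:
  assumes "test_function a b \<psi>" "x \<notin> {a<..<b}"
  shows "\<psi> x = 0"
  using assms closure_subset[of "{x. \<psi> x \<noteq> 0}"] unfolding test_function_def by blast

lemma test_functionI:
  assumes "a < p" "q < b" "\<And>x. (\<psi> has_real_derivative \<psi>' x) (at x)" "continuous_on UNIV \<psi>'"
    "\<And>x. x \<notin> {p..q} \<Longrightarrow> \<psi> x = 0"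
  shows "test_function a b \<psi>" "deriv \<psi> = \<psi>'"
proof -
  show d: "deriv \<psi> = \<psi>'" using assms(3) by (auto intro: DERIV_imp_deriv)
  have "{x. \<psi> x \<noteq> 0} \<subseteq> {p..q}" using assms(5) by blast
  hence "closure {x. \<psi> x \<noteq> 0} \<subseteq> {p..q}" by (intro closure_minimal) auto
  also have "\<dots> \<subseteq> {a<..<b}" using assms by auto
  finally show "test_function a b \<psi>"
    unfolding test_function_def d using assms(3,4) by (auto simp: real_differentiable_def)
qed

text \<open>
  Mean zero is what makes the primitive vanish to the right of the support as well.
\<close>

lemma primitive_test_function:
  assumes "a < p" "q < b" "continuous_on UNIV \<eta>" "\<And>x. x \<notin> {p..q} \<Longrightarrow> \<eta> x = 0"
    "integral {a..b} \<eta> = (0::real)"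
  obtains \<psi> where "test_function a b \<psi>" "deriv \<psi> = \<eta>"
proof -
  define \<psi> where "\<psi> x = integral {a..x} \<eta>" for x
  have zero_left: "\<psi> x = 0" if "x < p" for x
  proof -
    have "integral {a..x} \<eta> = integral {a..x} (\<lambda>_. 0)"
      by (intro integral_cong assms(4)) (use that in auto)
    thus ?thesis by (simp add: \<psi>_def)
  qed
  have zero_right: "\<psi> x = 0" if "q < x" for x
  proof -
    have "integral {a..x} \<eta> = integral UNIV (\<lambda>y. if y \<in> {a..x} then \<eta> y else 0)"
      by (rule integral_restrict_UNIV[symmetric])
    also have "(\<lambda>y. if y \<in> {a..x} then \<eta> y else 0) = (\<lambda>y. if y \<in> {a..b} then \<eta> y else 0)"
    proof
      fix y
      show "(if y \<in> {a..x} then \<eta> y else 0) = (if y \<in> {a..b} then \<eta> y else 0)"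
      proof (cases "y \<in> {p..q}")
        case True
        thus ?thesis using assms(1,2) that by simp
      next
        case False
        thus ?thesis using assms(4)[OF False] by simp
      qed
    qed
    also have "integral UNIV \<dots> = integral {a..b} \<eta>"
      by (rule integral_restrict_UNIV)
    finally show ?thesis using assms(5) by (simp add: \<psi>_def)
  qed
  have der: "(\<psi> has_real_derivative \<eta> x) (at x)" for x
  proof (cases "x < p")
    case True
    have "((\<lambda>_. 0) has_real_derivative \<eta> x) (at x)" using assms(4)[of x] True by auto
    thus ?thesis
      by (rule has_field_derivative_transform_within_open[where S = "{..<p}"])
         (use True zero_left in auto)
  next
    case False
    have "(\<psi> has_real_derivative \<eta> x) (at x within {a..x+1})"
      unfolding \<psi>_def[abs_def] using False assms
      by (intro integral_has_real_derivative continuous_on_subset[OF assms(3)]) auto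
    moreover have "x \<in> interior {a..x+1}" using False assms by simp
    ultimately show ?thesis using at_within_interior by metis
  qed
  have out: "\<psi> x = 0" if "x \<notin> {p..q}" for x
  proof -
    have "x < p \<or> q < x" using that by auto
    thus ?thesis using zero_left zero_right by blast
  qed
  show ?thesis
    by (rule that[OF test_functionI[OF assms(1,2) der assms(3) out]])
qed

text \<open>
  Test with \<open>\<psi>' = (w - c) \<kappa>\<close>, where \<open>\<kappa>\<close> is a bump and \<open>c\<close> is the \<open>\<kappa>\<close>-weighted mean of \<open>w\<close>, so that
  \<open>\<psi>'\<close> has mean zero. The orthogonality relation becomes \<open>\<integral> (w - c)\<^sup>2 \<kappa> = 0\<close>, and \<open>w = c\<close> where \<open>\<kappa> > 0\<close>.
\<close>

lemma du_bois_reymond: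
  assumes "a < b" "continuous_on {a..b} w"
    and orth: "\<And>\<psi>. test_function a b \<psi> \<Longrightarrow> integral {a..b} (\<lambda>x. w x * deriv \<psi> x) = (0::real)"
  shows "\<exists>c. \<forall>x\<in>{a..b}. w x = c"
proof -
  have const: "\<exists>c. \<forall>x\<in>{p<..<q}. w x = c" if pq: "a < p" "p < q" "q < b" for p q
  proof -
    \<comment> \<open>An extension of \<open>w\<close> that is continuous on the whole line.\<close>
    define v where "v x = w (max a (min b x))" for x
    define \<kappa> where "\<kappa> x = max 0 ((x - p) * (q - x))" for x
    have v: "continuous_on S v" for S
      unfolding v_def using assms(1)
      by (intro continuous_on_compose2[OF assms(2)] continuous_intros) auto
    have \<kappa>: "continuous_on S \<kappa>" for S unfolding \<kappa>_def by (intro continuous_intros)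
    have \<kappa>0: "\<kappa> x = 0" if "x \<notin> {p..q}" for x
    proof -
      have "x < p \<or> q < x" using that by auto
      hence "(x - p) * (q - x) \<le> 0"
        using pq by (auto intro: mult_nonpos_nonneg mult_nonneg_nonpos)
      thus ?thesis by (simp add: \<kappa>_def)
    qed
    have \<kappa>pos: "0 < \<kappa> x" if "x \<in> {p<..<q}" for x using that unfolding \<kappa>_def by (auto simp: max_def)
    have \<kappa>nn: "0 \<le> \<kappa> x" for x by (simp add: \<kappa>_def)
    note int = integrable_continuous_real[OF continuous_on_mult[OF v \<kappa>]]
      integrable_continuous_real[OF \<kappa>]
    have "integral {a..b} \<kappa> \<noteq> 0"
    proof
      assume "integral {a..b} \<kappa> = 0"
      hence "\<forall>x\<in>{a..b}. \<kappa> x = 0"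
        using integral_eq_0_iff[OF \<kappa> assms(1) \<kappa>nn] by blast
      moreover have "(p + q) / 2 \<in> {a..b}" using pq by simp
      ultimately have "\<kappa> ((p + q) / 2) = 0" by blast
      thus False using \<kappa>pos[of "(p + q) / 2"] pq by simp
    qed
    \<comment> \<open>This value of \<open>c\<close> gives \<open>(v - c) \<kappa>\<close> mean zero.\<close>
    define c where "c = integral {a..b} (\<lambda>x. v x * \<kappa> x) / integral {a..b} \<kappa>"
    define \<eta> where "\<eta> x = v x * \<kappa> x - c * \<kappa> x" for x
    have \<eta>c: "continuous_on S \<eta>" for S unfolding \<eta>_def by (intro continuous_intros v \<kappa>)
    have \<eta>0: "integral {a..b} \<eta> = 0"
      unfolding \<eta>_def using \<open>integral {a..b} \<kappa> \<noteq> 0\<close>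
      by (subst integral_diff) (auto intro!: int integrable_on_mult_right simp: c_def)
    obtain \<psi> where \<psi>: "test_function a b \<psi>" "deriv \<psi> = \<eta>"
      by (rule primitive_test_function[OF pq(1,3) \<eta>c _ \<eta>0]) (auto simp: \<eta>_def \<kappa>0)
    have "integral {a..b} (\<lambda>x. v x * \<eta> x) = integral {a..b} (\<lambda>x. w x * deriv \<psi> x)"
      unfolding \<psi>(2) by (rule integral_cong) (simp add: v_def)
    hence v\<eta>: "integral {a..b} (\<lambda>x. v x * \<eta> x) = 0" using orth[OF \<psi>(1)] by simp
    have "integral {a..b} (\<lambda>x. (v x - c)\<^sup>2 * \<kappa> x) = integral {a..b} (\<lambda>x. v x * \<eta> x - c * \<eta> x)"
      by (rule integral_cong) (simp add: \<eta>_def power2_eq_square algebra_simps)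
    also have "\<dots> = 0"
      using v\<eta> \<eta>0 by (subst integral_diff)
        (auto intro!: integrable_on_mult_right integrable_continuous_real continuous_on_mult v \<eta>c)
    finally have "\<forall>x\<in>{a..b}. (v x - c)\<^sup>2 * \<kappa> x = 0"
      using \<kappa>nn assms(1)
      by (subst (asm) integral_eq_0_iff) (auto intro!: continuous_intros v \<kappa>)
    hence "v x = c" if "x \<in> {p<..<q}" for x using that pq \<kappa>pos[OF that] by force
    moreover have "v x = w x" if "x \<in> {p<..<q}" for x using that pq by (simp add: v_def)
    ultimately show ?thesis by auto
  qed
  have "w x = w y" if "x \<in> {a<..<b}" "y \<in> {a<..<b}" for x y
  proof -
    have "\<exists>c. \<forall>z\<in>{(a + min x y) / 2<..<(b + max x y) / 2}. w z = c"
      by (rule const) (use that in auto)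
    moreover have "x \<in> {(a + min x y) / 2<..<(b + max x y) / 2}"
      "y \<in> {(a + min x y) / 2<..<(b + max x y) / 2}" using that by auto
    ultimately show ?thesis by metis
  qed
  note eq = this
  have "w x = w ((a + b) / 2)" if "x \<in> {a<..<b}" for x
    by (rule eq[OF that]) (use assms(1) in auto)
  note mid = this
  have cl: "closure {a<..<b} = {a..b}" using assms(1) by simp
  have "w x = w ((a + b) / 2)" if "x \<in> {a..b}" for x
    by (rule continuous_constant_on_closure[of "{a<..<b}" w]) (use assms(2) mid that in \<open>simp_all only: cl\<close>)
  thus ?thesis by blast
qed

text \<open>
  The difference of \<open>f\<close> and a primitive of \<open>g\<close> is orthogonal to all derivatives of test functions,
  hence constant.
\<close>

lemma weak_deriv_imp_DERIV:
  assumes "a < b" "continuous_on {a..b} f" "continuous_on {a..b} g" "weak_deriv a b f g"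
    and x: "x \<in> {a..b}"
  shows "(f has_real_derivative g x) (at x within {a..b})"
proof -
  define F where "F x = integral {a..x} g" for x
  have F: "(F has_real_derivative g x) (at x within {a..b})" if "x \<in> {a..b}" for x
    unfolding F_def[abs_def] using that assms by (intro integral_has_real_derivative) auto
  have Fc: "continuous_on {a..b} F" by (meson F DERIV_continuous_on)
  have "integral {a..b} (\<lambda>x. (f x - F x) * deriv \<psi> x) = 0" if \<psi>: "test_function a b \<psi>" for \<psi>
  proof -
    have \<psi>d: "(\<psi> has_real_derivative deriv \<psi> x) (at x within S)" for x S
      using \<psi> unfolding test_function_def
      by (meson DERIV_deriv_iff_real_differentiable has_field_derivative_at_within)
    have \<psi>c: "continuous_on S \<psi>" for S by (meson \<psi>d DERIV_continuous_on)
    have \<psi>'c: "continuous_on S (deriv \<psi>)" for S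
      using \<psi> unfolding test_function_def by (meson continuous_on_subset subset_UNIV)
    have "((\<lambda>x. g x * \<psi> x + F x * deriv \<psi> x) has_integral F b * \<psi> b - F a * \<psi> a) {a..b}"
      using assms(1) by (intro fundamental_theorem_of_calculus)
        (auto intro!: derivative_eq_intros F \<psi>d
          simp flip: has_real_derivative_iff_has_vector_derivative)
    hence "integral {a..b} (\<lambda>x. g x * \<psi> x + F x * deriv \<psi> x) = 0"
      using test_function_zero_outside[OF \<psi>, of a] test_function_zero_outside[OF \<psi>, of b]
      by (simp add: integral_unique)
    moreover have "integral {a..b} (\<lambda>x. f x * deriv \<psi> x) = - integral {a..b} (\<lambda>x. g x * \<psi> x)"
      using assms(4) \<psi> LINT_open_interval[OF continuous_on_mult[OF assms(2) \<psi>'c]]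
        LINT_open_interval[OF continuous_on_mult[OF assms(3) \<psi>c]]
      unfolding weak_deriv_def by auto
    moreover have "(\<lambda>x. g x * \<psi> x) integrable_on {a..b}" "(\<lambda>x. F x * deriv \<psi> x) integrable_on {a..b}"
      "(\<lambda>x. f x * deriv \<psi> x) integrable_on {a..b}"
      by (auto intro!: integrable_continuous_real continuous_on_mult assms \<psi>c \<psi>'c Fc)
    ultimately show ?thesis
      by (simp add: left_diff_distrib integral_diff integral_add)
  qed
  then obtain c where c: "\<forall>x\<in>{a..b}. f x - F x = c"
    using du_bois_reymond[OF assms(1) continuous_on_diff[OF assms(2) Fc]] by blast
  have "((\<lambda>x. F x + c) has_real_derivative g x) (at x within {a..b})"
    using DERIV_add[OF F[OF x] DERIV_const[of c]] by simp
  thus ?thesis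
    by (rule has_field_derivative_transform_within[OF _ zero_less_one x])
       (use c in \<open>auto simp: algebra_simps\<close>)
qed

text \<open>
  Truncating \<open>((x - p) (q - x))\<^sup>k\<close> to \<open>{p..q}\<close> gives bump functions whose derivatives are again truncated
  polynomials, so differentiability reduces to the multiplicity of the roots.
\<close>

definition truncated_poly :: "real \<Rightarrow> real \<Rightarrow> real poly \<Rightarrow> real \<Rightarrow> real"
  where "truncated_poly p q P x = (if x \<in> {p..q} then poly P x else 0)"

lemma DERIV_truncated_poly:
  assumes "p < q" "poly P p = 0" "poly P q = 0" "poly (pderiv P) p = 0" "poly (pderiv P) q = 0"
  shows "(truncated_poly p q P has_real_derivative truncated_poly p q (pderiv P) x) (at x)"
proof -
  consider "x < p" | "q < x" | "x \<in> {p<..<q}" | "x \<in> {p, q}" using assms(1) by force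
  thus ?thesis
  proof cases
    case 1
    show ?thesis
      by (rule has_field_derivative_transform_within_open[of "\<lambda>_. 0" _ _ "{..<p}"])
         (use 1 in \<open>auto simp: truncated_poly_def\<close>)
  next
    case 2
    show ?thesis
      by (rule has_field_derivative_transform_within_open[of "\<lambda>_. 0" _ _ "{q<..}"])
         (use 2 in \<open>auto simp: truncated_poly_def\<close>)
  next
    case 3
    show ?thesis
      by (rule has_field_derivative_transform_within_open[of "poly P" _ _ "{p<..<q}"])
         (use 3 in \<open>auto simp: truncated_poly_def\<close>)
  next
    case 4
    hence x: "poly P x = 0" "poly (pderiv P) x = 0" using assms by auto
    have "((\<lambda>y. (poly P y - poly P x) / (y - x)) \<longlongrightarrow> 0) (at x)"
      using poly_DERIV[of P x] x by (simp add: has_field_derivative_iff)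
    \<comment> \<open>The truncation only decreases absolute values, so its difference quotient is squeezed to 0.\<close>
    hence "((\<lambda>y. \<bar>(poly P y - poly P x) / (y - x)\<bar>) \<longlongrightarrow> 0) (at x)"
      by (rule tendsto_rabs_zero)
    hence "((\<lambda>y. (truncated_poly p q P y - truncated_poly p q P x) / (y - x)) \<longlongrightarrow> 0) (at x)"
      by (rule Lim_null_comparison[rotated])
         (simp add: truncated_poly_def x)
    moreover have "truncated_poly p q (pderiv P) x = 0" using x by (simp add: truncated_poly_def)
    ultimately show ?thesis by (simp only: has_field_derivative_iff)
  qed
qed

lemma pderiv_root_order:
  assumes "[:- c, 1:] ^ Suc k dvd (P :: real poly)"
  shows "[:- c, 1:] ^ k dvd pderiv P"
proof -
  obtain R where R: "P = [:- c, 1:] ^ Suc k * R" using assms by (auto elim: dvdE)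
  have "[:- c, 1:] ^ k dvd smult (of_nat (Suc k)) ([:- c, 1:] ^ k) * pderiv [:- c, 1:] * R"
    by (intro dvd_mult2 dvd_smult dvd_refl)
  moreover have "[:- c, 1:] ^ k dvd [:- c, 1:] ^ Suc k * pderiv R"
    by (intro dvd_mult2) (simp only: power_Suc dvd_triv_right)
  ultimately show ?thesis
    unfolding R pderiv_mult pderiv_power_Suc
    by (metis add.commute dvd_add mult.commute)
qed

text \<open>
  The exponent \<open>m + 2\<close> leaves all derivatives of order up to \<open>m\<close> with double roots at the end points, which
  is what the differentiability of a truncated polynomial requires.
\<close>

lemma smooth_bump:
  assumes "a < p" "p < q" "q < b"
  obtains \<psi> :: "nat \<Rightarrow> real \<Rightarrow> real"
  where "\<And>x. x \<notin> {p..q} \<Longrightarrow> \<psi> 0 x = 0" "\<And>x. 0 \<le> \<psi> 0 x" "\<And>x. x \<in> {p<..<q} \<Longrightarrow> 0 < \<psi> 0 x"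
    "\<And>l. l \<le> m \<Longrightarrow> continuous_on UNIV (\<psi> l)"
    "\<And>l. l < m \<Longrightarrow> test_function a b (\<psi> l) \<and> deriv (\<psi> l) = \<psi> (Suc l)"
proof -
  define P where "P = ([:- p, 1:] * [:q, -1:]) ^ (m + 2)"
  define \<psi> where "\<psi> l = truncated_poly p q ((pderiv ^^ l) P)" for l
  have ord: "[:- c, 1:] ^ (m + 2 - l) dvd (pderiv ^^ l) P" if "l \<le> m" "c \<in> {p, q}" for l c
    using that(1)
  proof (induction l)
    case 0
    have "[:- q, 1:] dvd [:q, -1:]"
      by (rule dvdI[of _ _ "-1"]) simp
    hence "[:- c, 1:] dvd [:- p, 1:] * [:q, -1:]"
    proof (cases "c = p")
      case True
      thus ?thesis by (simp only: dvd_triv_left)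
    next
      case False
      hence "c = q" using that(2) by simp
      with \<open>[:- q, 1:] dvd [:q, -1:]\<close> show ?thesis by (simp only: dvd_mult)
    qed
    thus ?case unfolding P_def diff_zero funpow_0 by (rule dvd_power_same)
  next
    case (Suc l)
    hence "m + 2 - l = Suc (m + 2 - Suc l)" "l \<le> m" by auto
    hence "[:- c, 1:] ^ Suc (m + 2 - Suc l) dvd (pderiv ^^ l) P" using Suc.IH by simp
    from pderiv_root_order[OF this] show ?case unfolding funpow.simps comp_apply .
  qed
  have root: "poly ((pderiv ^^ l) P) c = 0" "poly (pderiv ((pderiv ^^ l) P)) c = 0"
    if "l \<le> m" "c \<in> {p, q}" for l c
  proof -
    have k: "m + 2 - l = Suc (Suc (m - l))" using \<open>l \<le> m\<close> by arith
    have d: "[:- c, 1:] ^ Suc (Suc (m - l)) dvd (pderiv ^^ l) P" using ord[OF that] unfolding k .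
    show "poly ((pderiv ^^ l) P) c = 0"
      unfolding poly_eq_0_iff_dvd by (rule dvd_trans[OF dvd_power d]) simp
    show "poly (pderiv ((pderiv ^^ l) P)) c = 0"
      unfolding poly_eq_0_iff_dvd by (rule dvd_trans[OF dvd_power pderiv_root_order[OF d]]) simp
  qed
  have der: "(\<psi> l has_real_derivative \<psi> (Suc l) x) (at x)" if "l \<le> m" for l x
    unfolding \<psi>_def funpow.simps comp_apply
    by (rule DERIV_truncated_poly) (use that assms(2) root in blast)+
  have cont: "continuous_on UNIV (\<psi> l)" if "l \<le> m" for l
    using der[OF that] by (intro continuous_at_imp_continuous_on ballI DERIV_isCont)
  have zero: "\<psi> l x = 0" if "x \<notin> {p..q}" for l x using that by (auto simp: \<psi>_def truncated_poly_def)
  show ?thesis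
  proof
    show "\<And>x. x \<notin> {p..q} \<Longrightarrow> \<psi> 0 x = 0" by (rule zero)
    have \<psi>0: "\<psi> 0 x = (if x \<in> {p..q} then ((x - p) * (q - x)) ^ (m + 2) else 0)" for x
    proof -
      have "poly [:- p, 1:] x = x - p" "poly [:q, -1:] x = q - x" by auto
      thus ?thesis
        unfolding \<psi>_def truncated_poly_def P_def funpow_0 poly_power poly_mult by (simp only:)
    qed
    show "0 \<le> \<psi> 0 x" for x unfolding \<psi>0 by auto
    show "0 < \<psi> 0 x" if "x \<in> {p<..<q}" for x using that unfolding \<psi>0 by auto
    show "continuous_on UNIV (\<psi> l)" if "l \<le> m" for l by (rule cont[OF that])
    show "test_function a b (\<psi> l) \<and> deriv (\<psi> l) = \<psi> (Suc l)" if "l < m" for l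
    proof -
      have "l \<le> m" "Suc l \<le> m" using that by auto
      from test_functionI[OF assms(1,3) der[OF this(1)] cont[OF this(2)] zero]
      show ?thesis by blast
    qed
  qed
qed

lemma weak_derivs_by_parts:
  assumes "weak_derivs a b m f d"
    "\<And>l. l < m \<Longrightarrow> test_function a b (\<psi> l) \<and> deriv (\<psi> l) = \<psi> (Suc l)" "i \<le> m"
  shows "(LINT x|lebesgue_on {a<..<b}. f x * \<psi> m x)
    = (-1) ^ i * (LINT x|lebesgue_on {a<..<b}. d i x * \<psi> (m - i) x)"
  using assms(3)
proof (induction i)
  case 0 thus ?case using assms(1) by (simp add: weak_derivs_def)
next
  case (Suc i)
  define k where "k = m - Suc i"
  have k: "m - i = Suc k" "k < m" using Suc by (auto simp: k_def)
  have "weak_deriv a b (d i) (d (Suc i))" using assms(1) Suc by (simp add: weak_derivs_def)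
  hence "(LINT x|lebesgue_on {a<..<b}. d i x * \<psi> (Suc k) x)
      = - (LINT x|lebesgue_on {a<..<b}. d (Suc i) x * \<psi> k x)"
    using assms(2)[OF k(2)] unfolding weak_deriv_def by metis
  thus ?case using Suc k by (simp add: k_def)
qed

text \<open>
  The essential bounds concern some family of weak derivatives, the continuous one may be another.
  Both have the same integrals against bumps, which are \<open>m\<close> times differentiable; if the continuous
  one exceeded \<open>M\<close> at a point, a bump supported nearby would contradict the bound on the other. The two
  signs are treated together through \<open>\<sigma>\<close>.
\<close>

lemma weak_derivs_bound:
  assumes "a < b" "weak_derivs a b m f d" "weak_derivs a b m f d'" "continuous_on {a..b} (d m)"
    "AE x in lebesgue_on {a<..<b}. \<bar>d' m x\<bar> \<le> M" "x \<in> {a..b}"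
  shows "\<bar>d m x\<bar> \<le> M"
proof -
  have "\<not> M < \<sigma> * d m x0" if x0: "x0 \<in> {a<..<b}" and \<sigma>: "\<bar>\<sigma>\<bar> = 1" for x0 \<sigma> :: real
  proof
    assume gt: "M < \<sigma> * d m x0"
    define D where "D x = \<sigma> * d m x" for x
    have Dc: "continuous_on {a..b} D" unfolding D_def by (intro continuous_intros assms)
    have "isCont D x0"
      using continuous_on_interior[OF Dc] x0 by simp
    hence "\<forall>\<^sub>F x in nhds x0. M < D x"
      using gt unfolding D_def[symmetric] by (auto simp: isCont_def tendsto_at_iff_tendsto_nhds
        intro: order_tendstoD)
    then obtain r where r: "0 < r" "\<And>x. dist x x0 < r \<Longrightarrow> M < D x"
      unfolding eventually_nhds_metric by blast
    obtain s where s: "0 < s" "s < r" "s < x0 - a" "s < b - x0"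
      using field_lbound_gt_zero[of r "min (x0 - a) (b - x0)"] r x0 by auto
    obtain \<psi> :: "nat \<Rightarrow> real \<Rightarrow> real" where
      \<psi>0: "\<And>x. x \<notin> {x0 - s..x0 + s} \<Longrightarrow> \<psi> 0 x = 0" and
      \<psi>nn: "\<And>x. 0 \<le> \<psi> 0 x" and \<psi>pos: "\<And>x. x \<in> {x0 - s<..<x0 + s} \<Longrightarrow> 0 < \<psi> 0 x" and
      \<psi>c: "\<And>l. l \<le> m \<Longrightarrow> continuous_on UNIV (\<psi> l)" and
      \<psi>t: "\<And>l. l < m \<Longrightarrow> test_function a b (\<psi> l) \<and> deriv (\<psi> l) = \<psi> (Suc l)"
      by (rule smooth_bump[of a "x0 - s" "x0 + s" b m]) (use s in auto)
    have c0: "continuous_on S (\<psi> 0)" for S using \<psi>c[of 0] continuous_on_subset by blast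
    have "(LINT x|lebesgue_on {a<..<b}. d m x * \<psi> 0 x) = (LINT x|lebesgue_on {a<..<b}. d' m x * \<psi> 0 x)"
      using weak_derivs_by_parts[where \<psi> = \<psi> and i = m, OF assms(2) \<psi>t]
        weak_derivs_by_parts[where \<psi> = \<psi> and i = m, OF assms(3) \<psi>t] by simp
    hence "(LINT x|lebesgue_on {a<..<b}. D x * \<psi> 0 x)
        = (LINT x|lebesgue_on {a<..<b}. \<sigma> * d' m x * \<psi> 0 x)"
      unfolding D_def by (simp add: mult.assoc)
    also have "\<dots> \<le> (LINT x|lebesgue_on {a<..<b}. M * \<psi> 0 x)"
    proof (rule integral_mono_AE)
      have bnd: "AE x in lebesgue_on {a<..<b}. \<bar>\<sigma> * d' m x * \<psi> 0 x\<bar> \<le> M * \<psi> 0 x"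
        using assms(5)
      proof eventually_elim
        case (elim x)
        have "\<bar>\<sigma> * d' m x * \<psi> 0 x\<bar> = \<bar>d' m x\<bar> * \<psi> 0 x" using \<sigma> \<psi>nn by (simp add: abs_mult)
        thus ?case using elim \<psi>nn by (simp add: mult_right_mono)
      qed
      show i: "integrable (lebesgue_on {a<..<b}) (\<lambda>x. M * \<psi> 0 x)"
        by (intro integrable_open_interval continuous_intros c0)
      have "d' m \<in> borel_measurable (lebesgue_on {a<..<b})"
        using assms(3) by (auto simp: weak_derivs_def Linf_def)
      moreover have "\<psi> 0 \<in> borel_measurable (lebesgue_on {a<..<b})"
        using integrable_open_interval[OF c0] by blast
      ultimately have "(\<lambda>x. \<sigma> * d' m x * \<psi> 0 x) \<in> borel_measurable (lebesgue_on {a<..<b})"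
        by measurable
      thus "integrable (lebesgue_on {a<..<b}) (\<lambda>x. \<sigma> * d' m x * \<psi> 0 x)"
        by (rule Bochner_Integration.integrable_bound[OF i]) (use bnd in \<open>eventually_elim, simp\<close>)
      show "AE x in lebesgue_on {a<..<b}. \<sigma> * d' m x * \<psi> 0 x \<le> M * \<psi> 0 x"
        using bnd by eventually_elim linarith
    qed
    finally have "integral {a..b} (\<lambda>x. D x * \<psi> 0 x) \<le> integral {a..b} (\<lambda>x. M * \<psi> 0 x)"
      by (simp add: LINT_open_interval continuous_intros Dc c0)
    moreover have "integral {a..b} (\<lambda>x. (D x - M) * \<psi> 0 x)
        = integral {a..b} (\<lambda>x. D x * \<psi> 0 x) - integral {a..b} (\<lambda>x. M * \<psi> 0 x)"
      unfolding left_diff_distrib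
      by (intro integral_diff integrable_continuous_real continuous_intros Dc c0)
    moreover have nn: "0 \<le> (D x - M) * \<psi> 0 x" for x
    proof (cases "x \<in> {x0 - s..x0 + s}")
      case True
      hence "dist x x0 < r" using s r by (auto simp: dist_real_def)
      thus ?thesis using r(2)[of x] \<psi>nn by simp
    qed (simp add: \<psi>0)
    hence "0 \<le> integral {a..b} (\<lambda>x. (D x - M) * \<psi> 0 x)"
      by (intro integral_nonneg integrable_continuous_real continuous_intros Dc c0)
    ultimately have "integral {a..b} (\<lambda>x. (D x - M) * \<psi> 0 x) = 0" by linarith
    hence "(D x0 - M) * \<psi> 0 x0 = 0"
      using nn x0 assms(1)
      by (subst (asm) integral_eq_0_iff) (auto intro!: continuous_intros Dc c0)
    thus False using gt \<psi>pos[of x0] s by (simp add: D_def)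
  qed
  from this[of _ 1] this[of _ "-1"]
  have "\<bar>d m x0\<bar> \<le> M" if "x0 \<in> {a<..<b}" for x0
    using that by (force simp: abs_le_iff not_less)
  thus ?thesis
    using continuous_on_closure_norm_le[of "{a<..<b}" "d m" M x] assms by simp
qed

lemma continuous_AE_bound:
  fixes f :: "'a::euclidean_space \<Rightarrow> real"
  assumes "open I" "I \<subseteq> S" "S \<in> sets lebesgue" "continuous_on (closure I) f"
    "AE x in lebesgue_on S. \<bar>f x\<bar> \<le> c" "x \<in> closure I"
  shows "\<bar>f x\<bar> \<le> c"
proof -
  define B where "B = {x \<in> I. c < \<bar>f x\<bar>}"
  have "AE x in lebesgue. x \<in> S \<longrightarrow> \<bar>f x\<bar> \<le> c"
    using assms(3,5) by (simp add: AE_restrict_space_iff)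
  then obtain N where N: "N \<in> null_sets lebesgue" "{x. \<not> (x \<in> S \<longrightarrow> \<bar>f x\<bar> \<le> c)} \<subseteq> N"
    by (auto simp: eventually_ae_filter)
  hence "negligible N" by (simp add: negligible_iff_null_sets)
  moreover have "B \<subseteq> N" using N assms(2) by (force simp: B_def)
  ultimately have "negligible B" by (rule negligible_subset)
  moreover have "open B"
  proof -
    have "continuous_on I (\<lambda>x. \<bar>f x\<bar>)"
      using continuous_on_subset[OF assms(4) closure_subset] by (intro continuous_intros)
    hence "open (I \<inter> (\<lambda>x. \<bar>f x\<bar>) -` {c<..})"
      using assms(1) by (intro continuous_open_preimage) auto
    thus ?thesis by (simp add: B_def Int_def vimage_def)
  qed
  ultimately have "B = {}" using open_not_negligible by blast
  hence "\<forall>x\<in>I. norm (f x) \<le> c" by (auto simp: B_def not_less)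
  thus ?thesis using continuous_on_closure_norm_le[OF assms(4) _ assms(6)] by simp
qed

lemma AE_le_Linf_norm: "AE x in lebesgue_on S. ereal \<bar>f x\<bar> \<le> Linf_norm S f"
  unfolding Linf_norm_def by (rule esssup_AE)

lemma abs_le_Linf_norm:
  fixes f :: "'a::euclidean_space \<Rightarrow> real"
  assumes "open I" "I \<subseteq> S" "S \<in> sets lebesgue" "continuous_on (closure I) f" "x \<in> closure I"
  shows "ereal \<bar>f x\<bar> \<le> Linf_norm S f"
proof (rule ereal_le_real)
  fix z assume "Linf_norm S f \<le> ereal z"
  with AE_le_Linf_norm[of f S] have "AE x in lebesgue_on S. \<bar>f x\<bar> \<le> z"
    by (auto elim!: eventually_mono dest: order_trans)
  from continuous_AE_bound[OF assms(1-4) this assms(5)] show "ereal \<bar>f x\<bar> \<le> ereal z" by simp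
qed

text \<open>
  Fubini for null sets: an essential bound on the space-time cylinder holds on almost every time
  slice.
\<close>

lemma AE_product_slices:
  fixes P :: "real \<times> real \<Rightarrow> bool"
  assumes "A \<in> sets lebesgue" "B \<in> sets lebesgue" "A \<times> B \<in> sets lebesgue"
    "AE z in lebesgue_on (A \<times> B). P z"
  shows "AE t in lebesgue_on A. AE x in lebesgue_on B. P (t, x)"
proof -
  have "AE z in lebesgue. z \<in> A \<times> B \<longrightarrow> P z"
    using assms by (simp add: AE_restrict_space_iff)
  hence "AE z in lborel \<Otimes>\<^sub>M lborel. z \<in> A \<times> B \<longrightarrow> P z"
    unfolding lborel_prod AE_completion_iff .
  from lborel_pair.AE_pair[OF this]
  have "AE t in lebesgue. AE x in lebesgue. t \<in> A \<and> x \<in> B \<longrightarrow> P (t, x)"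
    by (simp add: AE_completion_iff)
  hence "AE t in lebesgue. t \<in> A \<longrightarrow> (AE x in lebesgue. x \<in> B \<longrightarrow> P (t, x))"
    by eventually_elim auto
  thus ?thesis using assms by (simp add: AE_restrict_space_iff)
qed

lemma Linf_norm_nonneg:
  assumes "a < b"
  shows "0 \<le> Linf_norm {a<..<b::real} f"
proof (rule ccontr)
  assume "\<not> 0 \<le> Linf_norm {a<..<b} f"
  hence "AE x in lebesgue_on {a<..<b}. \<bar>(\<lambda>_. 0) x\<bar> \<le> (-1::real)"
    using AE_le_Linf_norm[of f "{a<..<b}"]
    by (auto elim!: eventually_mono simp: not_le dest: order_le_less_trans)
  from continuous_AE_bound[OF _ _ _ _ this, of "{a<..<b}" "(a + b) / 2"] assms show False by simp
qed

lemma Linf_norm_le_W_norm: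
  assumes "a < b"
  shows "Linf_norm {a<..<b} f \<le> W_norm a b m f"
  unfolding W_norm_def
proof (rule INF_greatest)
  fix d assume "d \<in> {d. weak_derivs a b m f d}"
  hence "d 0 = f" by (simp add: weak_derivs_def)
  hence "Linf_norm {a<..<b} f = (\<Sum>l\<in>{0}. Linf_norm {a<..<b} (d l))" by simp
  also have "\<dots> \<le> (\<Sum>l\<le>m. Linf_norm {a<..<b} (d l))"
    by (rule sum_mono2) (auto simp: Linf_norm_nonneg[OF assms])
  finally show "Linf_norm {a<..<b} f \<le> (\<Sum>l\<le>m. Linf_norm {a<..<b} (d l))" .
qed

text \<open>
  On continuous functions the essential supremum is the supremum, so convergence in the Sobolev norm
  is in particular pointwise. This turns the Banach space valued time derivatives into classical
  ones.
\<close>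

lemma W_norm_tendsto_pointwise:
  assumes "a < b" "((\<lambda>s. W_norm a b m (w s)) \<longlongrightarrow> 0) F"
    "eventually (\<lambda>s. continuous_on {a..b} (w s)) F" "x \<in> {a..b}"
  shows "((\<lambda>s. w s x) \<longlongrightarrow> 0) F"
proof -
  have "((\<lambda>s. ereal \<bar>w s x\<bar>) \<longlongrightarrow> 0) F"
  proof (rule tendsto_sandwich[OF _ _ tendsto_const assms(2)])
    show "eventually (\<lambda>s. ereal \<bar>w s x\<bar> \<le> W_norm a b m (w s)) F"
      using assms(3)
    proof eventually_elim
      case (elim s)
      have "ereal \<bar>w s x\<bar> \<le> Linf_norm {a<..<b} (w s)"
        by (rule abs_le_Linf_norm[of "{a<..<b}"]) (use assms elim in auto)
      thus ?case using Linf_norm_le_W_norm[OF assms(1)] order_trans by blast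
    qed
  qed auto
  hence "((\<lambda>s. \<bar>w s x\<bar>) \<longlongrightarrow> 0) F" by (simp add: zero_ereal_def)
  thus ?thesis by (rule tendsto_rabs_zero_cancel)
qed

lemma W_per_continuous: "f \<in> W_per a b m \<Longrightarrow> 1 \<le> m \<Longrightarrow> continuous_on {a..b} f"
  unfolding W_per_def weak_derivs_def by force

lemma W_per_periodic: "f \<in> W_per a b m \<Longrightarrow> 1 \<le> m \<Longrightarrow> f a = f b"
  unfolding W_per_def weak_derivs_def by force

lemma Ck_W_per_DERIV:
  assumes "a < b" "Ck_W_per a b T k m v" "1 \<le> m" "r < k" "t \<in> {0..T}" "x \<in> {a..b}"
  shows "((\<lambda>t. v r t x) has_real_derivative v (Suc r) t x) (at t within {0..T})"
proof -
  have W: "v i s \<in> W_per a b m" if "i \<le> k" "s \<in> {0..T}" for i s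
    using assms(2) that unfolding Ck_W_per_def by blast
  have "((\<lambda>s. (v r s x - v r t x) / (s - t) - v (Suc r) t x) \<longlongrightarrow> 0) (at t within {0..T})"
  proof (rule W_norm_tendsto_pointwise[where m = m and
        w = "\<lambda>s x. (v r s x - v r t x) / (s - t) - v (Suc r) t x", OF assms(1)])
    show "((\<lambda>s. W_norm a b m (\<lambda>x. (v r s x - v r t x) / (s - t) - v (Suc r) t x)) \<longlongrightarrow> 0)
        (at t within {0..T})"
      using assms unfolding Ck_W_per_def by blast
    show "\<forall>\<^sub>F s in at t within {0..T}.
        continuous_on {a..b} (\<lambda>x. (v r s x - v r t x) / (s - t) - v (Suc r) t x)"
      unfolding eventually_at_filter
    proof (intro always_eventually allI impI)
      fix s assume "s \<noteq> t" "s \<in> {0..T}"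
      hence "continuous_on {a..b} (v r s)" "continuous_on {a..b} (v r t)"
        "continuous_on {a..b} (v (Suc r) t)"
        using assms by (auto intro: W_per_continuous[OF W])
      with \<open>s \<noteq> t\<close> show "continuous_on {a..b} (\<lambda>x. (v r s x - v r t x) / (s - t) - v (Suc r) t x)"
        by (intro continuous_intros) auto
    qed
  qed (use assms in auto)
  thus ?thesis by (simp add: has_field_derivative_iff LIM_zero_iff)
qed

lemma Ck_W_per_continuous:
  assumes "a < b" "Ck_W_per a b T k m v" "1 \<le> m" "r \<le> k" "x \<in> {a..b}"
  shows "continuous_on {0..T} (\<lambda>t. v r t x)"
  unfolding continuous_on_def
proof
  fix t assume t: "t \<in> {0..T}"
  have W: "v r s \<in> W_per a b m" if "s \<in> {0..T}" for s
    using assms(2,4) that unfolding Ck_W_per_def by blast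
  have "((\<lambda>s. v r s x - v r t x) \<longlongrightarrow> 0) (at t within {0..T})"
  proof (rule W_norm_tendsto_pointwise[where m = m and
        w = "\<lambda>s x. v r s x - v r t x", OF assms(1)])
    show "((\<lambda>s. W_norm a b m (\<lambda>x. v r s x - v r t x)) \<longlongrightarrow> 0) (at t within {0..T})"
      using assms t unfolding Ck_W_per_def by blast
    show "\<forall>\<^sub>F s in at t within {0..T}. continuous_on {a..b} (\<lambda>x. v r s x - v r t x)"
      unfolding eventually_at_filter
    proof (intro always_eventually allI impI)
      fix s assume "s \<noteq> t" "s \<in> {0..T}"
      hence "continuous_on {a..b} (v r s)" "continuous_on {a..b} (v r t)"
        using assms t by (auto intro: W_per_continuous[OF W])
      thus "continuous_on {a..b} (\<lambda>x. v r s x - v r t x)"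
        by (intro continuous_intros)
    qed
  qed (use assms in auto)
  thus "((\<lambda>t. v r t x) \<longlongrightarrow> v r t x) (at t within {0..T})" by (simp add: LIM_zero_iff)
qed

text \<open>
  \<open>d\<close> is the list of classical derivatives of the periodic function \<open>f\<close>, up to one-sided derivatives
  at the end points, with a bound on the last one only.
\<close>

definition regular_chain :: "real \<Rightarrow> real \<Rightarrow> real \<Rightarrow> nat \<Rightarrow> (real \<Rightarrow> real) \<Rightarrow> (nat \<Rightarrow> real \<Rightarrow> real) \<Rightarrow> bool"
  where "regular_chain a b M s f d \<longleftrightarrow> d 0 = f \<and>
    (\<forall>l<s. \<forall>x\<in>{a..b}. (d l has_real_derivative d (Suc l) x) (at x within {a..b})) \<and>
    (\<forall>l\<le>s. d l a = d l b) \<and> (\<forall>x\<in>{a..b}. \<bar>d s x\<bar> \<le> M)"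

lemma AE_regular_chain:
  assumes "a < b" "Ck_W_per a b T k m v" "r \<le> k" "s < m"
    and g: "AE t in lebesgue_on {0..T}. \<exists>d. weak_derivs a b s (v r t) d \<and> g t = d s"
      "Linf_norm ({0..T} \<times> {a<..<b}) (\<lambda>(t, x). g t x) \<le> ereal M"
  shows "AE t in lebesgue_on {0..T}. \<exists>d. regular_chain a b M s (v r t) d"
proof -
  have "AE z in lebesgue_on ({0..T} \<times> {a<..<b}). \<bar>(case z of (t, x) \<Rightarrow> g t x)\<bar> \<le> M"
    using AE_le_Linf_norm[of "\<lambda>(t, x). g t x" "{0..T} \<times> {a<..<b}"]
    by eventually_elim (metis ereal_less_eq(3) g(2) order_trans)
  moreover have "{0..T} \<times> {a<..<b} \<in> sets (lebesgue :: (real \<times> real) measure)"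
    by (intro sets_completionI_sets) (auto simp: borel_prod[symmetric])
  ultimately have "AE t in lebesgue_on {0..T}. AE x in lebesgue_on {a<..<b}. \<bar>g t x\<bar> \<le> M"
    using AE_product_slices[of "{0..T}" "{a<..<b}" "\<lambda>z. \<bar>case z of (t, x) \<Rightarrow> g t x\<bar> \<le> M"] by simp
  moreover have "AE t in lebesgue_on {0..T}. t \<in> {0..T}" using AE_space by auto
  ultimately show ?thesis using g(1)
  proof eventually_elim
    case (elim t)
    obtain d' where d': "weak_derivs a b s (v r t) d'" "g t = d' s" using elim by blast
    have "v r t \<in> W_per a b m" using assms(2,3) elim(2) unfolding Ck_W_per_def by blast
    then obtain d where d: "weak_derivs a b m (v r t) d"
      "\<And>l. l < m \<Longrightarrow> continuous_on {a..b} (d l) \<and> d l a = d l b"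
      unfolding W_per_def by blast
    have ds: "weak_derivs a b s (v r t) d" using d(1) \<open>s < m\<close> by (auto simp: weak_derivs_def)
    have "(d l has_real_derivative d (Suc l) x) (at x within {a..b})" if "l < s" "x \<in> {a..b}" for l x
      using that d \<open>s < m\<close> assms(1) by (intro weak_deriv_imp_DERIV) (auto simp: weak_derivs_def)
    moreover have "\<bar>d s x\<bar> \<le> M" if "x \<in> {a..b}" for x
      by (rule weak_derivs_bound[OF assms(1) ds d'(1) _ _ that])
         (use d(2) \<open>s < m\<close> elim(1) d'(2) in auto)
    ultimately have "regular_chain a b M s (v r t) d"
      using d \<open>s < m\<close> by (auto simp: regular_chain_def weak_derivs_def)
    thus ?case by blast
  qed
qed

section \<open>Consistency of the difference quotients\<close>

lemma taylor_bound:
  fixes d :: "nat \<Rightarrow> real \<Rightarrow> real"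
  assumes "\<And>l x. l \<le> n \<Longrightarrow> x \<in> {p..q} \<Longrightarrow> (d l has_real_derivative d (Suc l) x) (at x within {p..q})"
    and "\<And>x. x \<in> {p..q} \<Longrightarrow> \<bar>d (Suc n) x\<bar> \<le> B" and "w \<in> {p..q}" "z \<in> {p..q}"
  shows "\<bar>d 0 z - (\<Sum>i\<le>n. d i w * (z - w) ^ i / fact i)\<bar> \<le> B * \<bar>z - w\<bar> ^ Suc n"
proof -
  have B: "0 \<le> B" using assms(2)[OF assms(3)] by linarith
  have "norm (d 0 z - (\<Sum>i\<le>n. d i w * (z - w) ^ i / fact i)) \<le> B * norm (z - w) ^ Suc n / fact n"
    by (rule field_Taylor[of "{p..q}"]) (use assms in auto)
  also have "\<dots> \<le> B * norm (z - w) ^ Suc n / 1"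
    using B by (intro divide_left_mono mult_nonneg_nonneg) (auto simp: fact_ge_1)
  finally show ?thesis by simp
qed

text \<open>
  The two arguments \<open>x\<close> and \<open>y\<close> coincide at interior grid points; at the boundary they are the two end
  points of the period, where a periodic function has matching Taylor coefficients.
\<close>

lemma second_difference_bound:
  assumes "\<And>x. x \<in> {p..q} \<Longrightarrow> (f has_real_derivative f1 x) (at x within {p..q})"
    "\<And>x. x \<in> {p..q} \<Longrightarrow> (f1 has_real_derivative f2 x) (at x within {p..q})"
    "\<And>x. x \<in> {p..q} \<Longrightarrow> \<bar>f2 x\<bar> \<le> B" "x + k \<in> {p..q}" "y - k \<in> {p..q}" "x \<in> {p..q}" "y \<in> {p..q}"
    "f x = f y" "f1 x = f1 y" "0 \<le> k"
  shows "\<bar>f (x + k) - 2 * f x + f (y - k)\<bar> \<le> 2 * B * k\<^sup>2"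
proof -
  define d where "d = (\<lambda>l::nat. if l = 0 then f else if l = 1 then f1 else f2)"
  have 1: "(d l has_real_derivative d (Suc l) x) (at x within {p..q})" if "l \<le> 1" "x \<in> {p..q}" for l x
    using that assms(1,2) by (auto simp: d_def le_Suc_eq)
  have 2: "\<bar>d (Suc 1) x\<bar> \<le> B" if "x \<in> {p..q}" for x using that assms(3) by (auto simp: d_def)
  have "\<bar>f (x + k) - f x - f1 x * k\<bar> \<le> B * k\<^sup>2"
    using taylor_bound[of 1 p q d B x "x + k", OF 1 2] assms
    by (simp add: d_def power2_eq_square algebra_simps)
  moreover have "\<bar>f (y - k) - f y + f1 y * k\<bar> \<le> B * k\<^sup>2"
    using taylor_bound[of 1 p q d B y "y - k", OF 1 2] assms
    by (simp add: d_def power2_eq_square algebra_simps)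
  ultimately show ?thesis using assms(8,9) by (simp add: abs_le_iff)
qed

text \<open>
  As in the previous lemma \<open>x\<close> and \<open>y\<close> are equal up to periodicity; the odd Taylor terms cancel.
\<close>

lemma second_difference_expansion:
  assumes d: "\<And>l x. l \<le> 3 \<Longrightarrow> x \<in> {p..q} \<Longrightarrow> (d l has_real_derivative d (Suc l) x) (at x within {p..q})"
    and "\<And>x. x \<in> {p..q} \<Longrightarrow> \<bar>d 4 x\<bar> \<le> B" "x + k \<in> {p..q}" "y - k \<in> {p..q}" "x \<in> {p..q}" "y \<in> {p..q}"
    "\<And>l. l \<le> 3 \<Longrightarrow> d l x = d l y" "0 \<le> k"
  shows "\<bar>d 0 (x + k) - 2 * d 0 x + d 0 (y - k) - k\<^sup>2 * d 2 x\<bar> \<le> 2 * B * k ^ 4"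
proof -
  have 2: "\<bar>d (Suc 3) x\<bar> \<le> B" if "x \<in> {p..q}" for x using that assms(2) by (simp add: numeral_eq_Suc)
  have 3: "d 0 x = d 0 y" "d (Suc 0) x = d (Suc 0) y" "d 2 x = d 2 y" "d 3 x = d 3 y" using assms(7) by auto
  have sum3: "(\<Sum>i\<le>3. g i) = g 0 + g 1 + g 2 + g 3" for g :: "nat \<Rightarrow> real"
    by (simp add: numeral_eq_Suc)
  have "\<bar>d 0 (x + k) - (\<Sum>i\<le>3. d i x * (x + k - x) ^ i / fact i)\<bar> \<le> B * \<bar>x + k - x\<bar> ^ Suc 3"
    by (rule taylor_bound[OF d 2]) (use assms in auto)
  moreover have "\<bar>d 0 (y - k) - (\<Sum>i\<le>3. d i y * (y - k - y) ^ i / fact i)\<bar> \<le> B * \<bar>y - k - y\<bar> ^ Suc 3"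
    by (rule taylor_bound[OF d 2]) (use assms in auto)
  moreover have "(\<Sum>i\<le>3. d i x * (x + k - x) ^ i / fact i) + (\<Sum>i\<le>3. d i y * (y - k - y) ^ i / fact i)
      = 2 * d 0 x + k\<^sup>2 * d 2 x"
    unfolding sum3 by (simp add: 3 fact_numeral power3_eq_cube field_simps)
  moreover have "B * \<bar>x + k - x\<bar> ^ Suc 3 = B * k ^ 4" "B * \<bar>y - k - y\<bar> ^ Suc 3 = B * k ^ 4"
    using assms(8) by (simp_all add: numeral_eq_Suc)
  ultimately show ?thesis by linarith
qed

lemma grid_point_mem:
  assumes "a < b" "0 < N" "h = (b - a) / real N" "i \<le> N"
  shows "a + real i * h \<in> {a..b}"
proof -
  have h: "0 \<le> h" "real N * h = b - a" using assms by auto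
  have "real i * h \<le> real N * h" using h assms(4) by (intro mult_right_mono) auto
  thus ?thesis using h by simp
qed

text \<open>
  The periodic neighbours of a grid point are reached without leaving \<open>{a..b}\<close> by going to the right
  from \<open>p\<close> and to the left from \<open>q\<close>, two representatives of the grid point modulo the period.
\<close>

lemma grid_neighbours:
  assumes "a < b" "0 < N" "h = (b - a) / real N" "j \<le> N"
  obtains p q where "p \<in> {a..b}" "q \<in> {a..b}" "p + h \<in> {a..b}" "q - h \<in> {a..b}"
    "\<And>f. f a = f b \<Longrightarrow> f p = (f (a + real j * h) :: real)" "\<And>f. f a = f b \<Longrightarrow> f q = (f (a + real j * h) :: real)"
    "\<And>f. right_nb N (\<lambda>i. f (a + real i * h)) j = f (p + h)"
    "\<And>f. left_nb N (\<lambda>i. f (a + real i * h)) j = f (q - h)"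
proof -
  define p where "p = (if j = N then a else a + real j * h)"
  define q where "q = (if j = 0 then b else a + real j * h)"
  have h: "0 < h" using assms by simp
  have N: "a + real N * h = b" using assms by simp
  have r: "p + h = a + real (if j = N then 1 else j + 1) * h" by (simp add: p_def algebra_simps)
  have l: "q - h = a + real (if j = 0 then N - 1 else j - 1) * h"
    using assms(2) N by (auto simp: q_def algebra_simps of_nat_diff)
  note mem = grid_point_mem[OF assms(1-3)]
  show ?thesis
  proof
    show "p \<in> {a..b}" "q \<in> {a..b}" using mem[OF assms(4)] assms(1) by (auto simp: p_def q_def)
    show "p + h \<in> {a..b}" unfolding r using assms(2,4) by (intro mem) auto
    show "q - h \<in> {a..b}" unfolding l using assms(2,4) by (intro mem) auto
    show "f p = f (a + real j * h)" if "f a = f b" for f :: "real \<Rightarrow> real"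
      using that N by (simp add: p_def)
    show "f q = f (a + real j * h)" if "f a = f b" for f :: "real \<Rightarrow> real"
      using that by (simp add: q_def)
    show "right_nb N (\<lambda>i. f (a + real i * h)) j = f (p + h)" for f
      unfolding r by (simp add: right_nb_def)
    show "left_nb N (\<lambda>i. f (a + real i * h)) j = f (q - h)" for f
      unfolding l by (simp add: left_nb_def)
  qed
qed

lemma dx2_bound:
  assumes "a < b" "0 < N" "h = (b - a) / real N" "j \<le> N" "regular_chain a b M 2 f d"
  shows "\<bar>dx2 N h (\<lambda>i. f (a + real i * h)) j\<bar> \<le> 2 * M"
proof -
  have h: "0 < h" using assms by simp
  from grid_neighbours[OF assms(1-4)] obtain p q where pq:
    "p \<in> {a..b}" "q \<in> {a..b}" "p + h \<in> {a..b}" "q - h \<in> {a..b}"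
    "\<And>f. f a = f b \<Longrightarrow> f p = (f (a + real j * h) :: real)" "\<And>f. f a = f b \<Longrightarrow> f q = (f (a + real j * h) :: real)"
    and nb: "\<And>f. right_nb N (\<lambda>i. f (a + real i * h)) j = f (p + h)"
    "\<And>f. left_nb N (\<lambda>i. f (a + real i * h)) j = f (q - h)" by blast
  have d: "d 0 = f" "\<And>l. l \<le> 2 \<Longrightarrow> d l a = d l b" using assms(5) by (auto simp: regular_chain_def)
  have p: "d l p = d l (a + real j * h)" "d l q = d l (a + real j * h)" if "l \<le> 2" for l
    using pq(5,6)[of "d l"] d(2)[OF that] by auto
  have "\<bar>d 0 (p + h) - 2 * d 0 p + d 0 (q - h)\<bar> \<le> 2 * M * h\<^sup>2"
    by (rule second_difference_bound[of a b "d 0" "d 1" "d 2"])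
       (use assms(5) pq(1-4) p h in \<open>auto simp: regular_chain_def numeral_2_eq_2\<close>)
  hence "\<bar>(f (p + h) - 2 * f (a + real j * h) + f (q - h)) / h\<^sup>2\<bar> \<le> 2 * M"
    using p(1)[of 0] d(1) h by (simp add: abs_divide field_simps)
  thus ?thesis by (simp add: dx2_def nb)
qed

lemma dx2_consistency:
  assumes "a < b" "0 < N" "h = (b - a) / real N" "j \<le> N" "regular_chain a b M 4 f d"
  shows "\<bar>dx2 N h (\<lambda>i. f (a + real i * h)) j - d 2 (a + real j * h)\<bar> \<le> 2 * M * h\<^sup>2"
proof -
  have h: "0 < h" using assms by simp
  from grid_neighbours[OF assms(1-4)] obtain p q where pq:
    "p \<in> {a..b}" "q \<in> {a..b}" "p + h \<in> {a..b}" "q - h \<in> {a..b}"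
    "\<And>f. f a = f b \<Longrightarrow> f p = (f (a + real j * h) :: real)" "\<And>f. f a = f b \<Longrightarrow> f q = (f (a + real j * h) :: real)"
    and nb: "\<And>f. right_nb N (\<lambda>i. f (a + real i * h)) j = f (p + h)"
    "\<And>f. left_nb N (\<lambda>i. f (a + real i * h)) j = f (q - h)" by blast
  have d: "d 0 = f" "\<And>l. l \<le> 4 \<Longrightarrow> d l a = d l b" using assms(5) by (auto simp: regular_chain_def)
  have p: "d l p = d l (a + real j * h)" "d l q = d l (a + real j * h)" if "l \<le> 4" for l
    using pq(5,6)[of "d l"] d(2)[OF that] by auto
  have "\<bar>d 0 (p + h) - 2 * d 0 p + d 0 (q - h) - h\<^sup>2 * d 2 p\<bar> \<le> 2 * M * h ^ 4"
    by (rule second_difference_expansion[of a b d])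
       (use assms(5) pq(1-4) p h in \<open>auto simp: regular_chain_def\<close>)
  also have "\<dots> = 2 * M * h\<^sup>2 * h\<^sup>2" by (simp add: power2_eq_square numeral_eq_Suc)
  finally have "\<bar>(f (p + h) - 2 * f (a + real j * h) + f (q - h)) / h\<^sup>2 - d 2 (a + real j * h)\<bar>
      \<le> 2 * M * h\<^sup>2"
    using p[of 0] p[of 2] d h by (simp add: field_simps abs_le_iff)
  thus ?thesis by (simp add: dx2_def nb)
qed

text \<open>
  All that the error analysis needs to know about the exact solution: \<open>v r\<close> is its \<open>r\<close>-th time
  derivative, and second space derivatives occur only through difference quotients. In this form the
  bounds hold at every time: they are closed conditions, continuous in time, whereas the bounds on the
  space derivatives themselves are known for almost every time only.
\<close>

locale smooth_solution =
  fixes a b T M \<epsilon> :: real and v :: "nat \<Rightarrow> real \<Rightarrow> real \<Rightarrow> real" and uxx :: "real \<Rightarrow> real \<Rightarrow> real"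
  assumes ab: "a < b" and T: "0 < T"
    and v_deriv: "\<And>r t x. r \<le> 3 \<Longrightarrow> t \<in> {0..T} \<Longrightarrow> x \<in> {a..b} \<Longrightarrow>
      ((\<lambda>t. v r t x) has_real_derivative v (Suc r) t x) (at t within {0..T})"
    and v_bound: "\<And>r t x. r \<le> 4 \<Longrightarrow> t \<in> {0..T} \<Longrightarrow> x \<in> {a..b} \<Longrightarrow> \<bar>v r t x\<bar> \<le> M"
    and v_periodic: "\<And>r t. r \<le> 4 \<Longrightarrow> t \<in> {0..T} \<Longrightarrow> v r t a = v r t b"
    and utt_lipschitz: "\<And>t x y. t \<in> {0..T} \<Longrightarrow> x \<in> {a..b} \<Longrightarrow> y \<in> {a..b} \<Longrightarrow>
      \<bar>v 2 t x - v 2 t y\<bar> \<le> M * \<bar>x - y\<bar>"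
    and utt_dx2: "\<And>t N h j. t \<in> {0..T} \<Longrightarrow> 0 < N \<Longrightarrow> h = (b - a) / real N \<Longrightarrow> j \<le> N \<Longrightarrow>
      \<bar>dx2 N h (\<lambda>i. v 2 t (a + real i * h)) j\<bar> \<le> 2 * M"
    and u_dx2: "\<And>t N h j. t \<in> {0..T} \<Longrightarrow> 0 < N \<Longrightarrow> h = (b - a) / real N \<Longrightarrow> j \<le> N \<Longrightarrow>
      \<bar>dx2 N h (\<lambda>i. v 0 t (a + real i * h)) j - uxx t (a + real j * h)\<bar> \<le> 2 * M * h\<^sup>2"
    and pde: "\<And>t x. t \<in> {0..T} \<Longrightarrow> x \<in> {a..b} \<Longrightarrow>
      v 2 t x - uxx t x + v 0 t x + g_reg \<epsilon> (v 0 t x) = 0"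

lemma DERIV_unique_Icc:
  fixes f :: "real \<Rightarrow> real"
  assumes "p < q" "x \<in> {p..q}" "(f has_real_derivative A) (at x within {p..q})"
    "(f has_real_derivative B) (at x within {p..q})"
  shows "A = B"
proof -
  have "at x within {p..q} \<noteq> bot"
    using assms(1,2) by (simp add: trivial_limit_within islimpt_Icc)
  thus ?thesis
    using tendsto_unique assms(3,4) unfolding has_field_derivative_iff by blast
qed

lemma continuous_on_dx2:
  assumes "\<And>i. i \<le> N \<Longrightarrow> continuous_on S (\<lambda>t. w t i)" "0 < N" "j \<le> N"
  shows "continuous_on S (\<lambda>t. dx2 N h (w t) j)"
proof -
  have "continuous_on S (\<lambda>t. right_nb N (w t) j)" "continuous_on S (\<lambda>t. left_nb N (w t) j)"
    unfolding right_nb_def left_nb_def using assms(2,3)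
    by (cases "j = N"; cases "j = 0"; simp add: assms(1))+
  thus ?thesis
    unfolding dx2_def divide_inverse by (intro continuous_intros assms)
qed

lemma AE_bound_extends:
  fixes T :: real
  assumes "0 < T" "continuous_on {0..T} f" "AE t in lebesgue_on {0..T}. \<bar>f t\<bar> \<le> (c::real)" "t \<in> {0..T}"
  shows "\<bar>f t\<bar> \<le> c"
  by (rule continuous_AE_bound[of "{0<..<T}" "{0..T}"]) (use assms in auto)

text \<open>
  The time derivatives given by the regularity assumption agree with those of the classical solution
  because derivatives are unique, and the same holds for the space derivatives on almost every time
  slice. Each bound is first proved on almost every slice and then extended by continuity in time.
\<close>

lemma regular_solution_smooth:
  assumes ab: "a < b" and T: "0 < T" and sol: "is_solution a b \<epsilon> \<phi> \<gamma> T u"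
    and reg: "regular_solution a b T M u"
  obtains v uxx where "smooth_solution a b T M \<epsilon> v uxx" "v 0 = u"
    "\<And>x. x \<in> {a..b} \<Longrightarrow> v 0 0 x = \<phi> x \<and> v 1 0 x = \<gamma> x"
proof -
  from reg obtain v where v0: "v 0 = u" and C5: "Ck_W_per a b T 0 5 v" and C3: "Ck_W_per a b T 2 3 v"
    and C1: "Ck_W_per a b T 4 1 v" and bnd: "\<And>r s. r \<le> 4 \<Longrightarrow> r + s \<le> 5 \<Longrightarrow>
        (\<exists>g. (AE t in lebesgue_on {0..T}. \<exists>d. weak_derivs a b s (v r t) d \<and> g t = d s) \<and>
             (\<lambda>(t, x). g t x) \<in> Linf ({0..T} \<times> {a<..<b}) \<and>
             Linf_norm ({0..T} \<times> {a<..<b}) (\<lambda>(t, x). g t x) \<le> ereal M)"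
    unfolding regular_solution_def by blast
  from sol obtain ut utt ux uxx where
    cont: "\<forall>w\<in>{u, ut, utt, ux, uxx}. continuous_on ({0..T} \<times> {a..b}) (\<lambda>(t, x). w t x)"
    and eqs: "\<forall>t\<in>{0..T}. \<forall>x\<in>{a..b}.
        ((\<lambda>t. u t x) has_real_derivative ut t x) (at t within {0..T}) \<and>
        ((\<lambda>t. ut t x) has_real_derivative utt t x) (at t within {0..T}) \<and>
        ((\<lambda>x. u t x) has_real_derivative ux t x) (at x within {a..b}) \<and>
        ((\<lambda>x. ux t x) has_real_derivative uxx t x) (at x within {a..b}) \<and>
        utt t x - uxx t x + u t x + u t x * f_reg \<epsilon> ((u t x)\<^sup>2) = 0"
    and init: "\<forall>x\<in>{a..b}. u 0 x = \<phi> x \<and> ut 0 x = \<gamma> x"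
    unfolding is_solution_def by blast
  have der: "((\<lambda>t. v r t x) has_real_derivative v (Suc r) t x) (at t within {0..T})"
    if "r \<le> 3" "t \<in> {0..T}" "x \<in> {a..b}" for r t x
    by (rule Ck_W_per_DERIV[OF ab C1]) (use that in auto)
  have vcont: "continuous_on {0..T} (\<lambda>t. v r t x)" if "r \<le> 4" "x \<in> {a..b}" for r x
    by (rule Ck_W_per_continuous[OF ab C1]) (use that in auto)
  have v1: "v 1 t x = ut t x" if "t \<in> {0..T}" "x \<in> {a..b}" for t x
    using DERIV_unique_Icc[OF T that(1) der[of 0 t x]] eqs that v0 by auto
  have v2: "v 2 t x = utt t x" if "t \<in> {0..T}" "x \<in> {a..b}" for t x
  proof (rule DERIV_unique_Icc[OF T that(1)])
    have "((\<lambda>t. v 1 t x) has_real_derivative v 2 t x) (at t within {0..T})"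
      using der[of 1 t x] that by (simp add: numeral_2_eq_2)
    thus "((\<lambda>t. ut t x) has_real_derivative v 2 t x) (at t within {0..T})"
      by (rule has_field_derivative_transform_within[OF _ zero_less_one that(1)])
         (use v1 that in auto)
  qed (use eqs that in auto)
  have uxx_cont: "continuous_on {0..T} (\<lambda>t. uxx t x)" if "x \<in> {a..b}" for x
  proof -
    have "continuous_on {0..T} ((\<lambda>(t, x). uxx t x) \<circ> (\<lambda>t. (t, x)))"
      by (rule continuous_on_compose)
         (use cont that in \<open>auto intro!: continuous_intros elim: continuous_on_subset\<close>)
    thus ?thesis by (simp add: o_def)
  qed
  have chain: "AE t in lebesgue_on {0..T}. \<exists>d. regular_chain a b M s (v r t) d"
    if C: "Ck_W_per a b T k m v" and "r \<le> k" "s < m" "r \<le> 4" "r + s \<le> 5" for k m r s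
    using bnd[OF that(4,5)] AE_regular_chain[OF ab C that(2,3)] by blast
  have bound: "\<bar>v r t x\<bar> \<le> M" if "r \<le> 4" "t \<in> {0..T}" "x \<in> {a..b}" for r t x
  proof (rule AE_bound_extends[OF T vcont[OF that(1,3)] _ that(2)])
    have "AE t in lebesgue_on {0..T}. \<exists>d. regular_chain a b M 0 (v r t) d"
      by (rule chain[OF C1]) (use that in auto)
    thus "AE t in lebesgue_on {0..T}. \<bar>v r t x\<bar> \<le> M"
      by eventually_elim (use that in \<open>auto simp: regular_chain_def\<close>)
  qed
  have lip: "\<bar>v 2 t x - v 2 t y\<bar> \<le> M * \<bar>x - y\<bar>" if "t \<in> {0..T}" "x \<in> {a..b}" "y \<in> {a..b}" for t x y
  proof (rule AE_bound_extends[OF T _ _ that(1)])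
    show "continuous_on {0..T} (\<lambda>t. v 2 t x - v 2 t y)"
      by (intro continuous_intros vcont that) auto
    have "AE t in lebesgue_on {0..T}. \<exists>d. regular_chain a b M 1 (v 2 t) d"
      by (rule chain[OF C3]) auto
    thus "AE t in lebesgue_on {0..T}. \<bar>v 2 t x - v 2 t y\<bar> \<le> M * \<bar>x - y\<bar>"
    proof eventually_elim
      case (elim t)
      then obtain d where d: "regular_chain a b M 1 (v 2 t) d" by blast
      have "\<bar>d 0 x - (\<Sum>i\<le>0. d i y * (x - y) ^ i / fact i)\<bar> \<le> M * \<bar>x - y\<bar> ^ Suc 0"
        by (rule taylor_bound[of 0 a b]) (use d that in \<open>auto simp: regular_chain_def\<close>)
      thus ?case using d by (simp add: regular_chain_def)
    qed
  qed
  have dx2u: "\<bar>dx2 N h (\<lambda>i. v 2 t (a + real i * h)) j\<bar> \<le> 2 * M"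
    if "t \<in> {0..T}" "0 < N" "h = (b - a) / real N" "j \<le> N" for t N h j
  proof (rule AE_bound_extends[OF T _ _ that(1)])
    show "continuous_on {0..T} (\<lambda>t. dx2 N h (\<lambda>i. v 2 t (a + real i * h)) j)"
      using grid_point_mem[OF ab that(2,3)]
      by (intro continuous_on_dx2 that(2,4) vcont) auto
    have "AE t in lebesgue_on {0..T}. \<exists>d. regular_chain a b M 2 (v 2 t) d"
      by (rule chain[OF C3]) auto
    thus "AE t in lebesgue_on {0..T}. \<bar>dx2 N h (\<lambda>i. v 2 t (a + real i * h)) j\<bar> \<le> 2 * M"
      by eventually_elim (use dx2_bound[OF ab that(2-4)] in blast)
  qed
  have cons: "\<bar>dx2 N h (\<lambda>i. v 0 t (a + real i * h)) j - uxx t (a + real j * h)\<bar> \<le> 2 * M * h\<^sup>2"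
    if "t \<in> {0..T}" "0 < N" "h = (b - a) / real N" "j \<le> N" for t N h j
  proof (rule AE_bound_extends[OF T _ _ that(1)])
    have xj: "a + real j * h \<in> {a..b}" using grid_point_mem[OF ab that(2-4)] .
    show "continuous_on {0..T} (\<lambda>t. dx2 N h (\<lambda>i. v 0 t (a + real i * h)) j - uxx t (a + real j * h))"
      using grid_point_mem[OF ab that(2,3)]
      by (intro continuous_on_diff continuous_on_dx2 that(2,4) vcont uxx_cont xj) auto
    have "AE t in lebesgue_on {0..T}. \<exists>d. regular_chain a b M 4 (v 0 t) d"
      by (rule chain[OF C5]) auto
    moreover have "AE t in lebesgue_on {0..T}. t \<in> {0..T}" using AE_space by auto
    ultimately show "AE t in lebesgue_on {0..T}.
      \<bar>dx2 N h (\<lambda>i. v 0 t (a + real i * h)) j - uxx t (a + real j * h)\<bar> \<le> 2 * M * h\<^sup>2"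
    proof eventually_elim
      case (elim t)
      then obtain d where d: "regular_chain a b M 4 (v 0 t) d" by blast
      have d0: "d 0 = u t" and dd: "\<And>l x. l < 4 \<Longrightarrow> x \<in> {a..b} \<Longrightarrow>
          (d l has_real_derivative d (Suc l) x) (at x within {a..b})"
        using d v0 by (auto simp: regular_chain_def)
      have d1: "d 1 x = ux t x" if "x \<in> {a..b}" for x
        using DERIV_unique_Icc[OF ab that dd[of 0 x]] eqs elim that d0 by auto
      have d2: "d 2 x = uxx t x" if "x \<in> {a..b}" for x
      proof (rule DERIV_unique_Icc[OF ab that])
        have "(d 1 has_real_derivative d 2 x) (at x within {a..b})"
          using dd[of 1 x] that by (simp add: numeral_2_eq_2)
        thus "((\<lambda>x. ux t x) has_real_derivative d 2 x) (at x within {a..b})"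
          by (rule has_field_derivative_transform_within[OF _ zero_less_one that]) (use d1 in auto)
      qed (use eqs elim that in auto)
      show ?case using dx2_consistency[OF ab that(2-4) d] d2[OF xj] by simp
    qed
  qed
  have "smooth_solution a b T M \<epsilon> v uxx"
  proof
    show "v 2 t x - uxx t x + v 0 t x + g_reg \<epsilon> (v 0 t x) = 0" if "t \<in> {0..T}" "x \<in> {a..b}" for t x
      using eqs that v2[OF that] v0 by (simp add: g_reg_def f_reg_def)
    show "v r t a = v r t b" if "r \<le> 4" "t \<in> {0..T}" for r t
      using C1 that unfolding Ck_W_per_def by (intro W_per_periodic[of _ a b 1]) auto
  qed (fact ab T der bound lip dx2u cons)+
  moreover have "v 0 0 x = \<phi> x \<and> v 1 0 x = \<gamma> x" if "x \<in> {a..b}" for x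
    using init v1[of 0 x] that T v0 by auto
  ultimately show ?thesis using that v0 by blast
qed

context smooth_solution
begin

lemma M_nonneg: "0 \<le> M"
  using v_bound[of 0 0 a] ab T by force

lemma time_second_difference:
  assumes "t - \<tau> \<in> {0..T}" "t + \<tau> \<in> {0..T}" "0 < \<tau>" "x \<in> {a..b}"
  shows "\<bar>v 0 (t + \<tau>) x - 2 * v 0 t x + v 0 (t - \<tau>) x\<bar> \<le> 2 * M * \<tau>\<^sup>2"
    and "\<bar>v 0 (t + \<tau>) x - 2 * v 0 t x + v 0 (t - \<tau>) x - \<tau>\<^sup>2 * v 2 t x\<bar> \<le> 2 * M * \<tau> ^ 4"
proof -
  have t: "t \<in> {0..T}" using assms by auto
  show "\<bar>v 0 (t + \<tau>) x - 2 * v 0 t x + v 0 (t - \<tau>) x\<bar> \<le> 2 * M * \<tau>\<^sup>2"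
    by (rule second_difference_bound[of 0 T "\<lambda>t. v 0 t x" "\<lambda>t. v 1 t x" "\<lambda>t. v 2 t x"])
       (use assms t v_deriv[of 0] v_deriv[of 1] v_bound in \<open>auto simp: numeral_2_eq_2\<close>)
  show "\<bar>v 0 (t + \<tau>) x - 2 * v 0 t x + v 0 (t - \<tau>) x - \<tau>\<^sup>2 * v 2 t x\<bar> \<le> 2 * M * \<tau> ^ 4"
    by (rule second_difference_expansion[of 0 T "\<lambda>r t. v r t x"])
       (use assms t v_deriv v_bound in auto)
qed

lemma time_increment:
  assumes "s \<in> {0..T}" "t \<in> {0..T}" "x \<in> {a..b}"
  shows "\<bar>v 0 s x - v 0 t x\<bar> \<le> M * \<bar>s - t\<bar>"
proof -
  have "\<bar>v 0 s x - (\<Sum>i\<le>0. v i t x * (s - t) ^ i / fact i)\<bar> \<le> M * \<bar>s - t\<bar> ^ Suc 0"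
    by (rule taylor_bound[of 0 0 T "\<lambda>r t. v r t x"]) (use assms v_deriv v_bound in auto)
  thus ?thesis by simp
qed

text \<open>
  The space difference is centred at the middle level by writing the mean over the outer levels as the
  middle value plus half a second time difference. Taking space and time differences in the other order
  bounds the mixed term by the difference quotient of \<open>v 2\<close>.
\<close>

lemma linear_part_consistency:
  assumes "t - \<tau> \<in> {0..T}" "t + \<tau> \<in> {0..T}" "0 < \<tau>" "0 < N" "h = (b - a) / real N" "j \<le> N"
  defines "u \<equiv> \<lambda>s i. v 0 s (a + real i * h)"
  shows "\<bar>(u (t + \<tau>) j - 2 * u t j + u (t - \<tau>) j) / \<tau>\<^sup>2
      - 1 / 2 * dx2 N h (\<lambda>i. u (t + \<tau>) i + u (t - \<tau>) i) j
      + 1 / 2 * (u (t + \<tau>) j + u (t - \<tau>) j) + g_reg \<epsilon> (u t j)\<bar> \<le> 5 * M * \<tau>\<^sup>2 + 2 * M * h\<^sup>2"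
proof -
  have t: "t \<in> {0..T}" using assms by auto
  note x = grid_point_mem[OF ab assms(4,5)]
  define D where "D s = dx2 N h (u s) j" for s
  define Q where "Q = u (t + \<tau>) j - 2 * u t j + u (t - \<tau>) j"
  have "\<bar>Q - \<tau>\<^sup>2 * v 2 t (a + real j * h)\<bar> \<le> 2 * M * \<tau> ^ 4"
    unfolding Q_def u_def by (rule time_second_difference(2)[OF assms(1-3) x[OF assms(6)]])
  also have "\<dots> = 2 * M * \<tau>\<^sup>2 * \<tau>\<^sup>2" by (simp add: power2_eq_square numeral_eq_Suc)
  finally have 1: "\<bar>Q / \<tau>\<^sup>2 - v 2 t (a + real j * h)\<bar> \<le> 2 * M * \<tau>\<^sup>2"
    using assms(3) by (simp add: field_simps abs_le_iff)
  have 2: "\<bar>Q\<bar> \<le> 2 * M * \<tau>\<^sup>2"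
    unfolding Q_def u_def by (rule time_second_difference(1)[OF assms(1-3) x[OF assms(6)]])
  have Dder: "((\<lambda>s. dx2 N h (\<lambda>i. v r s (a + real i * h)) j) has_real_derivative
      dx2 N h (\<lambda>i. v (Suc r) s (a + real i * h)) j) (at s within {0..T})"
    if "r \<le> 3" "s \<in> {0..T}" for r s
  proof -
    have v: "((\<lambda>s. v r s (a + real i * h)) has_real_derivative v (Suc r) s (a + real i * h))
        (at s within {0..T})" if "i \<le> N" for i
      by (rule v_deriv[OF \<open>r \<le> 3\<close> \<open>s \<in> {0..T}\<close> x[OF that]])
    have "((\<lambda>s. right_nb N (\<lambda>i. v r s (a + real i * h)) j) has_real_derivative
        right_nb N (\<lambda>i. v (Suc r) s (a + real i * h)) j) (at s within {0..T})"
      using v[of 1] v[of "j + 1"] assms(4,6) by (cases "j = N") (simp_all add: right_nb_def)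
    moreover have "((\<lambda>s. left_nb N (\<lambda>i. v r s (a + real i * h)) j) has_real_derivative
        left_nb N (\<lambda>i. v (Suc r) s (a + real i * h)) j) (at s within {0..T})"
      using v[of "N - 1"] v[of "j - 1"] assms(4,6) by (cases "j = 0") (simp_all add: left_nb_def)
    ultimately show ?thesis
      unfolding dx2_def using v[OF assms(6)]
      by (intro DERIV_cdivide DERIV_add DERIV_diff DERIV_cmult)
  qed
  have 3: "\<bar>D (t + \<tau>) - 2 * D t + D (t - \<tau>)\<bar> \<le> 2 * (2 * M) * \<tau>\<^sup>2"
    unfolding D_def u_def
    by (rule second_difference_bound[of 0 T _ "\<lambda>s. dx2 N h (\<lambda>i. v 1 s (a + real i * h)) j"
          "\<lambda>s. dx2 N h (\<lambda>i. v 2 s (a + real i * h)) j"])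
       (use assms t Dder[of 0] Dder[of 1] utt_dx2 in \<open>auto simp: numeral_2_eq_2\<close>)
  have 4: "\<bar>D t - uxx t (a + real j * h)\<bar> \<le> 2 * M * h\<^sup>2"
    unfolding D_def u_def by (rule u_dx2[OF t assms(4-6)])
  have 5: "v 2 t (a + real j * h) - uxx t (a + real j * h) + u t j + g_reg \<epsilon> (u t j) = 0"
    unfolding u_def by (rule pde[OF t x[OF assms(6)]])
  have add: "dx2 N h (\<lambda>i. u (t + \<tau>) i + u (t - \<tau>) i) j = D (t + \<tau>) + D (t - \<tau>)"
    unfolding D_def dx2_def right_nb_def left_nb_def by (simp add: add_divide_distrib[symmetric])
  have sum: "\<bar>A - 1 / 2 * B - C + 1 / 2 * Q\<bar> \<le> 5 * m + 2 * k"
    if "\<bar>A\<bar> \<le> 2 * m" "\<bar>B\<bar> \<le> 4 * m" "\<bar>C\<bar> \<le> 2 * k" "\<bar>Q\<bar> \<le> 2 * m" for A B C Q m k :: real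
    using that by linarith
  have "(u (t + \<tau>) j - 2 * u t j + u (t - \<tau>) j) / \<tau>\<^sup>2
      - 1 / 2 * dx2 N h (\<lambda>i. u (t + \<tau>) i + u (t - \<tau>) i) j
      + 1 / 2 * (u (t + \<tau>) j + u (t - \<tau>) j) + g_reg \<epsilon> (u t j)
    = (Q / \<tau>\<^sup>2 - v 2 t (a + real j * h)) - 1 / 2 * (D (t + \<tau>) - 2 * D t + D (t - \<tau>))
      - (D t - uxx t (a + real j * h)) + 1 / 2 * Q"
    using 5 unfolding add Q_def by (simp add: field_simps)
  thus ?thesis
    using sum[of "Q / \<tau>\<^sup>2 - v 2 t (a + real j * h)" "M * \<tau>\<^sup>2" "D (t + \<tau>) - 2 * D t + D (t - \<tau>)"
        "D t - uxx t (a + real j * h)" "M * h\<^sup>2" Q] 1 2 3 4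
    by (simp add: mult.assoc)
qed

lemma nonlinear_part_consistency:
  assumes "t - \<tau> \<in> {0..T}" "t + \<tau> \<in> {0..T}" "0 < \<tau>" "x \<in> {a..b}" "0 < \<epsilon>" "\<epsilon> < 1"
  shows "\<bar>G_reg \<epsilon> (v 0 (t + \<tau>) x) (v 0 (t - \<tau>) x) - g_reg \<epsilon> (v 0 t x)\<bar>
      \<le> (2 * M * lip_const M \<epsilon> + 3 / \<epsilon> * M\<^sup>2) * \<tau>\<^sup>2"
    and "0 < \<delta> \<Longrightarrow> \<delta> < 1 \<Longrightarrow>
      \<bar>G_reg \<epsilon> (v 0 (t + \<tau>) x) (v 0 (t - \<tau>) x) - g_reg \<epsilon> (v 0 t x)\<bar>
      \<le> lip_const M \<delta> * M * \<tau> + 4 * \<delta>"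
proof -
  have t: "t \<in> {0..T}" using assms by auto
  define z where "z = v 0 t x"
  define y1 where "y1 = v 0 (t + \<tau>) x - z"
  define y2 where "y2 = v 0 (t - \<tau>) x - z"
  have zy: "v 0 (t + \<tau>) x = z + y1" "v 0 (t - \<tau>) x = z + y2" by (auto simp: y1_def y2_def)
  have z: "\<bar>z\<bar> \<le> M" "\<bar>z + y1\<bar> \<le> M" "\<bar>z + y2\<bar> \<le> M"
    unfolding y1_def y2_def z_def using v_bound assms t by auto
  have y: "\<bar>y1\<bar> \<le> M * \<tau>" "\<bar>y2\<bar> \<le> M * \<tau>"
    unfolding y1_def y2_def z_def
    using time_increment[OF assms(2) t assms(4)] time_increment[OF assms(1) t assms(4)] assms(3)
    by auto
  have yy: "\<bar>y1 + y2\<bar> \<le> 2 * M * \<tau>\<^sup>2"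
    using time_second_difference(1)[OF assms(1-4)] by (simp add: y1_def y2_def z_def algebra_simps)
  have "0 \<le> lip_const M \<epsilon>" using lip_const_ge_2[OF assms(5,6), of M] by linarith
  hence "lip_const M \<epsilon> * \<bar>y1 + y2\<bar> \<le> lip_const M \<epsilon> * (2 * M * \<tau>\<^sup>2)" using yy by (intro mult_left_mono)
  thus "\<bar>G_reg \<epsilon> (v 0 (t + \<tau>) x) (v 0 (t - \<tau>) x) - g_reg \<epsilon> (v 0 t x)\<bar>
      \<le> (2 * M * lip_const M \<epsilon> + 3 / \<epsilon> * M\<^sup>2) * \<tau>\<^sup>2"
    using G_reg_consistency[OF assms(5,6) z(1) y]
    unfolding zy z_def[symmetric] by (simp add: power_mult_distrib algebra_simps)
  show "\<bar>G_reg \<epsilon> (v 0 (t + \<tau>) x) (v 0 (t - \<tau>) x) - g_reg \<epsilon> (v 0 t x)\<bar>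
      \<le> lip_const M \<delta> * M * \<tau> + 4 * \<delta>" if "0 < \<delta>" "\<delta> < 1"
    using G_reg_consistency_uniform[OF assms(5,6) that z y]
    unfolding zy z_def[symmetric] by (simp add: mult.assoc)
qed

text \<open>
  The second bound says that the space difference quotient of the Taylor remainder is \<open>O(\<tau>\<^sup>2)\<close>. Two
  time derivatives suffice for it, because the bound on the initial error has to be of second order
  only.
\<close>

lemma initial_remainder:
  assumes "\<tau> \<in> {0..T}" "x \<in> {a..b}" "y \<in> {a..b}"
  defines "R \<equiv> \<lambda>x. v 0 \<tau> x - v 0 0 x - \<tau> * v 1 0 x - \<tau>\<^sup>2 / 2 * v 2 0 x"
  shows "\<bar>R x\<bar> \<le> M * \<tau> ^ 3" and "\<bar>R x - R y\<bar> \<le> 2 * M * \<bar>x - y\<bar> * \<tau>\<^sup>2"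
proof -
  have T0: "0 \<in> {0..T}" using T by simp
  have "\<bar>v 0 \<tau> x - (\<Sum>i\<le>2. v i 0 x * (\<tau> - 0) ^ i / fact i)\<bar> \<le> M * \<bar>\<tau> - 0\<bar> ^ Suc 2"
    by (rule taylor_bound[of 2 0 T "\<lambda>r t. v r t x"]) (use assms v_deriv v_bound T0 in auto)
  thus "\<bar>R x\<bar> \<le> M * \<tau> ^ 3"
    using assms(1) by (simp add: R_def numeral_2_eq_2 numeral_3_eq_3 algebra_simps)
  define d where "d r t = v r t x - v r t y" for r t
  have d2: "\<bar>d 2 t\<bar> \<le> M * \<bar>x - y\<bar>" if "t \<in> {0..T}" for t
    unfolding d_def by (rule utt_lipschitz[OF that assms(2,3)])
  have "\<bar>d 0 \<tau> - (\<Sum>i\<le>1. d i 0 * (\<tau> - 0) ^ i / fact i)\<bar> \<le> M * \<bar>x - y\<bar> * \<bar>\<tau> - 0\<bar> ^ Suc 1"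
    by (rule taylor_bound[of 1 0 T d])
       (use assms v_deriv d2 T0 in \<open>auto simp: d_def[abs_def] numeral_2_eq_2 intro!: DERIV_diff\<close>)
  hence 1: "\<bar>d 0 \<tau> - d 0 0 - \<tau> * d 1 0\<bar> \<le> M * \<bar>x - y\<bar> * \<tau>\<^sup>2"
    by (simp add: algebra_simps power2_eq_square)
  have 2: "\<bar>\<tau>\<^sup>2 / 2 * d 2 0\<bar> \<le> M * \<bar>x - y\<bar> * \<tau>\<^sup>2"
  proof -
    have "\<bar>\<tau>\<^sup>2 / 2 * d 2 0\<bar> = \<tau>\<^sup>2 / 2 * \<bar>d 2 0\<bar>" by (simp add: abs_mult)
    also have "\<dots> \<le> \<tau>\<^sup>2 * (M * \<bar>x - y\<bar>)" using d2[OF T0] by (intro mult_mono) auto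
    finally show ?thesis by (simp add: mult_ac)
  qed
  have "R x - R y = (d 0 \<tau> - d 0 0 - \<tau> * d 1 0) - \<tau>\<^sup>2 / 2 * d 2 0"
    by (simp add: R_def d_def algebra_simps)
  thus "\<bar>R x - R y\<bar> \<le> 2 * M * \<bar>x - y\<bar> * \<tau>\<^sup>2" using 1 2 by linarith
qed

end

section \<open>Discrete Osgood and Gronwall inequalities\<close>

lemma exp_neg_two_le: "0 \<le> x \<Longrightarrow> x \<le> 1/2 \<Longrightarrow> exp (- 2 * x) \<le> 1 - (x::real)"
proof -
  assume x: "0 \<le> x" "x \<le> 1/2"
  have "1 \<le> (1 - x) * (1 + 2 * x)" using x mult_nonneg_nonneg[of x "1 - 2 * x"] by (simp add: algebra_simps)
  also have "\<dots> \<le> (1 - x) * exp (2 * x)"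
    using x exp_ge_add_one_self[of "2 * x"] by (intro mult_left_mono) auto
  finally show ?thesis by (simp add: exp_minus field_simps)
qed

text \<open>
  The inequality is implicit in \<open>s'\<close>; dividing by \<open>1 - x \<ge> 1/2\<close> solves it.
\<close>

lemma implicit_step_bound:
  fixes s s' x \<beta> :: real
  assumes "0 \<le> s" "0 \<le> \<beta>" "0 \<le> x" "x \<le> 1/2" "s' \<le> s + \<beta> + x * (s' + s)"
  shows "s' \<le> (1 + 4 * x) * s + 2 * \<beta>"
proof -
  have "(1 - x) * s' \<le> (1 + x) * s + \<beta>" using assms(5) by (simp add: algebra_simps)
  also have "\<dots> \<le> (1 - x) * ((1 + 4 * x) * s + 2 * \<beta>)"
  proof -
    have "0 \<le> x * (2 - 4 * x) * s" "0 \<le> (1 - 2 * x) * \<beta>" using assms by auto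
    moreover have "(1 - x) * ((1 + 4 * x) * s + 2 * \<beta>) - ((1 + x) * s + \<beta>)
        = x * (2 - 4 * x) * s + (1 - 2 * x) * \<beta>" by (simp add: algebra_simps)
    ultimately show ?thesis by linarith
  qed
  finally show ?thesis using assms(4) by (simp add: mult_le_cancel_left)
qed

text \<open>
  The free parameter of the logarithmic Lipschitz estimate is chosen as the current error bound \<open>\<delta>\<close>,
  so the additive terms are absorbed and the error grows at most by the factor
  \<open>1 + O(\<tau>) (1 + ln (1 / \<delta>))\<close>.
\<close>

lemma osgood_step:
  fixes s s' \<delta> \<tau> c A X :: real
  defines "l \<equiv> ln (1 / \<delta>)"
  assumes "0 < \<delta>" "\<delta> < 1" "0 \<le> s" "s \<le> \<delta>" "0 \<le> X" "X \<le> \<delta>" "0 \<le> c" "0 \<le> A" "0 < \<tau>"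
    "\<tau> * (2 * (2 * l + A)) \<le> 1/2"
    "s' \<le> s + \<tau> * (c * (X + 4 * \<delta>) + 2 * (2 * l + A) * (s' + s))"
  shows "s' \<le> \<delta> * (1 + \<tau> * (10 * c + 8 * A + 16) * (1 + l))"
proof -
  have l: "0 \<le> l" using assms by (simp add: l_def)
  define x where "x = \<tau> * (2 * (2 * l + A))"
  have x: "0 \<le> x" "x \<le> 1/2" using assms l by (auto simp: x_def)
  have "s' \<le> s + \<tau> * (c * (X + 4 * \<delta>)) + x * (s' + s)"
    using assms(12) by (simp add: x_def algebra_simps)
  hence "s' \<le> (1 + 4 * x) * s + 2 * (\<tau> * (c * (X + 4 * \<delta>)))"
    using assms x by (intro implicit_step_bound) auto
  also have "\<dots> \<le> (1 + 4 * x) * \<delta> + 2 * (\<tau> * (c * (5 * \<delta>)))"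
    using assms x by (intro add_mono mult_left_mono) auto
  also have "\<dots> = \<delta> * (1 + \<tau> * (10 * c + 8 * A + 16 * l))" by (simp add: x_def algebra_simps)
  also have "\<dots> \<le> \<delta> * (1 + \<tau> * ((10 * c + 8 * A + 16) * (1 + l)))"
  proof -
    have "0 \<le> (10 * c + 8 * A) * l" using assms l by auto
    hence "10 * c + 8 * A + 16 * l \<le> (10 * c + 8 * A + 16) * (1 + l)" by (simp add: algebra_simps)
    thus ?thesis using assms by (intro mult_left_mono add_left_mono) auto
  qed
  finally show ?thesis by (simp add: mult.assoc)
qed

text \<open>
  The comparison sequence. With \<open>y(t) = exp (1 - \<Gamma> exp (- K t))\<close> one has \<open>y' = K y (1 + ln (1 / y))\<close>, the
  Osgood equation for the logarithmic modulus of continuity; here \<open>exp (- K t)\<close> is replaced by \<open>(1 - k)\<^sup>n\<close>. For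
  \<open>\<Gamma>\<close> large the sequence remains as small as desired over a bounded time.
\<close>

definition osgood :: "real \<Rightarrow> real \<Rightarrow> nat \<Rightarrow> real"
  where "osgood \<Gamma> k n = exp (1 - \<Gamma> * (1 - k) ^ n)"

lemma osgood_Suc_ge:
  assumes "0 \<le> k" "k \<le> 1/2" "0 \<le> \<Gamma>"
  shows "osgood \<Gamma> k n * (1 + k * (1 + ln (1 / osgood \<Gamma> k n))) \<le> osgood \<Gamma> k (Suc n)"
proof -
  define z where "z = \<Gamma> * (1 - k) ^ n"
  have "1 + ln (1 / osgood \<Gamma> k n) = z" by (simp add: osgood_def z_def ln_div)
  hence "osgood \<Gamma> k n * (1 + k * (1 + ln (1 / osgood \<Gamma> k n))) = exp (1 - z) * (1 + k * z)"
    by (simp add: osgood_def z_def)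
  also have "\<dots> \<le> exp (1 - z) * exp (k * z)"
    by (intro mult_left_mono exp_ge_add_one_self) auto
  also have "\<dots> = osgood \<Gamma> k (Suc n)"
    by (simp add: osgood_def z_def exp_add[symmetric] algebra_simps)
  finally show ?thesis .
qed

lemma osgood_bounds:
  assumes "0 \<le> k" "k \<le> 1/2" "0 \<le> \<Gamma>" "real n * k \<le> \<kappa>"
  shows "osgood \<Gamma> k n \<le> exp (1 - \<Gamma> * exp (- 2 * \<kappa>))" and "exp (1 - \<Gamma>) \<le> osgood \<Gamma> k n"
proof -
  have "exp (- 2 * \<kappa>) \<le> exp (real n * (- 2 * k))" using assms by simp
  also have "\<dots> = exp (- 2 * k) ^ n" by (rule exp_of_nat_mult)
  also have "\<dots> \<le> (1 - k) ^ n" using assms by (intro power_mono exp_neg_two_le) auto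
  finally have "\<Gamma> * exp (- 2 * \<kappa>) \<le> \<Gamma> * (1 - k) ^ n" using assms by (intro mult_left_mono)
  thus "osgood \<Gamma> k n \<le> exp (1 - \<Gamma> * exp (- 2 * \<kappa>))" by (simp add: osgood_def)
  have "\<Gamma> * (1 - k) ^ n \<le> \<Gamma> * 1" using assms by (intro mult_left_mono power_le_one) auto
  thus "exp (1 - \<Gamma>) \<le> osgood \<Gamma> k n" by (simp add: osgood_def)
qed

lemma discrete_gronwall:
  fixes s :: "nat \<Rightarrow> real"
  assumes "\<And>n. n \<le> m \<Longrightarrow> 0 \<le> s n" "0 \<le> \<beta>" "0 \<le> x" "x \<le> 1/2"
    "\<And>n. n < m \<Longrightarrow> s (Suc n) \<le> s n + \<beta> + x * (s (Suc n) + s n)"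
  shows "s m \<le> exp (4 * x * real m) * (s 0 + 2 * \<beta> * real m)"
  using assms
proof (induction m)
  case (Suc m)
  have s0: "0 \<le> s 0" using Suc.prems(1) by simp
  have IH: "s m \<le> exp (4 * x * real m) * (s 0 + 2 * \<beta> * real m)"
    by (rule Suc.IH) (use Suc.prems in auto)
  have 1: "s (Suc m) \<le> (1 + 4 * x) * s m + 2 * \<beta>"
    by (rule implicit_step_bound) (use Suc.prems in auto)
  have "(1 + 4 * x) * s m \<le> exp (4 * x) * (exp (4 * x * real m) * (s 0 + 2 * \<beta> * real m))"
    using IH Suc.prems by (intro mult_mono exp_ge_add_one_self) auto
  also have "\<dots> = exp (4 * x * real (Suc m)) * (s 0 + 2 * \<beta> * real m)"
    by (simp add: exp_add[symmetric] algebra_simps)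
  finally have 2: "(1 + 4 * x) * s m \<le> exp (4 * x * real (Suc m)) * (s 0 + 2 * \<beta> * real m)" .
  have 3: "2 * \<beta> \<le> exp (4 * x * real (Suc m)) * (2 * \<beta>)"
  proof -
    have "0 \<le> 4 * x * real (Suc m)" using Suc.prems(3) by simp
    hence "1 \<le> exp (4 * x * real (Suc m))" by simp
    hence "1 * (2 * \<beta>) \<le> exp (4 * x * real (Suc m)) * (2 * \<beta>)"
      using Suc.prems(2) by (intro mult_right_mono) auto
    thus ?thesis by simp
  qed
  have "s (Suc m) \<le> exp (4 * x * real (Suc m)) * (s 0 + 2 * \<beta> * real m)
      + exp (4 * x * real (Suc m)) * (2 * \<beta>)"
    using 1 2 3 by linarith
  also have "\<dots> = exp (4 * x * real (Suc m)) * (s 0 + 2 * \<beta> * real (Suc m))"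
    by (simp only: distrib_left[symmetric]) (simp add: algebra_simps)
  finally show ?case .
qed simp

text \<open>
  The part of \<open>lip_const (M + 1) \<delta>\<close> that does not depend on \<open>\<delta>\<close>.
\<close>

definition log_const :: "real \<Rightarrow> real"
  where "log_const M = ln (1 + (M + 1)\<^sup>2) + 2"

lemma lip_const_eq: "lip_const (M + 1) \<delta> = 2 * ln (1 / \<delta>) + log_const M"
  by (simp add: lip_const_def log_const_def)

lemma log_const_ge_2: "2 \<le> log_const M"
  by (simp add: log_const_def)

lemma lip_const_le_inverse:
  assumes "0 < \<epsilon>" "\<epsilon> < 1"
  shows "lip_const (M + 1) \<epsilon> \<le> (2 + log_const M) / \<epsilon>"
proof -
  have "ln (1 / \<epsilon>) \<le> 1 / \<epsilon>" using ln_le_minus_one[of "1 / \<epsilon>"] assms by simp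
  moreover have "log_const M * 1 \<le> log_const M * (1 / \<epsilon>)"
    using assms log_const_ge_2[of M] by (intro mult_left_mono) auto
  ultimately show ?thesis unfolding lip_const_eq by (simp add: add_divide_distrib)
qed

lemma lip_const_mono: "0 \<le> M \<Longrightarrow> lip_const M \<delta> \<le> lip_const (M + 1) \<delta>"
  by (simp add: lip_const_def add_pos_nonneg power_mono)

text \<open>
  The Gronwall factor is \<open>exp (16 T ln (1 / \<epsilon>))\<close> up to a constant, and this is where it is compared with
  \<open>exp (T / (2 \<epsilon>))\<close>. The number 32 is chosen such that \<open>16 ln (z / 32) \<le> z / 2\<close>.
\<close>

lemma ln_inverse_le:
  fixes \<epsilon> :: real
  assumes "0 < \<epsilon>" shows "16 * ln (1 / \<epsilon>) \<le> 1 / (2 * \<epsilon>) + 16 * ln 32"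
proof -
  have "ln ((1 / \<epsilon>) / 32) \<le> (1 / \<epsilon>) / 32 - 1" using assms by (intro ln_le_minus_one) auto
  moreover have "ln ((1 / \<epsilon>) / 32) = ln (1 / \<epsilon>) - ln 32" using assms by (simp only: ln_divide_pos divide_pos_pos zero_less_one zero_less_numeral)
  ultimately have "ln (1 / \<epsilon>) - ln 32 \<le> (1 / \<epsilon>) / 32" by simp
  thus ?thesis by simp
qed

section \<open>The error of the scheme\<close>

text \<open>
  A regular solution together with a numerical solution of the scheme. The restrictions \<open>h \<le> 1\<close> and
  \<open>\<tau> \<le> 1\<close> are normalizations of the step sizes.
\<close>

locale cnfd_error = smooth_solution +
  fixes N :: nat and h \<tau> :: real and \<phi> \<gamma> :: "real \<Rightarrow> real" and U :: "nat \<Rightarrow> nat \<Rightarrow> real"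
  assumes eps: "0 < \<epsilon>" "\<epsilon> < 1" and N: "0 < N" and h: "h = (b - a) / real N" and h1: "h \<le> 1"
    and tau: "0 < \<tau>" "\<tau> \<le> 1"
    and scheme: "cnfd_solution a \<epsilon> \<phi> \<gamma> N h \<tau> U"
    and initial: "\<And>x. x \<in> {a..b} \<Longrightarrow> v 0 0 x = \<phi> x \<and> v 1 0 x = \<gamma> x"
begin

definition x :: "nat \<Rightarrow> real" where "x j = a + real j * h"

definition e :: "nat \<Rightarrow> nat \<Rightarrow> real" where "e n j = v 0 (real n * \<tau>) (x j) - U n j"

text \<open>
  The discrete \<open>l\<^sup>2\<close> norm of the constant 1.
\<close>

definition c :: real where "c = sqrt (b - a)"

definition s :: "nat \<Rightarrow> real" where "s n = sqrt (energy N h \<tau> (e n) (e (Suc n)))"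

lemma h_pos: "0 < h" using ab N h by simp

lemma hN: "h * real N = b - a" using N h by simp

lemma c_pos: "0 < c" using ab by (simp add: c_def)

lemma s_nonneg: "0 \<le> s n" by (simp add: s_def energy_nonneg)

lemma x_mem: "j \<le> N \<Longrightarrow> x j \<in> {a..b}"
  unfolding x_def by (rule grid_point_mem[OF ab N h])

lemma x_ends: "x 0 = a" "x N = b" using hN by (auto simp: x_def mult.commute)

lemma time_mem: "real n * \<tau> \<le> T \<Longrightarrow> real n * \<tau> \<in> {0..T}"
  using tau by simp

lemma e_periodic: "real n * \<tau> \<le> T \<Longrightarrow> e n \<in> X_grid N"
  using scheme v_periodic[of 0, OF _ time_mem] unfolding cnfd_solution_def
  by (simp add: X_grid_def e_def x_ends Let_def)

lemma error_sup_bound: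
  assumes "real (Suc n) * \<tau> \<le> T" "j \<le> N"
  shows "\<bar>e n j\<bar> \<le> 3/2 * (1 / c + c) * s n"
proof -
  have "real n * \<tau> \<le> T" using assms(1) tau by (simp add: algebra_simps)
  note X = e_periodic[OF this]
  have h0: "0 \<le> h" using h_pos by simp
  note E = energy_controls[OF h0, where N = N and w = "e (Suc n)" and \<tau> = \<tau> and v = "e n", folded s_def]
  have "\<bar>e n j\<bar> \<le> l2_norm N h (e n) / c + c * l2_norm N h (dx_plus N h (e n))"
    using discrete_sobolev[OF N h_pos X assms(2)] by (simp add: hN c_def)
  also have "\<dots> \<le> 3/2 * s n / c + c * (3/2 * s n)"
    using E(2,4) c_pos by (intro add_mono divide_right_mono mult_left_mono) auto
  finally show ?thesis by (simp add: algebra_simps)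
qed

text \<open>
  The defect of the exact solution in the scheme that computes level \<open>n + 2\<close> from the levels \<open>n + 1\<close> and
  \<open>n\<close>.
\<close>

definition residual :: "nat \<Rightarrow> nat \<Rightarrow> real"
  where "residual n j = (let u = (\<lambda>n j. v 0 (real n * \<tau>) (x j)) in
    (u (Suc (Suc n)) j - 2 * u (Suc n) j + u n j) / \<tau>\<^sup>2
    - 1 / 2 * dx2 N h (\<lambda>i. u (Suc (Suc n)) i + u n i) j
    + 1 / 2 * (u (Suc (Suc n)) j + u n j) + G_reg \<epsilon> (u (Suc (Suc n)) j) (u n j))"

lemma residual_bound:
  assumes "real (Suc (Suc n)) * \<tau> \<le> T" "j \<le> N"
  shows "\<bar>residual n j\<bar> \<le> 5 * M * \<tau>\<^sup>2 + 2 * M * h\<^sup>2 + (2 * M * lip_const M \<epsilon> + 3 / \<epsilon> * M\<^sup>2) * \<tau>\<^sup>2"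
    and "0 < \<delta> \<Longrightarrow> \<delta> < 1 \<Longrightarrow>
      \<bar>residual n j\<bar> \<le> 5 * M * \<tau>\<^sup>2 + 2 * M * h\<^sup>2 + (lip_const M \<delta> * M * \<tau> + 4 * \<delta>)"
proof -
  define t where "t = real (Suc n) * \<tau>"
  have t: "real n * \<tau> = t - \<tau>" "real (Suc (Suc n)) * \<tau> = t + \<tau>" "real (Suc n) * \<tau> = t"
    by (auto simp: t_def algebra_simps)
  have mem: "t - \<tau> \<in> {0..T}" "t + \<tau> \<in> {0..T}"
    using assms(1) tau t by (auto simp: t_def algebra_simps)
  define u where "u n j = v 0 (real n * \<tau>) (x j)" for n j
  define lin where "lin = (u (Suc (Suc n)) j - 2 * u (Suc n) j + u n j) / \<tau>\<^sup>2
    - 1 / 2 * dx2 N h (\<lambda>i. u (Suc (Suc n)) i + u n i) j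
    + 1 / 2 * (u (Suc (Suc n)) j + u n j) + g_reg \<epsilon> (u (Suc n) j)"
  have lin: "\<bar>lin\<bar> \<le> 5 * M * \<tau>\<^sup>2 + 2 * M * h\<^sup>2"
    unfolding lin_def u_def x_def t by (rule linear_part_consistency[OF mem tau(1) N h assms(2)])
  have res: "residual n j = lin + (G_reg \<epsilon> (u (Suc (Suc n)) j) (u n j) - g_reg \<epsilon> (u (Suc n) j))"
    by (simp add: residual_def Let_def lin_def u_def)
  note nl = nonlinear_part_consistency[OF mem tau(1) x_mem[OF assms(2)] eps, folded t, folded u_def]
  show "\<bar>residual n j\<bar> \<le> 5 * M * \<tau>\<^sup>2 + 2 * M * h\<^sup>2 + (2 * M * lip_const M \<epsilon> + 3 / \<epsilon> * M\<^sup>2) * \<tau>\<^sup>2"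
    unfolding res by (rule order_trans[OF abs_triangle_ineq add_mono[OF lin nl(1)]])
  show "\<bar>residual n j\<bar> \<le> 5 * M * \<tau>\<^sup>2 + 2 * M * h\<^sup>2 + (lip_const M \<delta> * M * \<tau> + 4 * \<delta>)"
    if "0 < \<delta>" "\<delta> < 1"
    unfolding res by (rule order_trans[OF abs_triangle_ineq add_mono[OF lin nl(2)[OF that]]])
qed

text \<open>
  One step of the error recursion, for any modulus of continuity \<open>r \<mapsto> L r + \<kappa>\<close> of the nonlinearity. It
  is used twice: with the logarithmic modulus, uniformly in \<open>\<epsilon>\<close>, and with the Lipschitz constant of
  \<open>g_reg \<epsilon>\<close> and \<open>\<kappa> = 0\<close> for the rate. The new error \<open>e (n + 2)\<close> is not assumed to be small.
\<close>

lemma error_step: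
  assumes n: "real (Suc (Suc n)) * \<tau> \<le> T" and X: "0 \<le> X" "\<And>j. j < N \<Longrightarrow> \<bar>residual n j\<bar> \<le> X"
    and e1: "\<And>j. j < N \<Longrightarrow> \<bar>e n j\<bar> \<le> 1" and L: "0 \<le> L" "0 \<le> \<kappa>"
    and lip: "\<And>z w. \<bar>z\<bar> \<le> M + 1 \<Longrightarrow> \<bar>w\<bar> \<le> M + 1 \<Longrightarrow>
      \<bar>g_reg \<epsilon> z - g_reg \<epsilon> w\<bar> \<le> L * \<bar>z - w\<bar> + \<kappa>"
  shows "s (Suc n) \<le> s n + \<tau> * (c * (X + \<kappa>) + 2 * L * (s (Suc n) + s n))"
proof -
  have n': "real n * \<tau> \<le> T" "real (Suc n) * \<tau> \<le> T" using n tau by (auto simp: algebra_simps)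
  have h0: "0 \<le> h" using h_pos by simp
  define u where "u n j = v 0 (real n * \<tau>) (x j)" for n j
  define D where "D j = G_reg \<epsilon> (U (Suc (Suc n)) j) (U n j) - G_reg \<epsilon> (u (Suc (Suc n)) j) (u n j)" for j
  define p where "p j = (X + \<kappa>) + L * (\<bar>e (Suc (Suc n)) j\<bar> + \<bar>e n j\<bar>)" for j
  have eu: "e n j = u n j - U n j" for n j by (simp add: e_def u_def)
  have "s (Suc n) \<le> s n + \<tau> * l2_norm N h p"
    unfolding s_def
  proof (rule energy_step[OF N h_pos tau(1) e_periodic[OF n'(1)] e_periodic[OF n'(2)] e_periodic[OF n]])
    fix j assume j: "j < N"
    have sch: "(U (Suc (Suc n)) j - 2 * U (Suc n) j + U n j) / \<tau>\<^sup>2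
         - 1 / 2 * dx2 N h (\<lambda>i. U (Suc (Suc n)) i + U n i) j
         + 1 / 2 * (U (Suc (Suc n)) j + U n j) + G_reg \<epsilon> (U (Suc (Suc n)) j) (U n j) = 0"
    proof -
      have "\<forall>n\<ge>1. \<forall>j\<le>N. (U (n + 1) j - 2 * U n j + U (n - 1) j) / \<tau>\<^sup>2
         - 1 / 2 * dx2 N h (\<lambda>i. U (n + 1) i + U (n - 1) i) j
         + 1 / 2 * (U (n + 1) j + U (n - 1) j) + G_reg \<epsilon> (U (n + 1) j) (U (n - 1) j) = 0"
        using scheme unfolding cnfd_solution_def Let_def by blast
      from this[rule_format, of "Suc n" j] j show ?thesis by simp
    qed
    have dx2_diff: "dx2 N h (\<lambda>i. e (Suc (Suc n)) i + e n i) j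
        = dx2 N h (\<lambda>i. u (Suc (Suc n)) i + u n i) j - dx2 N h (\<lambda>i. U (Suc (Suc n)) i + U n i) j"
      unfolding dx2_def right_nb_def left_nb_def
      by (simp add: eu diff_divide_distrib[symmetric])
    have res: "residual n j = (u (Suc (Suc n)) j - 2 * u (Suc n) j + u n j) / \<tau>\<^sup>2
      - 1 / 2 * dx2 N h (\<lambda>i. u (Suc (Suc n)) i + u n i) j
      + 1 / 2 * (u (Suc (Suc n)) j + u n j) + G_reg \<epsilon> (u (Suc (Suc n)) j) (u n j)"
      by (simp add: residual_def Let_def u_def)
    have quot: "(e (Suc (Suc n)) j - 2 * e (Suc n) j + e n j) / \<tau>\<^sup>2
      = (u (Suc (Suc n)) j - 2 * u (Suc n) j + u n j) / \<tau>\<^sup>2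
        - (U (Suc (Suc n)) j - 2 * U (Suc n) j + U n j) / \<tau>\<^sup>2"
      by (simp add: eu diff_divide_distrib[symmetric])
    show "(e (Suc (Suc n)) j - 2 * e (Suc n) j + e n j) / \<tau>\<^sup>2
        - 1 / 2 * dx2 N h (\<lambda>i. e (Suc (Suc n)) i + e n i) j
        + 1 / 2 * (e (Suc (Suc n)) j + e n j) = residual n j + D j"
      using sch unfolding dx2_diff res quot D_def by (simp add: eu algebra_simps)
    have u: "\<bar>u n' j\<bar> \<le> M" if "real n' * \<tau> \<le> T" for n'
      unfolding u_def using v_bound[of 0, OF _ time_mem[OF that] x_mem] j by auto
    \<comment> \<open>Stability is applied at the exact solution, of which the numerical one is the perturbation by \<open>- e\<close>.\<close>
    have "- ((G_reg \<epsilon> (u (Suc (Suc n)) j + - e (Suc (Suc n)) j) (u n j + - e n j)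
          - G_reg \<epsilon> (u (Suc (Suc n)) j) (u n j)) * (- e (Suc (Suc n)) j - - e n j))
        \<le> (L * (\<bar>- e (Suc (Suc n)) j\<bar> + \<bar>- e n j\<bar>) + \<kappa>) * \<bar>- e (Suc (Suc n)) j - - e n j\<bar>"
      by (rule G_reg_stability[OF eps(1) L(1) M_nonneg u[OF n] u[OF n'(1)] _ lip])
         (use e1[OF j] in auto)
    hence "D j * (e (Suc (Suc n)) j - e n j)
        \<le> (L * (\<bar>e (Suc (Suc n)) j\<bar> + \<bar>e n j\<bar>) + \<kappa>) * \<bar>e (Suc (Suc n)) j - e n j\<bar>"
      by (simp add: D_def eu abs_minus_commute algebra_simps)
    moreover have "residual n j * (e (Suc (Suc n)) j - e n j) \<le> X * \<bar>e (Suc (Suc n)) j - e n j\<bar>"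
    proof -
      have "residual n j * (e (Suc (Suc n)) j - e n j)
          \<le> \<bar>residual n j\<bar> * \<bar>e (Suc (Suc n)) j - e n j\<bar>"
        by (metis abs_ge_self abs_mult)
      also have "\<dots> \<le> X * \<bar>e (Suc (Suc n)) j - e n j\<bar>"
        by (intro mult_right_mono X j) auto
      finally show ?thesis .
    qed
    ultimately show "(residual n j + D j) * (e (Suc (Suc n)) j - e n j)
        \<le> p j * \<bar>e (Suc (Suc n)) j - e n j\<bar>"
      by (simp add: p_def algebra_simps)
  qed
  also have "l2_norm N h p \<le> c * (X + \<kappa>) + 2 * L * (s (Suc n) + s n)"
  proof -
    have "l2_norm N h p \<le> l2_norm N h (\<lambda>_. X + \<kappa>)
        + l2_norm N h (\<lambda>j. L * (\<bar>e (Suc (Suc n)) j\<bar> + \<bar>e n j\<bar>))"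
      unfolding p_def by (rule l2_norm_triangle[OF h0])
    also have "l2_norm N h (\<lambda>_. X + \<kappa>) \<le> c * (X + \<kappa>)"
      using l2_norm_le_sup[OF h0, of "X + \<kappa>" N "\<lambda>_. X + \<kappa>"] X L by (simp add: hN c_def)
    also have "l2_norm N h (\<lambda>j. L * (\<bar>e (Suc (Suc n)) j\<bar> + \<bar>e n j\<bar>))
        \<le> L * (l2_norm N h (e (Suc (Suc n))) + l2_norm N h (e n))"
      unfolding l2_norm_scale[OF h0] using L
        l2_norm_triangle[OF h0, of N "\<lambda>j. \<bar>e (Suc (Suc n)) j\<bar>" "\<lambda>j. \<bar>e n j\<bar>"]
      by (simp add: l2_norm_abs mult_left_mono)
    also have "\<dots> \<le> L * (3/2 * s (Suc n) + 3/2 * s n)"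
      unfolding s_def using L by (intro mult_left_mono add_mono energy_controls h0) auto
    also have "\<dots> = 3/2 * (L * (s (Suc n) + s n))" by (simp add: algebra_simps)
    also have "\<dots> \<le> 2 * (L * (s (Suc n) + s n))"
      using L s_nonneg[of n] s_nonneg[of "Suc n"] by (intro mult_right_mono mult_nonneg_nonneg) auto
    finally show ?thesis by (simp add: mult.assoc)
  qed
  finally show ?thesis using tau by (simp add: mult_left_mono)
qed

text \<open>
  The first time step of the scheme is a Taylor polynomial in which \<open>u\<^sub>t\<^sub>t\<close> is expressed through the
  equation, with a difference quotient in the place of \<open>u\<^sub>x\<^sub>x\<close>.
\<close>

lemma initial_energy:
  assumes "\<tau> \<le> T"
  shows "s 0 \<le> 6 * c * M * (\<tau>\<^sup>2 + h\<^sup>2)"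
proof -
  have h0: "0 \<le> h" using h_pos by simp
  have \<tau>T: "\<tau> \<in> {0..T}" "0 \<in> {0..T}" using assms tau T by auto
  define R where "R x = v 0 \<tau> x - v 0 0 x - \<tau> * v 1 0 x - \<tau>\<^sup>2 / 2 * v 2 0 x" for x
  note R = initial_remainder[OF \<tau>T(1), folded R_def]
  have e0: "e 0 j = 0" if "j \<le> N" for j
    using scheme initial[OF x_mem[OF that]] that
    by (simp add: cnfd_solution_def Let_def e_def x_def[symmetric])
  have e1: "\<bar>e 1 j - R (x j)\<bar> \<le> M * \<tau>\<^sup>2 * h\<^sup>2" if j: "j \<le> N" for j
  proof -
    note xj = x_mem[OF j]
    have U1: "U 1 j = \<phi> (x j) + \<tau> * \<gamma> (x j) + \<tau>\<^sup>2 / 2 *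
        (dx2 N h (\<lambda>i. \<phi> (x i)) j - \<phi> (x j) - g_reg \<epsilon> (\<phi> (x j)))"
      using scheme j by (simp add: cnfd_solution_def Let_def x_def g_reg_def)
    have dx2: "dx2 N h (\<lambda>i. \<phi> (x i)) j = dx2 N h (\<lambda>i. v 0 0 (x i)) j"
    proof -
      have "\<phi> (x i) = v 0 0 (x i)" if "i \<le> N" for i using initial[OF x_mem[OF that]] by simp
      thus ?thesis using j N by (simp add: dx2_def right_nb_def left_nb_def)
    qed
    have pde0: "v 2 0 (x j) = uxx 0 (x j) - v 0 0 (x j) - g_reg \<epsilon> (v 0 0 (x j))"
      using pde[OF \<tau>T(2) xj] by linarith
    have "e 1 j - R (x j) = - (\<tau>\<^sup>2 / 2 * (dx2 N h (\<lambda>i. v 0 0 (x i)) j - uxx 0 (x j)))"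
      unfolding e_def U1 R_def dx2 pde0 using initial[OF xj] by (simp add: algebra_simps)
    also have "\<bar>\<dots>\<bar> = \<tau>\<^sup>2 / 2 * \<bar>dx2 N h (\<lambda>i. v 0 0 (x i)) j - uxx 0 (x j)\<bar>"
      by (simp add: abs_mult)
    also have "\<dots> \<le> \<tau>\<^sup>2 / 2 * (2 * M * h\<^sup>2)"
      using u_dx2[OF \<tau>T(2) N h j] unfolding x_def by (intro mult_left_mono) auto
    finally show ?thesis by (simp add: mult.left_commute)
  qed
  have e1b: "\<bar>e 1 j\<bar> \<le> M * \<tau> ^ 3 + M * \<tau>\<^sup>2 * h\<^sup>2" if "j < N" for j
    using e1[of j] R(1)[OF x_mem, of j] x_mem[of j] that by force
  have small: "\<tau> ^ 3 \<le> \<tau>\<^sup>2" "\<tau>\<^sup>2 * h\<^sup>2 \<le> h\<^sup>2" "\<tau> * h\<^sup>2 \<le> h\<^sup>2" "\<tau>\<^sup>2 * h \<le> \<tau>\<^sup>2"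
  proof -
    show "\<tau> ^ 3 \<le> \<tau>\<^sup>2" using tau by (intro power_decreasing) auto
    show "\<tau>\<^sup>2 * h\<^sup>2 \<le> h\<^sup>2" using tau by (intro mult_left_le_one_le power_le_one) auto
    show "\<tau> * h\<^sup>2 \<le> h\<^sup>2" using tau by (intro mult_left_le_one_le) auto
    show "\<tau>\<^sup>2 * h \<le> \<tau>\<^sup>2" using h1 h0 by (intro mult_right_le_one_le) auto
  qed
  have M: "M * \<tau> ^ 3 \<le> M * \<tau>\<^sup>2" "M * \<tau>\<^sup>2 * h\<^sup>2 \<le> M * h\<^sup>2" "M * \<tau> * h\<^sup>2 \<le> M * h\<^sup>2" "M * \<tau>\<^sup>2 * h \<le> M * \<tau>\<^sup>2"
    using small M_nonneg by (auto simp: mult.assoc intro!: mult_left_mono)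
  have Mnn: "0 \<le> M * \<tau>\<^sup>2" "0 \<le> M * h\<^sup>2" using M_nonneg by auto
  have n1: "l2_norm N h (e 1) \<le> c * (M * \<tau>\<^sup>2 + M * h\<^sup>2)"
  proof -
    have "l2_norm N h (e 1) \<le> sqrt (h * real N) * (M * \<tau>\<^sup>2 + M * h\<^sup>2)"
      using e1b M Mnn by (intro l2_norm_le_sup h0) fastforce+
    thus ?thesis by (simp add: hN c_def)
  qed
  have n2: "l2_norm N h (\<lambda>j. (e 1 j - e 0 j) / \<tau>) \<le> c * (M * \<tau>\<^sup>2 + M * h\<^sup>2)"
  proof -
    have "\<bar>(e 1 j - e 0 j) / \<tau>\<bar> \<le> M * \<tau>\<^sup>2 + M * h\<^sup>2" if "j < N" for j
    proof -
      have "\<bar>(e 1 j - e 0 j) / \<tau>\<bar> \<le> (M * \<tau> ^ 3 + M * \<tau>\<^sup>2 * h\<^sup>2) / \<tau>"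
        using e1b[OF that] e0[of j] that tau by (simp add: divide_right_mono)
      also have "\<dots> = M * \<tau>\<^sup>2 + M * \<tau> * h\<^sup>2"
        using tau by (simp add: field_simps power2_eq_square power3_eq_cube)
      finally show ?thesis using M(3) by linarith
    qed
    hence "l2_norm N h (\<lambda>j. (e 1 j - e 0 j) / \<tau>) \<le> sqrt (h * real N) * (M * \<tau>\<^sup>2 + M * h\<^sup>2)"
      using Mnn by (intro l2_norm_le_sup h0) auto
    thus ?thesis by (simp add: hN c_def)
  qed
  have n3: "l2_norm N h (dx_plus N h (e 1)) \<le> c * (4 * (M * \<tau>\<^sup>2))"
  proof -
    have "\<bar>dx_plus N h (e 1) j\<bar> \<le> 4 * (M * \<tau>\<^sup>2)" if j: "j < N" for j
    proof -
      have xx: "x (Suc j) - x j = h" by (simp add: x_def algebra_simps)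
      have "\<bar>R (x (Suc j)) - R (x j)\<bar> \<le> 2 * M * h * \<tau>\<^sup>2"
        using R(2)[OF x_mem x_mem, of "Suc j" j] j h0 by (simp add: xx)
      moreover have "\<bar>e 1 (Suc j) - R (x (Suc j))\<bar> \<le> M * \<tau>\<^sup>2 * h\<^sup>2"
        "\<bar>e 1 j - R (x j)\<bar> \<le> M * \<tau>\<^sup>2 * h\<^sup>2" using e1[of j] e1[of "Suc j"] j by auto
      ultimately have "\<bar>e 1 (Suc j) - e 1 j\<bar> \<le> 2 * M * h * \<tau>\<^sup>2 + 2 * (M * \<tau>\<^sup>2 * h\<^sup>2)" by linarith
      also have "\<dots> = (2 * (M * \<tau>\<^sup>2) + 2 * (M * \<tau>\<^sup>2 * h)) * h"
        by (simp add: power2_eq_square algebra_simps)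
      also have "\<dots> \<le> 4 * (M * \<tau>\<^sup>2) * h" using M(4) h0 by (intro mult_right_mono) auto
      finally show ?thesis using j h_pos by (simp add: dx_plus_def right_nb_def field_simps)
    qed
    hence "l2_norm N h (dx_plus N h (e 1)) \<le> sqrt (h * real N) * (4 * (M * \<tau>\<^sup>2))"
      using Mnn by (intro l2_norm_le_sup h0) auto
    thus ?thesis by (simp add: hN c_def)
  qed
  have z: "l2_norm N h (e 0) = 0" "l2_norm N h (dx_plus N h (e 0)) = 0"
    using e0 by (auto simp: l2_norm_def dx_plus_def right_nb_def)
  define p where "p = l2_norm N h (\<lambda>j. (e 1 j - e 0 j) / \<tau>)"
  define q where "q = l2_norm N h (dx_plus N h (e 1))"
  define r where "r = l2_norm N h (e 1)"
  have nn: "0 \<le> p" "0 \<le> q" "0 \<le> r" using h0 by (auto simp: p_def q_def r_def l2_norm_nonneg)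
  have "energy N h \<tau> (e 0) (e 1) = p\<^sup>2 + q\<^sup>2 / 2 + r\<^sup>2 / 2"
    by (simp add: energy_def z p_def q_def r_def)
  also have "\<dots> \<le> p\<^sup>2 + q\<^sup>2 + r\<^sup>2"
    using zero_le_power2[of q] zero_le_power2[of r] by linarith
  also have "\<dots> \<le> (p + q + r)\<^sup>2"
    using nn by (simp add: power2_eq_square algebra_simps)
  finally have "s 0 \<le> p + q + r"
    unfolding s_def using nn by (intro real_le_lsqrt) auto
  also have "\<dots> \<le> c * (M * \<tau>\<^sup>2 + M * h\<^sup>2) + c * (4 * (M * \<tau>\<^sup>2)) + c * (M * \<tau>\<^sup>2 + M * h\<^sup>2)"
    using n1 n2 n3 unfolding p_def q_def r_def by linarith
  also have "\<dots> = c * (6 * (M * \<tau>\<^sup>2) + 2 * (M * h\<^sup>2))" by (simp add: algebra_simps)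
  also have "\<dots> \<le> c * (6 * (M * \<tau>\<^sup>2) + 6 * (M * h\<^sup>2))"
    using Mnn c_pos by (intro mult_left_mono add_left_mono) auto
  finally show ?thesis by (simp add: algebra_simps)
qed


text \<open>
  The growth rate \<open>K\<close> of the Osgood sequence.
\<close>

definition rate :: real where "rate = 10 * c + 8 * log_const M + 16"

text \<open>
  The induction compares \<open>s n\<close> with the Osgood sequence. The conditions on the step sizes involve
  \<open>\<Gamma>\<close>, \<open>y\<close> and \<open>\<delta>\<close>, which can all be fixed in terms of \<open>b - a\<close>, \<open>T\<close> and \<open>M\<close>, hence independently of \<open>\<epsilon>\<close>.
\<close>

lemma uniform_bound:
  assumes \<tau>: "\<tau> * rate \<le> 1/2" "\<tau> * (2 * (2 * \<Gamma> + log_const M)) \<le> 1/2" and \<Gamma>: "0 \<le> \<Gamma>"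
    and y: "exp (1 - \<Gamma> * exp (- 2 * (rate * T))) \<le> y" "y < 1" "3/2 * (1 / c + c) * y \<le> 1"
    and start: "6 * c * M * (\<tau>\<^sup>2 + h\<^sup>2) \<le> exp (1 - \<Gamma>)" and \<delta>: "0 < \<delta>" "\<delta> < 1"
    and res: "5 * M * \<tau>\<^sup>2 + 2 * M * h\<^sup>2 + (lip_const M \<delta> * M * \<tau> + 4 * \<delta>) \<le> exp (1 - \<Gamma>)"
    and n: "real (Suc n) * \<tau> \<le> T"
  shows "s n \<le> y" and "j \<le> N \<Longrightarrow> \<bar>e n j\<bar> \<le> 1"
proof -
  have rate: "0 \<le> rate" using c_pos log_const_ge_2[of M] by (simp add: rate_def)
  define k where "k = \<tau> * rate"
  have k: "0 \<le> k" "k \<le> 1/2" using rate tau \<tau> by (auto simp: k_def)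
  have nk: "real n * k \<le> rate * T" if "real (Suc n) * \<tau> \<le> T" for n
  proof -
    have "real n * \<tau> \<le> T" using that tau by (simp add: algebra_simps)
    hence "real n * \<tau> * rate \<le> T * rate" using rate by (rule mult_right_mono)
    thus ?thesis by (simp add: k_def mult_ac)
  qed
  have os: "osgood \<Gamma> k n \<le> y" "exp (1 - \<Gamma>) \<le> osgood \<Gamma> k n" if "real (Suc n) * \<tau> \<le> T" for n
    using osgood_bounds[OF k \<Gamma> nk[OF that]] y(1) by auto
  have e1: "\<bar>e n j\<bar> \<le> 1" if "real (Suc n) * \<tau> \<le> T" "j \<le> N" "s n \<le> y" for n j
  proof -
    have "3/2 * (1 / c + c) * s n \<le> 3/2 * (1 / c + c) * y"
      using that c_pos by (intro mult_left_mono) auto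
    thus ?thesis using error_sup_bound[OF that(1,2)] y(3) by linarith
  qed
  have *: "s n \<le> osgood \<Gamma> k n" using n
  proof (induction n)
    case 0
    hence "s 0 \<le> 6 * c * M * (\<tau>\<^sup>2 + h\<^sup>2)" by (intro initial_energy) simp
    thus ?case using start by (simp add: osgood_def)
  next
    case (Suc n)
    have n1: "real (Suc n) * \<tau> \<le> T" using Suc.prems tau by (simp add: algebra_simps)
    define q where "q = osgood \<Gamma> k n"
    have sq: "s n \<le> q" using Suc.IH[OF n1] by (simp add: q_def)
    have q: "q \<le> y" "exp (1 - \<Gamma>) \<le> q" using os[OF n1] by (auto simp: q_def)
    have q01: "0 < q" "q < 1"
      using order_le_less_trans[OF q(1) y(2)] by (auto simp: q_def osgood_def)
    define X where "X = 5 * M * \<tau>\<^sup>2 + 2 * M * h\<^sup>2 + (lip_const M \<delta> * M * \<tau> + 4 * \<delta>)"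
    have X: "0 \<le> X" "\<bar>residual n j\<bar> \<le> X" if "j < N" for j
      using residual_bound(2)[OF Suc.prems _ \<delta>, of j] that by (auto simp: X_def)
    have X0: "0 \<le> X" using X(1)[OF N] .
    have l: "ln (1 / q) \<le> \<Gamma>"
    proof -
      have "ln (exp (1 - \<Gamma>)) \<le> ln q" using q q01 by (intro ln_mono) auto
      thus ?thesis using q01 by (simp add: ln_div)
    qed
    have step: "s (Suc n) \<le> s n + \<tau> * (c * (X + 4 * q) + 2 * lip_const (M + 1) q * (s (Suc n) + s n))"
    proof (rule error_step[OF Suc.prems X0])
      show "\<bar>e n j\<bar> \<le> 1" if "j < N" for j using that sq q(1) by (intro e1[OF n1]) auto
      show "0 \<le> lip_const (M + 1) q" using lip_const_ge_2[OF q01, of "M + 1"] by linarith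
      show "\<bar>g_reg \<epsilon> z - g_reg \<epsilon> w\<bar> \<le> lip_const (M + 1) q * \<bar>z - w\<bar> + 4 * q"
        if "\<bar>z\<bar> \<le> M + 1" "\<bar>w\<bar> \<le> M + 1" for z w
        by (rule g_reg_log_lipschitz[OF eps q01 that])
    qed (use X q01 in auto)
    have "s (Suc n) \<le> q * (1 + \<tau> * (10 * c + 8 * log_const M + 16) * (1 + ln (1 / q)))"
    proof (rule osgood_step[where s = "s n" and X = X])
      have "\<tau> * (2 * (2 * ln (1 / q) + log_const M)) \<le> \<tau> * (2 * (2 * \<Gamma> + log_const M))"
        using l tau by (intro mult_left_mono) auto
      thus "\<tau> * (2 * (2 * ln (1 / q) + log_const M)) \<le> 1/2" using \<tau>(2) by linarith
      show "X \<le> q" using res q(2) by (simp add: X_def)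
      show "s (Suc n) \<le> s n + \<tau> * (c * (X + 4 * q) + 2 * (2 * ln (1 / q) + log_const M) * (s (Suc n) + s n))"
        using step by (simp only: lip_const_eq)
    qed (use q01 sq X0 c_pos tau s_nonneg log_const_ge_2[of M] in auto)
    also have "\<dots> \<le> osgood \<Gamma> k (Suc n)"
      using osgood_Suc_ge[OF k \<Gamma>, of n] by (simp add: q_def k_def rate_def)
    finally show ?case .
  qed
  thus "s n \<le> y" using os(1)[OF n] by linarith
  thus "\<bar>e n j\<bar> \<le> 1" if "j \<le> N" using e1[OF n that] by blast
qed

definition gronwall_const :: real
  where "gronwall_const = exp (8 * log_const M * T + 16 * ln 32 * T) *
    (6 * c * M + 2 * c * T * (5 * M + 2 * M * (2 + log_const M) + 3 * M\<^sup>2))"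

lemma gronwall_const_nonneg: "0 \<le> gronwall_const"
  unfolding gronwall_const_def using c_pos T M_nonneg log_const_ge_2[of M]
  by (intro mult_nonneg_nonneg add_nonneg_nonneg) auto

text \<open>
  Once the errors are known to be bounded by 1, the Lipschitz constant \<open>L\<close> of \<open>g_reg \<epsilon>\<close> is available. If
  \<open>\<tau> L\<close> is small, the implicit recursion can be solved and Gronwall applies. Otherwise
  \<open>\<tau> / \<epsilon>\<close> is bounded below, because \<open>L = O(1 / \<epsilon>)\<close>, and the claim already follows from the boundedness of
  the error. So no relation between \<open>\<tau>\<close> and \<open>\<epsilon>\<close> is needed.
\<close>

lemma convergence_rate:
  assumes bounded: "\<And>n. real (Suc n) * \<tau> \<le> T \<Longrightarrow> s n \<le> 1"
      "\<And>n j. real (Suc n) * \<tau> \<le> T \<Longrightarrow> j \<le> N \<Longrightarrow> \<bar>e n j\<bar> \<le> 1"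
    and n: "real (Suc n) * \<tau> \<le> T"
  shows "s n \<le> (gronwall_const + (4 * (2 + log_const M))\<^sup>2)
    * (exp (T / (2 * \<epsilon>)) * (h\<^sup>2 + \<tau>\<^sup>2 / \<epsilon>\<^sup>2))"
proof -
  define E where "E = h\<^sup>2 + \<tau>\<^sup>2 / \<epsilon>\<^sup>2"
  define A where "A = log_const M"
  define L where "L = lip_const (M + 1) \<epsilon>"
  have A: "2 \<le> A" unfolding A_def by (rule log_const_ge_2)
  have L2: "2 \<le> L" unfolding L_def by (rule lip_const_ge_2[OF eps])
  have L: "L \<le> (2 + A) / \<epsilon>" unfolding L_def A_def by (rule lip_const_le_inverse[OF eps])
  have E: "h\<^sup>2 \<le> E" "\<tau>\<^sup>2 / \<epsilon>\<^sup>2 \<le> E" "0 \<le> E" by (auto simp: E_def)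
  have ee: "1 \<le> exp (T / (2 * \<epsilon>))" using T eps by simp
  have inv: "1 \<le> 1 / \<epsilon>" "1 / \<epsilon> \<le> 1 / \<epsilon>\<^sup>2" "1 \<le> 1 / \<epsilon>\<^sup>2"
    using eps by (auto simp: field_simps power2_eq_square mult_le_one)
  have \<tau>E: "\<tau>\<^sup>2 \<le> \<tau>\<^sup>2 / \<epsilon>\<^sup>2" "\<tau>\<^sup>2 / \<epsilon> \<le> \<tau>\<^sup>2 / \<epsilon>\<^sup>2"
    using mult_left_mono[OF inv(3), of "\<tau>\<^sup>2"] mult_left_mono[OF inv(2), of "\<tau>\<^sup>2"] by auto
  have T': "\<tau> \<le> T" "real n * \<tau> \<le> T"
  proof -
    have "0 \<le> real n * \<tau>" using tau by simp
    moreover have "real n * \<tau> + \<tau> \<le> T" using n by (simp add: algebra_simps)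
    ultimately show "\<tau> \<le> T" "real n * \<tau> \<le> T" using tau by linarith+
  qed
  have "s n \<le> gronwall_const * (exp (T / (2 * \<epsilon>)) * E)
    \<or> s n \<le> (4 * (2 + A))\<^sup>2 * (exp (T / (2 * \<epsilon>)) * E)"
  proof (cases "2 * L * \<tau> \<le> 1/2")
    case True
    define X where "X = (5 * M + 2 * M * (2 + A) + 3 * M\<^sup>2) * E"
    have XR: "5 * M * \<tau>\<^sup>2 + 2 * M * h\<^sup>2 + (2 * M * lip_const M \<epsilon> + 3 / \<epsilon> * M\<^sup>2) * \<tau>\<^sup>2 \<le> X"
    proof -
      have "5 * M * \<tau>\<^sup>2 + 2 * M * h\<^sup>2 \<le> 5 * M * \<tau>\<^sup>2 + 5 * M * h\<^sup>2"
        using M_nonneg by (simp add: mult_right_mono)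
      also have "\<dots> = 5 * M * (\<tau>\<^sup>2 + h\<^sup>2)" by (simp add: distrib_left)
      also have "\<dots> \<le> 5 * M * E" using \<tau>E M_nonneg by (intro mult_left_mono) (auto simp: E_def)
      finally have 1: "5 * M * \<tau>\<^sup>2 + 2 * M * h\<^sup>2 \<le> 5 * M * E" .
      have "lip_const M \<epsilon> \<le> (2 + A) / \<epsilon>"
        using lip_const_mono[OF M_nonneg, of \<epsilon>] L by (simp add: L_def)
      hence "2 * M * lip_const M \<epsilon> \<le> 2 * M * ((2 + A) / \<epsilon>)" using M_nonneg by (intro mult_left_mono) auto
      hence "(2 * M * lip_const M \<epsilon> + 3 / \<epsilon> * M\<^sup>2) * \<tau>\<^sup>2 \<le> (2 * M * ((2 + A) / \<epsilon>) + 3 / \<epsilon> * M\<^sup>2) * \<tau>\<^sup>2"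
        by (intro mult_right_mono add_right_mono) auto
      also have "\<dots> = (2 * M * (2 + A) + 3 * M\<^sup>2) * (\<tau>\<^sup>2 / \<epsilon>)"
        using eps by (simp add: field_simps)
      also have "\<dots> \<le> (2 * M * (2 + A) + 3 * M\<^sup>2) * E"
        using \<tau>E E A M_nonneg by (intro mult_left_mono) auto
      finally show ?thesis using 1 by (simp add: X_def distrib_right)
    qed
    have X0: "0 \<le> X" unfolding X_def using A M_nonneg E by (intro mult_nonneg_nonneg) auto
    have "s n \<le> exp (4 * (2 * L * \<tau>) * real n) * (s 0 + 2 * (\<tau> * (c * X)) * real n)"
    proof (rule discrete_gronwall[where s = s])
      fix m assume m: "m < n"
      have m2: "real (Suc (Suc m)) * \<tau> \<le> T"
      proof -
        have "real (Suc (Suc m)) * \<tau> \<le> real (Suc n) * \<tau>" using m tau by (intro mult_right_mono) auto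
        thus ?thesis using n by linarith
      qed
      hence m1: "real (Suc m) * \<tau> \<le> T" using tau by (simp add: algebra_simps)
      have "s (Suc m) \<le> s m + \<tau> * (c * (X + 0) + 2 * L * (s (Suc m) + s m))"
      proof (rule error_step[OF m2 X0])
        show "\<bar>residual m j\<bar> \<le> X" if "j < N" for j
          using residual_bound(1)[OF m2, of j] that XR by simp
        show "\<bar>e m j\<bar> \<le> 1" if "j < N" for j using bounded(2)[OF m1] that by simp
        show "\<bar>g_reg \<epsilon> z - g_reg \<epsilon> w\<bar> \<le> L * \<bar>z - w\<bar> + 0"
          if "\<bar>z\<bar> \<le> M + 1" "\<bar>w\<bar> \<le> M + 1" for z w
          using g_reg_lipschitz[OF eps that] by (simp add: L_def)
      qed (use L2 in auto)
      thus "s (Suc m) \<le> s m + \<tau> * (c * X) + 2 * L * \<tau> * (s (Suc m) + s m)"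
        by (simp add: algebra_simps)
    qed (use s_nonneg X0 c_pos tau True L2 in auto)
    also have "\<dots> \<le> exp (8 * L * T) * (6 * c * M * E + 2 * c * T * X)"
    proof (rule mult_mono[OF _ add_mono])
      have "8 * L * (real n * \<tau>) \<le> 8 * L * T" using T' L2 by (intro mult_left_mono) auto
      thus "exp (4 * (2 * L * \<tau>) * real n) \<le> exp (8 * L * T)" by (simp add: mult_ac)
      have "6 * c * M * (\<tau>\<^sup>2 + h\<^sup>2) \<le> 6 * c * M * E"
        using \<tau>E c_pos M_nonneg by (intro mult_left_mono) (auto simp: E_def)
      thus "s 0 \<le> 6 * c * M * E" using initial_energy[OF T'(1)] by linarith
      have "2 * c * X * (real n * \<tau>) \<le> 2 * c * X * T"
        using T'(2) c_pos X0 by (intro mult_left_mono) auto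
      thus "2 * (\<tau> * (c * X)) * real n \<le> 2 * c * T * X" by (simp add: mult_ac)
    qed (use s_nonneg[of 0] X0 c_pos tau in auto)
    also have "6 * c * M * E + 2 * c * T * X
        = (6 * c * M + 2 * c * T * (5 * M + 2 * M * (2 + A) + 3 * M\<^sup>2)) * E"
      by (simp add: X_def algebra_simps)
    also have "exp (8 * L * T) * \<dots> \<le> (exp (8 * A * T + 16 * ln 32 * T) * exp (T / (2 * \<epsilon>))) * \<dots>"
    proof (rule mult_right_mono)
      have "8 * L = 16 * ln (1 / \<epsilon>) + 8 * A" by (simp add: L_def A_def lip_const_eq)
      also have "\<dots> \<le> 1 / (2 * \<epsilon>) + 16 * ln 32 + 8 * A" using ln_inverse_le[OF eps(1)] by simp
      finally have "8 * L * T \<le> (1 / (2 * \<epsilon>) + 16 * ln 32 + 8 * A) * T"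
        using T by (intro mult_right_mono) auto
      also have "\<dots> = (8 * A * T + 16 * ln 32 * T) + T / (2 * \<epsilon>)" by (simp add: algebra_simps)
      finally show "exp (8 * L * T) \<le> exp (8 * A * T + 16 * ln 32 * T) * exp (T / (2 * \<epsilon>))"
        by (simp only: exp_add[symmetric] exp_le_cancel_iff)
      show "0 \<le> (6 * c * M + 2 * c * T * (5 * M + 2 * M * (2 + A) + 3 * M\<^sup>2)) * E"
        using c_pos T M_nonneg A E by (intro mult_nonneg_nonneg add_nonneg_nonneg) auto
    qed
    also have "\<dots> = gronwall_const * (exp (T / (2 * \<epsilon>)) * E)"
      by (simp only: gronwall_const_def A_def mult_ac)
    finally show ?thesis by blast
  next
    case False
    hence "1 \<le> 4 * L * \<tau>" by simp
    also have "\<dots> \<le> 4 * ((2 + A) / \<epsilon>) * \<tau>"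
      using tau(1) by (intro mult_right_mono mult_left_mono L) auto
    also have "\<dots> = 4 * (2 + A) * (\<tau> / \<epsilon>)" by simp
    finally have "1 \<le> (4 * (2 + A) * (\<tau> / \<epsilon>))\<^sup>2" by (rule one_le_power)
    also have "\<dots> = (4 * (2 + A))\<^sup>2 * (\<tau>\<^sup>2 / \<epsilon>\<^sup>2)" by (simp only: power_mult_distrib power_divide)
    also have "\<dots> \<le> (4 * (2 + A))\<^sup>2 * (exp (T / (2 * \<epsilon>)) * E)"
    proof (rule mult_left_mono)
      have "1 * E \<le> exp (T / (2 * \<epsilon>)) * E" using ee E(3) by (intro mult_right_mono) auto
      thus "\<tau>\<^sup>2 / \<epsilon>\<^sup>2 \<le> exp (T / (2 * \<epsilon>)) * E" using E(2) by linarith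
    qed simp
    finally show ?thesis using bounded(1)[OF n] by linarith
  qed
  moreover have "0 \<le> gronwall_const * (exp (T / (2 * \<epsilon>)) * E)"
    using gronwall_const_nonneg E by simp
  moreover have "0 \<le> (4 * (2 + A))\<^sup>2 * (exp (T / (2 * \<epsilon>)) * E)" using E by simp
  ultimately have "s n \<le> gronwall_const * (exp (T / (2 * \<epsilon>)) * E)
      + (4 * (2 + A))\<^sup>2 * (exp (T / (2 * \<epsilon>)) * E)" by linarith
  thus ?thesis by (simp add: E_def A_def distrib_right)
qed

lemma error_norm_bound:
  "l2_norm N h (dx_plus N h (e n)) + l2_norm N h (e n) \<le> 3 * s n"
  using energy_controls(2,4)[where h = h and N = N and v = "e n" and w = "e (Suc n)" and \<tau> = \<tau>] h_pos
  by (simp add: s_def)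

end

section \<open>Convergence\<close>

lemma small_steps:
  fixes P Q R :: real
  assumes "0 \<le> P" "0 \<le> Q" "0 \<le> R" "0 < \<eta>"
  obtains \<mu> where "0 < \<mu>" "\<mu> \<le> 1" "\<mu> * P \<le> 1/2" "\<mu> * Q \<le> \<eta>" "\<mu> * R \<le> \<eta>"
proof -
  define \<mu> where "\<mu> = min 1 (min (1 / (2 * (P + 1))) (min (\<eta> / (Q + 1)) (\<eta> / (R + 1))))"
  have "0 < \<mu>" using assms by (simp add: \<mu>_def)
  moreover have "\<mu> \<le> 1" by (simp add: \<mu>_def)
  moreover have "\<mu> * P \<le> 1/2"
  proof -
    have "\<mu> * P \<le> 1 / (2 * (P + 1)) * P" using assms by (intro mult_right_mono) (auto simp: \<mu>_def)
    also have "\<dots> \<le> 1/2" using assms by (simp add: field_simps)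
    finally show ?thesis .
  qed
  moreover have "\<mu> * S \<le> \<eta>" if "0 \<le> S" "\<mu> \<le> \<eta> / (S + 1)" for S
  proof -
    have "\<mu> * S \<le> \<eta> / (S + 1) * S" using that by (intro mult_right_mono) auto
    also have "\<dots> \<le> \<eta>" using assms that by (simp add: field_simps)
    finally show ?thesis .
  qed
  hence "\<mu> * Q \<le> \<eta>" "\<mu> * R \<le> \<eta>" using assms by (auto simp: \<mu>_def)
  ultimately show ?thesis using that by blast
qed

lemma abs_le_cylinder_norm:
  assumes "a < b" "0 < T" "is_solution a b \<epsilon> \<phi> \<gamma> T u" "t \<in> {0..T}" "x \<in> {a..b}"
  shows "ereal \<bar>u t x\<bar> \<le> Linf_norm ({0..T} \<times> {a<..<b}) (\<lambda>(t, x). u t x)"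
proof -
  have cl: "closure ({0<..<T} \<times> {a<..<b}) = {0..T} \<times> {a..b}"
    using assms by (simp add: closure_Times)
  have "continuous_on ({0..T} \<times> {a..b}) (\<lambda>(t, x). u t x)"
    using assms(3) unfolding is_solution_def by blast
  moreover have "{0..T} \<times> {a<..<b} \<in> sets (lebesgue :: (real \<times> real) measure)"
    by (intro sets_completionI_sets) (auto simp: borel_prod[symmetric])
  ultimately have "ereal \<bar>(case (t, x) of (t, x) \<Rightarrow> u t x)\<bar>
      \<le> Linf_norm ({0..T} \<times> {a<..<b}) (\<lambda>(t, x). u t x)"
    using assms(4,5) by (intro abs_le_Linf_norm[of "{0<..<T} \<times> {a<..<b}"]) (auto simp: cl intro: open_Times)
  thus ?thesis by simp
qed

lemma linf_norm_attained:
  assumes "0 < N"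
  obtains j where "j < N" "linf_norm N w = \<bar>w j\<bar>"
proof -
  have "linf_norm N w \<in> (\<lambda>j. \<bar>w j\<bar>) ` {..<N}"
    unfolding linf_norm_def using assms by (subst cSup_eq_Max) (auto intro!: Max_in)
  thus ?thesis using that by auto
qed

theorem theorem4p1:
  fixes a b T \<epsilon>\<^sub>0 M :: real
    and \<phi> \<gamma> :: "real \<Rightarrow> real"
    and u :: "real \<Rightarrow> real \<Rightarrow> real \<Rightarrow> real"
  assumes "a < b" and "0 < T" and "0 < \<epsilon>\<^sub>0" and "\<epsilon>\<^sub>0 < 1"
    and T_less: "\<And>\<epsilon>. 0 < \<epsilon> \<Longrightarrow> \<epsilon> \<le> \<epsilon>\<^sub>0 \<Longrightarrow> ereal T < max_existence_time a b \<epsilon> \<phi> \<gamma>"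
    and sol: "\<And>\<epsilon>. 0 < \<epsilon> \<Longrightarrow> \<epsilon> \<le> \<epsilon>\<^sub>0 \<Longrightarrow> is_solution a b \<epsilon> \<phi> \<gamma> T (u \<epsilon>)"
    and reg: "\<And>\<epsilon>. 0 < \<epsilon> \<Longrightarrow> \<epsilon> \<le> \<epsilon>\<^sub>0 \<Longrightarrow> regular_solution a b T M (u \<epsilon>)"
  shows "\<exists>h\<^sub>0>0. \<exists>\<tau>\<^sub>0>0. \<exists>C. \<forall>\<epsilon> N h \<tau> U.
    0 < \<epsilon> \<longrightarrow> \<epsilon> \<le> \<epsilon>\<^sub>0 \<longrightarrow>
    0 < N \<longrightarrow> h = (b - a) / real N \<longrightarrow> h \<le> h\<^sub>0 \<longrightarrow>
    0 < \<tau> \<longrightarrow> \<tau> \<le> \<tau>\<^sub>0 \<longrightarrow>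
    cnfd_solution a \<epsilon> \<phi> \<gamma> N h \<tau> U \<longrightarrow>
    (\<forall>n. real n \<le> T / \<tau> - 1 \<longrightarrow>
      (let e = (\<lambda>j. u \<epsilon> (real n * \<tau>) (a + real j * h) - U n j);
           \<Lambda> = Linf_norm ({0..T} \<times> {a<..<b}) (\<lambda>(t, x). u \<epsilon> t x)
       in l2_norm N h (dx_plus N h e) + l2_norm N h e
            \<le> C * (exp (T / (2 * \<epsilon>)) * (h\<^sup>2 + \<tau>\<^sup>2 / \<epsilon>\<^sup>2)) \<and>
          ereal (linf_norm N (U n)) \<le> \<Lambda> + 1))"
proof -
  obtain v0 uxx0 where "smooth_solution a b T M \<epsilon>\<^sub>0 v0 uxx0"
    using regular_solution_smooth[OF assms(1,2) sol[OF assms(3) order_refl] reg[OF assms(3) order_refl]]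
    by blast
  hence M: "0 \<le> M" by (rule smooth_solution.M_nonneg)
  define c where "c = sqrt (b - a)"
  have c: "0 < c" using assms(1) by (simp add: c_def)
  define A where "A = log_const M"
  have A: "2 \<le> A" unfolding A_def by (rule log_const_ge_2)
  define K where "K = 10 * c + 8 * A + 16"
  have K: "0 \<le> K" using c A by (simp add: K_def)
  \<comment> \<open>The ceiling for the root of the energy: below it the error is at most 1 pointwise.\<close>
  define y where "y = min (1/2) (1 / (3/2 * (1 / c + c)))"
  have y: "0 < y" "y < 1" using c by (auto simp: y_def add_pos_pos)
  have "y \<le> 1 / (3/2 * (1 / c + c))" unfolding y_def by (rule min.cobounded2)
  hence y1: "3/2 * (1 / c + c) * y \<le> 1" using c by (simp add: field_simps add_pos_pos)
  \<comment> \<open>With this \<open>\<Gamma>\<close> the Osgood sequence, started at \<open>exp (1 - \<Gamma>)\<close>, stays below \<open>y\<close> up to time \<open>T\<close>.\<close>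
  define \<Gamma> where "\<Gamma> = (1 - ln y) * exp (2 * (K * T))"
  have "ln y < 0" using y by simp
  hence \<Gamma>: "0 \<le> \<Gamma>" by (simp add: \<Gamma>_def)
  have \<Gamma>y: "exp (1 - \<Gamma> * exp (- 2 * (K * T))) \<le> y"
  proof -
    have "\<Gamma> * exp (- 2 * (K * T)) = 1 - ln y"
      by (simp add: \<Gamma>_def mult.assoc exp_add[symmetric])
    thus ?thesis using y by simp
  qed
  \<comment> \<open>Residual and initial error each consist of few terms, each of which is kept below \<open>\<eta>\<close>.\<close>
  define \<eta> where "\<eta> = exp (1 - \<Gamma>) / 4"
  define \<delta> where "\<delta> = min (1/2) (\<eta> / 4)"
  have \<eta>: "0 < \<eta>" by (simp add: \<eta>_def)
  have \<delta>: "0 < \<delta>" "\<delta> < 1" "4 * \<delta> \<le> \<eta>" using \<eta> by (auto simp: \<delta>_def)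
  define L where "L = lip_const M \<delta>"
  have L: "0 \<le> L" unfolding L_def using lip_const_ge_2[OF \<delta>(1,2), of M] by linarith
  obtain \<mu> where \<mu>: "0 < \<mu>" "\<mu> \<le> 1" "\<mu> * (K + 2 * (2 * \<Gamma> + A)) \<le> 1/2"
    "\<mu> * (6 * c * M) \<le> \<eta>" "\<mu> * (5 * M + L * M) \<le> \<eta>"
    by (rule small_steps[of "K + 2 * (2 * \<Gamma> + A)" "6 * c * M" "5 * M + L * M" \<eta>])
       (use K \<Gamma> A c M L \<eta> in auto)
  define C where "C = 3 * (exp (8 * log_const M * T + 16 * ln 32 * T) *
    (6 * c * M + 2 * c * T * (5 * M + 2 * M * (2 + log_const M) + 3 * M\<^sup>2)) + (4 * (2 + log_const M))\<^sup>2)"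
  have main: "l2_norm N h (dx_plus N h e) + l2_norm N h e
        \<le> C * (exp (T / (2 * \<epsilon>)) * (h\<^sup>2 + \<tau>\<^sup>2 / \<epsilon>\<^sup>2)) \<and>
      ereal (linf_norm N (U n)) \<le> Linf_norm ({0..T} \<times> {a<..<b}) (\<lambda>(t, x). u \<epsilon> t x) + 1"
    if eps: "0 < \<epsilon>" "\<epsilon> \<le> \<epsilon>\<^sub>0" and N: "0 < N" and h: "h = (b - a) / real N" "h \<le> \<mu>"
      and \<tau>: "0 < \<tau>" "\<tau> \<le> \<mu>" and U: "cnfd_solution a \<epsilon> \<phi> \<gamma> N h \<tau> U"
      and n: "real n \<le> T / \<tau> - 1" and e: "e = (\<lambda>j. u \<epsilon> (real n * \<tau>) (a + real j * h) - U n j)"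
    for \<epsilon> N h \<tau> U n e
  proof -
    obtain v uxx where v: "smooth_solution a b T M \<epsilon> v uxx" "v 0 = u \<epsilon>"
      "\<And>x. x \<in> {a..b} \<Longrightarrow> v 0 0 x = \<phi> x \<and> v 1 0 x = \<gamma> x"
      using regular_solution_smooth[OF assms(1,2) sol[OF eps] reg[OF eps]] by blast
    interpret E: cnfd_error a b T M \<epsilon> v uxx N h \<tau> \<phi> \<gamma> U
    proof (intro cnfd_error.intro v(1) cnfd_error_axioms.intro)
      show "h \<le> 1" "\<tau> \<le> 1" "\<epsilon> < 1" using h(2) \<tau>(2) \<mu>(2) eps(2) assms(4) by linarith+
    qed (use eps N h \<tau> U v(3) in auto)
    have Ec: "E.c = c" "E.rate = K"
      by (simp_all add: E.c_def E.rate_def c_def K_def A_def)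
    have nT: "real (Suc n) * \<tau> \<le> T" using n \<tau>(1) by (simp add: field_simps)
    have sq: "\<tau>\<^sup>2 \<le> \<mu>" "h\<^sup>2 \<le> \<mu>"
    proof -
      have *: "z\<^sup>2 \<le> \<mu>" if "0 < z" "z \<le> \<mu>" for z
      proof -
        have "z * z \<le> 1 * \<mu>" using that \<mu>(2) by (intro mult_mono) auto
        thus ?thesis by (simp add: power2_eq_square)
      qed
      show "\<tau>\<^sup>2 \<le> \<mu>" "h\<^sup>2 \<le> \<mu>" using *[OF \<tau>] *[OF E.h_pos h(2)] by auto
    qed
    have step: "\<tau> * K \<le> 1/2" "\<tau> * (2 * (2 * \<Gamma> + A)) \<le> 1/2"
    proof -
      have "\<tau> * (K + 2 * (2 * \<Gamma> + A)) \<le> \<mu> * (K + 2 * (2 * \<Gamma> + A))"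
        using \<tau>(2) K \<Gamma> A by (intro mult_right_mono) auto
      hence "\<tau> * K + \<tau> * (2 * (2 * \<Gamma> + A)) \<le> 1/2"
        using \<mu>(3) by (simp only: distrib_left[of \<tau>])
      moreover have "0 \<le> \<tau> * K" "0 \<le> \<tau> * (2 * (2 * \<Gamma> + A))" using \<tau>(1) K \<Gamma> A by auto
      ultimately show "\<tau> * K \<le> 1/2" "\<tau> * (2 * (2 * \<Gamma> + A)) \<le> 1/2"
        by linarith+
    qed
    have start: "6 * c * M * (\<tau>\<^sup>2 + h\<^sup>2) \<le> exp (1 - \<Gamma>)"
    proof -
      have "6 * c * M * (\<tau>\<^sup>2 + h\<^sup>2) \<le> 6 * c * M * (\<mu> + \<mu>)"
        using sq c M by (intro mult_left_mono add_mono) auto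
      also have "\<dots> \<le> 2 * \<eta>" using \<mu>(4) by (simp add: algebra_simps)
      finally show ?thesis using exp_gt_zero[of "1 - \<Gamma>"] unfolding \<eta>_def by linarith
    qed
    have res: "5 * M * \<tau>\<^sup>2 + 2 * M * h\<^sup>2 + (lip_const M \<delta> * M * \<tau> + 4 * \<delta>) \<le> exp (1 - \<Gamma>)"
    proof -
      have "5 * M * \<tau>\<^sup>2 \<le> 5 * M * \<mu>" "2 * M * h\<^sup>2 \<le> 5 * M * \<mu>" "L * M * \<tau> \<le> L * M * \<mu>"
        using sq M \<tau> L by (auto intro!: mult_mono mult_left_mono)
      moreover have "5 * M * \<mu> + L * M * \<mu> \<le> \<eta>" using \<mu>(5) by (simp add: algebra_simps)
      moreover have "0 \<le> L * M * \<mu>" using L M \<mu>(1) by simp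
      ultimately have "5 * M * \<tau>\<^sup>2 + 2 * M * h\<^sup>2 + (L * M * \<tau> + 4 * \<delta>) \<le> 4 * \<eta>"
        using \<delta>(3) \<eta> by linarith
      thus ?thesis by (simp add: \<eta>_def L_def)
    qed
    note unif = E.uniform_bound[OF _ _ \<Gamma> _ y(2) _ _ \<delta>(1,2) res, unfolded Ec, folded A_def,
        OF step \<Gamma>y y1 start]
    have s1: "E.s m \<le> 1" if "real (Suc m) * \<tau> \<le> T" for m
      using unif(1)[OF that] y(2) by linarith
    have "l2_norm N h (dx_plus N h (E.e n)) + l2_norm N h (E.e n) \<le> 3 * E.s n"
      by (rule E.error_norm_bound)
    also have "\<dots> \<le> C * (exp (T / (2 * \<epsilon>)) * (h\<^sup>2 + \<tau>\<^sup>2 / \<epsilon>\<^sup>2))"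
      using E.convergence_rate[OF s1 unif(2) nT] unfolding C_def E.gronwall_const_def Ec(1)
      by (simp only: mult.assoc) simp
    finally have rate: "l2_norm N h (dx_plus N h e) + l2_norm N h e
        \<le> C * (exp (T / (2 * \<epsilon>)) * (h\<^sup>2 + \<tau>\<^sup>2 / \<epsilon>\<^sup>2))"
      by (simp add: e E.e_def[abs_def] E.x_def v(2))
    obtain j where j: "j < N" "linf_norm N (U n) = \<bar>U n j\<bar>" by (rule linf_norm_attained[OF N])
    have "real n * \<tau> \<le> T" using nT \<tau>(1) by (simp add: algebra_simps)
    have "\<bar>E.e n j\<bar> \<le> 1" using unif(2)[OF nT] j(1) by simp
    hence "\<bar>U n j\<bar> \<le> \<bar>u \<epsilon> (real n * \<tau>) (E.x j)\<bar> + 1" by (simp add: E.e_def v(2))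
    hence "ereal \<bar>U n j\<bar> \<le> ereal \<bar>u \<epsilon> (real n * \<tau>) (E.x j)\<bar> + 1" by (simp add: one_ereal_def)
    also have "\<dots> \<le> Linf_norm ({0..T} \<times> {a<..<b}) (\<lambda>(t, x). u \<epsilon> t x) + 1"
      using j(1) by (intro add_right_mono abs_le_cylinder_norm[OF assms(1,2) sol[OF eps]]
          E.time_mem E.x_mem \<open>real n * \<tau> \<le> T\<close>) auto
    finally show ?thesis using rate j(2) by simp
  qed
  show ?thesis
    unfolding Let_def
    by (intro exI[of _ \<mu>] conjI[OF \<mu>(1)] exI[of _ C] allI impI; rule main; (assumption | rule refl))
qed

end
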